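(* Let $T>0$, $\alpha>0$ and $\nu:=\alpha-1/2$, and let $z^{(\nu)}_k$, $k\in\mathbb{N}$, be the positive zeros of the Bessel function $J_\nu$ of the first kind. (1) If $(X^{(\alpha)}_t)_{t\in[0,T]}$ is the $\alpha$-Wiener bridge on $[0,T]$, then $$\mathsf{E}\exp\left\{-c\int_0^T(X^{(\alpha)}_u)^2\,du\right\}=\prod_{k=1}^\infty\frac{1}{\sqrt{1+2cT^2/(z^{(\nu)}_k)^2}},\qquad c\ge 0.$$ (2) If $(X^{(0)}_t)_{t\in[0,1]}$ is a standard Wiener process on $[0,1]$, then $$\mathsf{E}\exp\left\{-c\int_0^1(X^{(0)}_u)^2\,du\right\}=\frac{1}{\sqrt{\cosh(\sqrt{2c})}},\qquad c\ge 0.$$ (3) If $(X^{(1)}_t)_{t\in[0,1]}$ is the $\alpha$-Wiener bridge on $[0,1]$ with $\alpha=1$ (the usual Wiener bridge), then $$\mathsf{E}\exp\left\{-c\int_0^1(X^{(1)}_u)^2\,du\right\}=\sqrt{\frac{\sqrt{2c}}{\sinh(\sqrt{2c})}},\qquad c>0.$$ (4) If $(X^{(1/2)}_t)_{t\in[0,T]}$ is the $\alpha$-Wiener bridge on $[0,T]$ with $\alpha=1/2$, then for all $0<S<T$, $$\mathsf{E}\exp\left\{-c\int_0^S\frac{(X^{(1/2)}_u)^2}{(T-u)^2}\,du\right\}=\frac{1}{\sqrt{\cosh\left(\sqrt{2c}\,\ln\left(\frac{T}{T-S}\right)\right)}},\qquad c\ge 0.$$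
   Context: Let $(B_t)_{t\ge 0}$ be a standard Wiener process. For $\alpha>0$ and $T\in(0,\infty)$ the $\alpha$-Wiener bridge on $[0,T]$ is the process $X_t^{(\alpha)}=\int_0^t\big(\frac{T-t}{T-s}\big)^\alpha\,dB_s$, $t\in[0,T)$, i.e. the unique strong solution of $dX_t^{(\alpha)}=-\frac{\alpha}{T-t}X_t^{(\alpha)}\,dt+dB_t$, $X_0^{(\alpha)}=0$, extended by $X_T^{(\alpha)}=0$ (the extension is almost surely continuous on $[0,T]$). For $\alpha=0$ the same formula gives the standard Wiener process. The Bessel function of the first kind of order $\nu>-1$ is $J_\nu(x)=\sum_{k=0}^\infty\frac{(-1)^k}{k!\,\Gamma(k+\nu+1)}\big(\frac{x}{2}\big)^{2k+\nu}$, $x>0$; it has infinitely many positive zeros, all simple, listed increasingly as $0<z^{(\nu)}_1<z^{(\nu)}_2<\cdots$. *)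

theory Defs
  imports "HOL-Probability.Probability"
begin

definition wiener_process :: "'a measure \<Rightarrow> real set \<Rightarrow> (real \<Rightarrow> 'a \<Rightarrow> real) \<Rightarrow> bool" where
  "wiener_process M I B \<longleftrightarrow>
     prob_space M \<and>
     (\<forall>t\<in>I. B t \<in> borel_measurable M) \<and>
     (AE \<omega> in M. B 0 \<omega> = 0) \<and>
     (AE \<omega> in M. continuous_on I (\<lambda>t. B t \<omega>)) \<and>
     (\<forall>s\<in>I. \<forall>t\<in>I. s < t \<longrightarrow>
        distributed M lborel (\<lambda>\<omega>. B t \<omega> - B s \<omega>) (normal_density 0 (sqrt (t - s)))) \<and>
     (\<forall>n (p :: nat \<Rightarrow> real). (\<forall>i\<le>n. p i \<in> I) \<and> (\<forall>i<n. p i < p (Suc i)) \<longrightarrow>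
        prob_space.indep_vars M (\<lambda>_. borel) (\<lambda>i \<omega>. B (p (Suc i)) \<omega> - B (p i) \<omega>) {..<n})"

definition step_fun :: "nat \<Rightarrow> (nat \<Rightarrow> real) \<Rightarrow> (nat \<Rightarrow> real) \<Rightarrow> real \<Rightarrow> real" where
  "step_fun m p a s = (\<Sum>i<m. a i * indicator {p i<..p (Suc i)} s)"

definition step_integral ::
    "(real \<Rightarrow> 'a \<Rightarrow> real) \<Rightarrow> nat \<Rightarrow> (nat \<Rightarrow> real) \<Rightarrow> (nat \<Rightarrow> real) \<Rightarrow> 'a \<Rightarrow> real" where
  "step_integral B m p a \<omega> = (\<Sum>i<m. a i * (B (p (Suc i)) \<omega> - B (p i) \<omega>))"

text \<open>
  The random variable \<open>Y\<close> is a version of the stochastic integral of the deterministic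
  function \<open>f\<close> over \<open>[0, t]\<close> with respect to \<open>B\<close>: the mean-square limit of the elementary
  integrals of step functions converging to \<open>f\<close> in \<open>L\<^sup>2[0, t]\<close>. By the Ito isometry, \<open>Y\<close> is
  unique up to null sets and does not depend on the approximating sequence. The distances are
  nonnegative integrals, so that they are infinite, not 0, in the absence of square integrability.
\<close>

definition has_wiener_integral ::
    "'a measure \<Rightarrow> (real \<Rightarrow> 'a \<Rightarrow> real) \<Rightarrow> (real \<Rightarrow> real) \<Rightarrow> real \<Rightarrow> ('a \<Rightarrow> real) \<Rightarrow> bool" where
  "has_wiener_integral M B f t Y \<longleftrightarrow>
     set_borel_measurable lborel {0..t} f \<and> Y \<in> borel_measurable M \<and>
     (\<exists>(m :: nat \<Rightarrow> nat) (p :: nat \<Rightarrow> nat \<Rightarrow> real) (a :: nat \<Rightarrow> nat \<Rightarrow> real).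
        (\<forall>n. p n 0 = 0 \<and> p n (m n) = t \<and> (\<forall>i<m n. p n i < p n (Suc i))) \<and>
        (\<lambda>n. \<integral>\<^sup>+s\<in>{0..t}. ennreal ((f s - step_fun (m n) (p n) (a n) s)\<^sup>2) \<partial>lborel) \<longlonglongrightarrow> 0 \<and>
        (\<lambda>n. \<integral>\<^sup>+\<omega>. ennreal ((Y \<omega> - step_integral B (m n) (p n) (a n) \<omega>)\<^sup>2) \<partial>M) \<longlonglongrightarrow> 0)"

text \<open>
  The stochastic integrals determine each \<open>X t\<close> only up to a null set depending on \<open>t\<close>; the
  continuity requirement selects the version with almost surely continuous paths, that is, the
  strong solution of \<open>dX\<^sub>t = - \<alpha> / (T - t) X\<^sub>t dt + dB\<^sub>t\<close>, \<open>X\<^sub>0 = 0\<close>, extended by \<open>X\<^sub>T = 0\<close>.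
\<close>

definition alpha_wiener_bridge ::
    "'a measure \<Rightarrow> (real \<Rightarrow> 'a \<Rightarrow> real) \<Rightarrow> real \<Rightarrow> real \<Rightarrow> (real \<Rightarrow> 'a \<Rightarrow> real) \<Rightarrow> bool" where
  "alpha_wiener_bridge M B \<alpha> T X \<longleftrightarrow>
     (\<forall>t\<in>{0..<T}. has_wiener_integral M B (\<lambda>s. ((T - t) / (T - s)) powr \<alpha>) t (X t)) \<and>
     (AE \<omega> in M. X T \<omega> = 0) \<and>
     (AE \<omega> in M. continuous_on {0..T} (\<lambda>t. X t \<omega>))"

definition Bessel_J :: "real \<Rightarrow> real \<Rightarrow> real" where
  "Bessel_J \<nu> x =
     (\<Sum>k. (- 1) ^ k / (fact k * Gamma (real k + \<nu> + 1)) * (x / 2) powr (2 * real k + \<nu>))"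

text \<open>The listing starts at index 0: \<open>z k\<close> is the zero usually numbered \<open>k + 1\<close>.\<close>

definition lists_Bessel_zeros :: "real \<Rightarrow> (nat \<Rightarrow> real) \<Rightarrow> bool" where
  "lists_Bessel_zeros \<nu> z \<longleftrightarrow> strict_mono z \<and> range z = {x. 0 < x \<and> Bessel_J \<nu> x = 0}"

text \<open>
  The expectation is taken with respect to the completion of \<open>M\<close>. Paths are continuous only almost
  surely, so a functional of the whole path is measurable only up to a null set, and its Bochner
  integral over an incomplete \<open>M\<close> could be the default value 0. For functionals measurable
  with respect to \<open>M\<close> both integrals agree.
\<close>

definition path_expectation :: "'a measure \<Rightarrow> ('a \<Rightarrow> real) \<Rightarrow> real" where
  "path_expectation M F = (\<integral>\<omega>. F \<omega> \<partial>(completion M))"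

end

theory Submission
  imports Defs "HOL-Complex_Analysis.Complex_Analysis" "HOL-Real_Asymp.Real_Asymp"
begin

text \<open>The obstacle is that \<open>X\<close> is known only through mean-square limits, one time
  at a time, so that no joint law of its values is given. Two devices deal with this. First,
  integrating out a Gaussian increment of variance \<open>v\<close> turns a quadratic weight
  \<open>a\<close> into \<open>a / (1 + a * v)\<close>; writing weights as minus slope over value of
  \<open>\<phi>\<close> linearises this Riccati recursion, so the expectation is one and the same
  number on every grid. Second, mean value points make everything finite exact: one choice makes
  increments of \<open>\<phi>\<close> exact multiples of increments of \<open>\<tau>\<close>,
  another gives the approximating step integrals exactly the variances prescribed by
  \<open>\<tau>\<close>. What remains is pathwise convergence of exponents and dominated
  convergence; the bound 1 comes from \<open>\<phi>' \<le> 0\<close> and \<open>g \<ge> 0\<close>.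
  For the bridge, the solution regular at \<open>t = T\<close> is chosen, because its boundary
  coefficient vanishes as \<open>S\<close> tends to \<open>T\<close>. From
  \<open>\<alpha> > 0\<close> one gets \<open>\<nu> > - 1 / 2\<close>, where the coefficients of
  \<open>F\<close> are dominated by those of \<open>cosh (2 * sqrt z)\<close>; this is the source of
  the order 1/2. An order below 1 is what keeps an exponential factor out of the product.\<close>

text \<open>
  If \<open>Y\<close> has independent centred Gaussian increments with variance function \<open>\<tau>\<close>, and \<open>\<phi> > 0\<close> solves
  \<open>(\<phi>' / \<tau>')' = g \<phi>\<close> with \<open>\<phi>' \<le> 0\<close> on \<open>[0, S]\<close>, then
  \<open>E exp (- (\<integral> g Y\<^sup>2 - \<phi>'(S) / (\<tau>'(S) \<phi>(S)) Y\<^sub>S\<^sup>2) / 2) = sqrt (\<phi>(S) / \<phi>(0))\<close>, the integral being taken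
  over \<open>[0, S]\<close>. On a grid, the quadratic form whose weights are the second divided differences of
  \<open>\<phi>\<close> satisfies this identity exactly, because the Gaussian integrals telescope, and by the mean
  value theorem it is a Riemann sum for the integral. The bridge divided by \<open>(T - t)\<^sup>\<alpha>\<close> is such a
  process with \<open>\<tau>' = (T - t)\<^bsup>-2\<alpha>\<^esup>\<close>. For \<open>g = 2 c (T - t)\<^bsup>2\<alpha>\<^esup>\<close> the equation is solved by
  \<open>\<phi>(t) = F (c (T - t)\<^sup>2 / 2)\<close>, where \<open>F(z)\<close> is the normalized entire function obtained from
  \<open>J\<^sub>\<nu>\<close>, and \<open>S \<rightarrow> T\<close> gives the Laplace transform \<open>F(c T\<^sup>2 / 2)\<^bsup>-1/2\<^esup>\<close>. Since \<open>F\<close> has order 1/2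
  and only simple negative zeros, it is the product over its zeros.
\<close>

section \<open>Gaussian integrals over independent increments\<close>

text \<open>Completing the square: the weight times the density is a constant multiple of the normal
  density with mean \<open>m\<close> and standard deviation \<open>r\<close>, which has total mass
  1.\<close>

lemma nn_integral_gaussian_shift:
  fixes a c s :: real
  assumes a: "a \<ge> 0" and s: "s > 0"
  shows "(\<integral>\<^sup>+y. ennreal (exp (- (a * (c + y)\<^sup>2) / 2)) \<partial>density lborel (normal_density 0 s)) =
    ennreal (exp (- (a / (1 + a * s\<^sup>2) * c\<^sup>2) / 2) / sqrt (1 + a * s\<^sup>2))"
proof -
  define D where "D = 1 + a * s\<^sup>2"
  have D: "D > 0" using a s by (simp add: D_def add_pos_nonneg)
  define r where "r = s / sqrt D"
  define m where "m = - a * c * s\<^sup>2 / D"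
  have r: "r > 0" using s D by (simp add: r_def)
  have r2: "r\<^sup>2 = s\<^sup>2 / D" using D by (simp add: r_def power_divide)
  have eq: "normal_density 0 s y * exp (- (a * (c + y)\<^sup>2) / 2) =
     (exp (- (a / D * c\<^sup>2) / 2) / sqrt D) * normal_density m r y" for y
  proof -
    have 1: "- y\<^sup>2 / (2 * s\<^sup>2) + - (a * (c + y)\<^sup>2) / 2 = - (a / D * c\<^sup>2) / 2 + - (y - m)\<^sup>2 / (2 * r\<^sup>2)"
    proof -
      have "(y - m)\<^sup>2 / (2 * r\<^sup>2) = (D * y + a * c * s\<^sup>2)\<^sup>2 / (2 * s\<^sup>2 * D)"
        unfolding r2 m_def using D s by (simp add: field_simps power2_eq_square)
      also have "\<dots> = y\<^sup>2 / (2 * s\<^sup>2) + (a * (c + y)\<^sup>2) / 2 - (a / D * c\<^sup>2) / 2"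
      proof -
        have "(D * y + a * c * s\<^sup>2)\<^sup>2 = D * y\<^sup>2 + (a * (c + y)\<^sup>2) * (s\<^sup>2 * D) - (a * c\<^sup>2) * s\<^sup>2"
          unfolding D_def by algebra
        then show ?thesis using D s by (simp add: field_simps)
      qed
      finally show ?thesis by simp
    qed
    have 2: "sqrt (2 * pi * s\<^sup>2) = sqrt D * sqrt (2 * pi * r\<^sup>2)"
      unfolding r2 using D by (simp add: real_sqrt_mult[symmetric])
    show ?thesis
      unfolding normal_density_def 2 using 1
      by (simp add: exp_add[symmetric])
  qed
  have "(\<integral>\<^sup>+y. ennreal (exp (- (a * (c + y)\<^sup>2) / 2)) \<partial>density lborel (normal_density 0 s)) =
    (\<integral>\<^sup>+y. ennreal (normal_density 0 s y) * ennreal (exp (- (a * (c + y)\<^sup>2) / 2)) \<partial>lborel)"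
    by (subst nn_integral_density) auto
  also have "\<dots> = (\<integral>\<^sup>+y. ennreal (exp (- (a / D * c\<^sup>2) / 2) / sqrt D) * ennreal (normal_density m r y) \<partial>lborel)"
    using D by (intro nn_integral_cong) (subst (1 2) ennreal_mult[symmetric], simp_all only: eq, auto)
  also have "\<dots> = ennreal (exp (- (a / D * c\<^sup>2) / 2) / sqrt D) * (\<integral>\<^sup>+y. ennreal (normal_density m r y) \<partial>lborel)"
    by (rule nn_integral_cmult) auto
  also have "(\<integral>\<^sup>+y. ennreal (normal_density m r y) \<partial>lborel) = 1"
    using r by (subst nn_integral_eq_integral) auto
  finally show ?thesis by (simp add: D_def)
qed


text \<open>The integrand depends on \<open>x\<close> through the partial sums \<open>(\<Sum>i<j. x i)\<close>. With \<open>\<gamma>\<close> the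
  difference quotients of \<open>f\<close>, the weights are chosen so that integrating out the last variable reproduces the same formula
  with one variable less.\<close>

definition diff_exponent :: "nat \<Rightarrow> (nat \<Rightarrow> real) \<Rightarrow> (nat \<Rightarrow> real) \<Rightarrow> (nat \<Rightarrow> real) \<Rightarrow> real" where
  "diff_exponent m f \<gamma> y =
     (\<Sum>i<m. (\<gamma> (Suc i) - \<gamma> i) / f (Suc i) * (y (Suc i))\<^sup>2) - \<gamma> m / f (Suc m) * (y (Suc m))\<^sup>2"

lemma borel_measurable_diff_exponent:
  assumes "\<And>j. j \<le> Suc m \<Longrightarrow> (\<lambda>x. y x j) \<in> borel_measurable M"
  shows "(\<lambda>x. diff_exponent m f \<gamma> (y x)) \<in> borel_measurable M"
  unfolding diff_exponent_def using assms
  by (intro borel_measurable_diff borel_measurable_sum borel_measurable_times borel_measurable_const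
      borel_measurable_power) auto

text \<open>Increasing slopes make the inner weights nonnegative, and a nonpositive last slope does
  the same for the boundary weight. The resulting bound 1 for the exponential is what dominated
  convergence uses later.\<close>

lemma diff_exponent_nonneg:
  assumes "\<And>i. i \<le> Suc m \<Longrightarrow> f i > 0" "\<And>i. i < m \<Longrightarrow> \<gamma> i \<le> \<gamma> (Suc i)" "\<gamma> m \<le> 0"
  shows "diff_exponent m f \<gamma> y \<ge> 0"
proof -
  have "- \<gamma> m / f (Suc m) * (y (Suc m))\<^sup>2 \<ge> 0"
    using assms(1)[of "Suc m"] assms(3) by (intro mult_nonneg_nonneg divide_nonneg_nonneg) auto
  moreover have "(\<Sum>i<m. (\<gamma> (Suc i) - \<gamma> i) / f (Suc i) * (y (Suc i))\<^sup>2) \<ge> 0"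
    using assms(1,2) by (intro sum_nonneg mult_nonneg_nonneg divide_nonneg_nonneg) (auto intro: less_imp_le)
  ultimately show ?thesis unfolding diff_exponent_def by simp
qed

text \<open>Induction on the number of variables: integrating out the last one contributes
  \<open>\<gamma> (Suc k) / f (Suc k) * s^2\<close>, which cancels the
  \<open>\<gamma> (Suc k)\<close> in the last summand and leaves the boundary term of the shorter
  exponent. The factors \<open>sqrt (f (Suc k) / f k)\<close> telescope.\<close>

lemma nn_integral_PiM_diff_exponent:
  fixes f \<gamma> v :: "nat \<Rightarrow> real"
  assumes v: "\<And>i. v i > 0" and f: "\<And>i. i \<le> Suc m \<Longrightarrow> f i > 0"
    and "\<And>i. i \<le> m \<Longrightarrow> \<gamma> i \<le> 0" "\<And>i. i \<le> m \<Longrightarrow> f (Suc i) - f i = \<gamma> i * v i"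
  shows "(\<integral>\<^sup>+x. ennreal (exp (- diff_exponent m f \<gamma> (\<lambda>j. \<Sum>i<j. x i) / 2))
            \<partial>PiM {..<Suc m} (\<lambda>i. density lborel (normal_density 0 (sqrt (v i))))) =
         ennreal (sqrt (f (Suc m) / f 0))"
proof -
  define N where "N = (\<lambda>i. density lborel (normal_density 0 (sqrt (v i))))"
  interpret N: product_prob_space N UNIV
  proof (rule product_prob_spaceI)
    show "prob_space (N i)" for i unfolding N_def
      by (rule prob_space_normal_density) (use v in auto)
  qed
  have sets_N: "sets (N i) = sets borel" for i by (simp add: N_def)
  have meas: "(\<lambda>x. \<Sum>i<j. x i) \<in> borel_measurable (PiM {..<k} N)" if "j \<le> k" for j k
  proof (rule borel_measurable_sum)
    fix i assume "i \<in> {..<j}"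
    then have "(\<lambda>x. x i) \<in> measurable (PiM {..<k} N) (N i)"
      using that by (intro measurable_component_singleton) auto
    then show "(\<lambda>x. x i) \<in> borel_measurable (PiM {..<k} N)"
      using measurable_cong_sets[OF refl sets_N] by blast
  qed
  have gauss: "(\<integral>\<^sup>+y. ennreal (exp (- (- \<gamma> k / f (Suc k) * (s + y)\<^sup>2) / 2)) \<partial>N k) =
      ennreal (exp (\<gamma> k / f k * s\<^sup>2 / 2) * sqrt (f (Suc k) / f k))" if "k \<le> m" for k s
  proof -
    have *: "f k > 0" "f (Suc k) > 0" "\<gamma> k \<le> 0" "f (Suc k) - f k = \<gamma> k * v k" "v k > 0"
      using assms that by auto
    \<comment> \<open>With weight \<open>a = - \<gamma> k / f (Suc k)\<close> the relation
      \<open>f (Suc k) - f k = \<gamma> k * v k\<close> makes \<open>1 + a * v k\<close> a quotient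
      of consecutive values of \<open>f\<close>; hence the new weight is
      \<open>- \<gamma> k / f k\<close>.\<close>
    have 1: "1 + - \<gamma> k / f (Suc k) * (sqrt (v k))\<^sup>2 = f k / f (Suc k)" using * by (simp add: field_simps)
    have "- \<gamma> k / f (Suc k) \<ge> 0" using * by (intro divide_nonneg_nonneg) auto
    from nn_integral_gaussian_shift[OF this, of "sqrt (v k)" s, unfolded 1]
    show ?thesis using * by (simp add: real_sqrt_divide N_def)
  qed
  have meas_E: "(\<lambda>x. ennreal (exp (- diff_exponent k f \<gamma> (\<lambda>j. \<Sum>i<j. x i) / 2)))
      \<in> borel_measurable (PiM {..<Suc k} N)" for k
  proof -
    have [measurable]: "(\<lambda>x. diff_exponent k f \<gamma> (\<lambda>j. \<Sum>i<j. x i)) \<in> borel_measurable (PiM {..<Suc k} N)"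
      by (rule borel_measurable_diff_exponent) (rule meas)
    show ?thesis by measurable
  qed
  have "k \<le> m \<Longrightarrow> (\<integral>\<^sup>+x. ennreal (exp (- diff_exponent k f \<gamma> (\<lambda>j. \<Sum>i<j. x i) / 2)) \<partial>PiM {..<Suc k} N)
      = ennreal (sqrt (f (Suc k) / f 0))" for k
  proof (induction k)
    case 0
    have "(\<integral>\<^sup>+x. ennreal (exp (- diff_exponent 0 f \<gamma> (\<lambda>j. \<Sum>i<j. x i) / 2)) \<partial>PiM {..<Suc 0} N) =
      (\<integral>\<^sup>+x. (\<lambda>y. ennreal (exp (- (- \<gamma> 0 / f (Suc 0) * (0 + y)\<^sup>2) / 2))) (x 0) \<partial>PiM {0} N)"
      by (simp add: diff_exponent_def lessThan_Suc)
    also have "\<dots> = (\<integral>\<^sup>+y. ennreal (exp (- (- \<gamma> 0 / f (Suc 0) * (0 + y)\<^sup>2) / 2)) \<partial>N 0)"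
      by (rule N.product_nn_integral_singleton) (simp add: N_def)
    finally show ?case using gauss[of 0 0] by simp
  next
    case (Suc k)
    let ?E = "\<lambda>k x. exp (- diff_exponent k f \<gamma> (\<lambda>j. \<Sum>i<j. x i) / 2)"
    have "(\<integral>\<^sup>+x. ennreal (?E (Suc k) x) \<partial>PiM {..<Suc (Suc k)} N) =
      (\<integral>\<^sup>+x. ennreal (?E (Suc k) x) \<partial>PiM (insert (Suc k) {..<Suc k}) N)"
      by (simp only: lessThan_Suc[of "Suc k"])
    also have "\<dots> = (\<integral>\<^sup>+x. (\<integral>\<^sup>+y. ennreal (?E (Suc k) (x(Suc k := y))) \<partial>N (Suc k)) \<partial>PiM {..<Suc k} N)"
    proof (rule N.product_nn_integral_insert)
      show "(\<lambda>x. ennreal (?E (Suc k) x)) \<in> borel_measurable (PiM (insert (Suc k) {..<Suc k}) N)"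
        unfolding lessThan_Suc[of "Suc k", symmetric]
        by (rule meas_E)
    qed auto
    also have "\<dots> = (\<integral>\<^sup>+x. ennreal (?E k x) * ennreal (sqrt (f (Suc (Suc k)) / f (Suc k))) \<partial>PiM {..<Suc k} N)"
    proof (rule nn_integral_cong)
      fix x :: "nat \<Rightarrow> real"
      define s where "s = (\<Sum>i<Suc k. x i)"
      define A where "A = (\<Sum>i<Suc k. (\<gamma> (Suc i) - \<gamma> i) / f (Suc i) * (\<Sum>l<Suc i. x l)\<^sup>2)"
      have f: "f (Suc k) > 0" using assms Suc by auto
      have upd: "(\<Sum>i<j. (x(Suc k := y)) i) = (\<Sum>i<j. x i)" if "j \<le> Suc k" for j y
        using that by (intro sum.cong) auto
      have top: "(\<Sum>i<Suc (Suc k). (x(Suc k := y)) i) = s + y" for y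
        unfolding s_def by (subst sum.lessThan_Suc) (simp only: upd[OF order.refl], simp)
      have 1: "diff_exponent (Suc k) f \<gamma> (\<lambda>j. \<Sum>i<j. (x(Suc k := y)) i)
         = A + (- \<gamma> (Suc k) / f (Suc (Suc k)) * (s + y)\<^sup>2)" for y
      proof -
        have "(\<Sum>i<Suc k. (\<gamma> (Suc i) - \<gamma> i) / f (Suc i) * (\<Sum>l<Suc i. (x(Suc k := y)) l)\<^sup>2) = A"
          unfolding A_def by (intro sum.cong refl) (subst upd, auto)
        then show ?thesis unfolding diff_exponent_def top by simp
      qed
      have 2: "diff_exponent k f \<gamma> (\<lambda>j. \<Sum>i<j. x i) = A - \<gamma> (Suc k) / f (Suc k) * s\<^sup>2"
        using f unfolding diff_exponent_def A_def s_def
        by (subst (2) sum.lessThan_Suc) (simp add: field_simps)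
      have "(\<integral>\<^sup>+y. ennreal (?E (Suc k) (x(Suc k := y))) \<partial>N (Suc k)) =
        (\<integral>\<^sup>+y. ennreal (exp (- A / 2)) * ennreal (exp (- (- \<gamma> (Suc k) / f (Suc (Suc k)) * (s + y)\<^sup>2) / 2)) \<partial>N (Suc k))"
        unfolding 1 by (simp add: ennreal_mult[symmetric] exp_add[symmetric] diff_divide_distrib)
      also have "\<dots> = ennreal (exp (- A / 2)) *
          ennreal (exp (\<gamma> (Suc k) / f (Suc k) * s\<^sup>2 / 2) * sqrt (f (Suc (Suc k)) / f (Suc k)))"
        unfolding gauss[OF Suc.prems, symmetric] by (rule nn_integral_cmult) (simp add: N_def)
      also have "\<dots> = ennreal (?E k x) * ennreal (sqrt (f (Suc (Suc k)) / f (Suc k)))"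
        unfolding 2 using assms Suc
        by (subst (1 2) ennreal_mult[symmetric])
           (auto intro!: divide_nonneg_nonneg less_imp_le simp: mult.assoc[symmetric] exp_add[symmetric] diff_divide_distrib)
      finally show "(\<integral>\<^sup>+y. ennreal (?E (Suc k) (x(Suc k := y))) \<partial>N (Suc k)) =
        ennreal (?E k x) * ennreal (sqrt (f (Suc (Suc k)) / f (Suc k)))" .
    qed
    also have "\<dots> = (\<integral>\<^sup>+x. ennreal (?E k x) \<partial>PiM {..<Suc k} N) * ennreal (sqrt (f (Suc (Suc k)) / f (Suc k)))"
      by (rule nn_integral_multc) (rule meas_E)
    also have "\<dots> = ennreal (sqrt (f (Suc k) / f 0)) * ennreal (sqrt (f (Suc (Suc k)) / f (Suc k)))"
      using Suc by simp
    also have "\<dots> = ennreal (sqrt (f (Suc (Suc k)) / f 0))"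
    proof -
      have "f 0 > 0" "f (Suc k) > 0" "f (Suc (Suc k)) > 0" using assms Suc by auto
      then show ?thesis by (subst ennreal_mult[symmetric]) (auto simp: real_sqrt_mult[symmetric])
    qed
    finally show ?case .
  qed
  from this[of m] show ?thesis by (simp add: N_def)
qed

text \<open>Independence identifies the joint law of the increments with a product of normal laws,
  so the expectation becomes the product integral already computed.\<close>

lemma (in prob_space) expectation_exp_diff_exponent:
  fixes f \<gamma> v :: "nat \<Rightarrow> real"
  assumes indep: "indep_vars (\<lambda>_. borel) D {..<Suc m}"
    and D: "\<And>i. i \<le> m \<Longrightarrow> distributed M lborel (D i) (normal_density 0 (sqrt (v i)))"
    and v: "\<And>i. i \<le> m \<Longrightarrow> v i > 0" and f: "\<And>i. i \<le> Suc m \<Longrightarrow> f i > 0"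
    and \<gamma>: "\<And>i. i \<le> m \<Longrightarrow> \<gamma> i \<le> 0" "\<And>i. i \<le> m \<Longrightarrow> f (Suc i) - f i = \<gamma> i * v i"
  shows "expectation (\<lambda>\<omega>. exp (- diff_exponent m f \<gamma> (\<lambda>j. \<Sum>i<j. D i \<omega>) / 2)) = sqrt (f (Suc m) / f 0)"
proof -
  \<comment> \<open>The product integral asks for positive variances at all indices; the value 1
    beyond \<open>m\<close> is a dummy.\<close>
  define v' where "v' i = (if i \<le> m then v i else 1)" for i
  have rv: "\<And>i. i \<in> {..<Suc m} \<Longrightarrow> random_variable borel (D i)"
    using indep by (auto simp: indep_vars_def)
  have rv': "D i \<in> borel_measurable M" if "i \<le> m" for i using rv that by auto
  have mY: "(\<lambda>\<omega>. \<Sum>i<j. D i \<omega>) \<in> borel_measurable M" if "j \<le> Suc m" for j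
    using that by (intro borel_measurable_sum rv') auto
  have [measurable]: "(\<lambda>\<omega>. diff_exponent m f \<gamma> (\<lambda>j. \<Sum>i<j. D i \<omega>)) \<in> borel_measurable M"
    by (rule borel_measurable_diff_exponent) (rule mY)
  have eq: "distr M (PiM {..<Suc m} (\<lambda>_. borel)) (\<lambda>\<omega>. \<lambda>i\<in>{..<Suc m}. D i \<omega>) =
      PiM {..<Suc m} (\<lambda>i. density lborel (normal_density 0 (sqrt (v' i))))"
  proof -
    have "PiM {..<Suc m} (\<lambda>i. distr M borel (D i)) =
        PiM {..<Suc m} (\<lambda>i. density lborel (normal_density 0 (sqrt (v' i))))"
    proof (rule PiM_cong[OF refl])
      fix i assume "i \<in> {..<Suc m}"
      then have "distr M lborel (D i) = density lborel (normal_density 0 (sqrt (v' i)))"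
        using distributed_distr_eq_density[OF D[of i]] by (simp add: v'_def)
      moreover have "distr M lborel (D i) = distr M borel (D i)" by (rule distr_cong) auto
      ultimately show "distr M borel (D i) = density lborel (normal_density 0 (sqrt (v' i)))" by simp
    qed
    then show ?thesis
      using indep_vars_iff_distr_eq_PiM'[where I = "{..<Suc m}" and M' = "\<lambda>_. borel" and X = D, OF _ rv] indep
      by auto
  qed
  let ?g = "\<lambda>x. ennreal (exp (- diff_exponent m f \<gamma> (\<lambda>j. \<Sum>i<j. x i) / 2))"
  have mx: "(\<lambda>x. \<Sum>i<j. x i) \<in> borel_measurable (PiM {..<Suc m} (\<lambda>_. borel :: real measure))"
    if "j \<le> Suc m" for j
    using that by (intro borel_measurable_sum measurable_component_singleton) auto
  have [measurable]: "(\<lambda>x. diff_exponent m f \<gamma> (\<lambda>j. \<Sum>i<j. x i)) \<in> borel_measurable (PiM {..<Suc m} (\<lambda>_. borel))"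
    by (rule borel_measurable_diff_exponent) (rule mx)
  have "(\<integral>\<^sup>+\<omega>. ennreal (exp (- diff_exponent m f \<gamma> (\<lambda>j. \<Sum>i<j. D i \<omega>) / 2)) \<partial>M) =
     (\<integral>\<^sup>+\<omega>. ?g (\<lambda>i\<in>{..<Suc m}. D i \<omega>) \<partial>M)"
  proof (intro nn_integral_cong)
    fix \<omega>
    have "(\<Sum>i<j. D i \<omega>) = (\<Sum>i<j. (\<lambda>i\<in>{..<Suc m}. D i \<omega>) i)" if "j \<le> Suc m" for j
      using that by (intro sum.cong) auto
    then have "diff_exponent m f \<gamma> (\<lambda>j. \<Sum>i<j. D i \<omega>) = diff_exponent m f \<gamma> (\<lambda>j. \<Sum>i<j. (\<lambda>i\<in>{..<Suc m}. D i \<omega>) i)"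
      unfolding diff_exponent_def
      by (intro arg_cong2[where f="(-)"] sum.cong arg_cong2[where f="(*)"] arg_cong[where f=power2] refl) auto
    then show "ennreal (exp (- diff_exponent m f \<gamma> (\<lambda>j. \<Sum>i<j. D i \<omega>) / 2)) = ?g (\<lambda>i\<in>{..<Suc m}. D i \<omega>)"
      by simp
  qed
  also have "\<dots> = (\<integral>\<^sup>+x. ?g x \<partial>distr M (PiM {..<Suc m} (\<lambda>_. borel)) (\<lambda>\<omega>. \<lambda>i\<in>{..<Suc m}. D i \<omega>))"
    by (subst nn_integral_distr) (auto intro!: measurable_restrict rv')
  also have "\<dots> = ennreal (sqrt (f (Suc m) / f 0))"
    unfolding eq by (rule nn_integral_PiM_diff_exponent) (use assms in \<open>auto simp: v'_def\<close>)
  finally have "(\<integral>\<^sup>+\<omega>. ennreal (exp (- diff_exponent m f \<gamma> (\<lambda>j. \<Sum>i<j. D i \<omega>) / 2)) \<partial>M) = ennreal (sqrt (f (Suc m) / f 0))" .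
  then show ?thesis
    using f[of 0] f[of "Suc m"] by (subst integral_eq_nn_integral) auto
qed

section \<open>Quadratic functionals of processes with Gaussian increments\<close>

text \<open>The preimages of a set under \<open>f\<close> and \<open>g\<close> differ only inside a
  null set, and the completion contains all subsets of null sets.\<close>

lemma borel_measurable_completion_AE_eq:
  fixes f g :: "'a \<Rightarrow> real"
  assumes f: "f \<in> borel_measurable (completion M)" and eq: "AE x in M. f x = g x"
  shows "g \<in> borel_measurable (completion M)"
proof (rule measurableI)
  fix A :: "real set" assume "A \<in> sets borel"
  then have A: "f -` A \<inter> space (completion M) \<in> sets (completion M)"
    using f by (rule measurable_sets[rotated])
  show "g -` A \<inter> space (completion M) \<in> sets (completion M)"
  proof (rule completion.in_sets_AE[OF _ A])
    show "AE x in completion M. (x \<in> f -` A \<inter> space (completion M)) = (x \<in> g -` A \<inter> space (completion M))"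
      using AE_completion[OF eq] by eventually_elim auto
  qed auto
qed auto

text \<open>The limit is known only along almost every path, so \<open>f\<close> inherits
  measurability from the pointwise \<open>lim\<close> through completeness; the expectations then
  converge by domination with the constant 1.\<close>

lemma path_expectation_limit:
  fixes F :: "nat \<Rightarrow> 'a \<Rightarrow> real"
  assumes "prob_space M"
    and meas: "\<And>n. F n \<in> borel_measurable (completion M)"
    and bound: "\<And>n. AE \<omega> in M. \<bar>F n \<omega>\<bar> \<le> 1"
    and lim: "AE \<omega> in M. (\<lambda>n. F n \<omega>) \<longlonglongrightarrow> f \<omega>"
    and L: "(\<lambda>n. path_expectation M (F n)) \<longlonglongrightarrow> L"
  shows "f \<in> borel_measurable (completion M)" "path_expectation M f = L"
proof -
  interpret prob_space M by fact
  interpret C: prob_space "completion M" by standard (simp add: emeasure_space_1)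
  have "(\<lambda>\<omega>. lim (\<lambda>n. F n \<omega>)) \<in> borel_measurable (completion M)"
    using meas by (rule borel_measurable_lim_metric)
  moreover have "AE \<omega> in M. lim (\<lambda>n. F n \<omega>) = f \<omega>"
    using lim by eventually_elim (rule limI)
  ultimately show f: "f \<in> borel_measurable (completion M)"
    by (rule borel_measurable_completion_AE_eq)
  have "(\<lambda>n. path_expectation M (F n)) \<longlonglongrightarrow> path_expectation M f"
    unfolding path_expectation_def
    by (rule integral_dominated_convergence[where w = "\<lambda>_. 1"])
       (use f meas bound lim in \<open>auto intro: AE_completion\<close>)
  then show "path_expectation M f = L" using L by (rule LIMSEQ_unique)
qed

text \<open>There are \<open>Suc m\<close> cells, so the points with indices 0 to
  \<open>Suc m\<close> are exactly those that \<open>diff_exponent m\<close> refers to, and the mesh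
  is defined also for \<open>m = 0\<close>.\<close>

definition grid :: "real \<Rightarrow> nat \<Rightarrow> nat \<Rightarrow> real" where
  "grid S m j = S * real j / real (Suc m)"

lemma grid_0 [simp]: "grid S m 0 = 0"
  and grid_last [simp]: "grid S m (Suc m) = S"
  by (simp_all add: grid_def del: of_nat_Suc)

lemma grid_mono: "0 < S \<Longrightarrow> i < j \<Longrightarrow> grid S m i < grid S m j"
  by (simp add: grid_def divide_strict_right_mono)

lemma grid_mono': "0 < S \<Longrightarrow> i \<le> j \<Longrightarrow> grid S m i \<le> grid S m j"
  by (simp add: grid_def divide_right_mono)

lemma grid_nonneg: "0 < S \<Longrightarrow> 0 \<le> grid S m j"
  by (simp add: grid_def)

lemma grid_le: "0 < S \<Longrightarrow> j \<le> Suc m \<Longrightarrow> grid S m j \<le> S"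
  using grid_mono'[of S j "Suc m" m] by simp

lemma grid_Suc_diff: "grid S m (Suc i) - grid S m i = S / real (Suc m)"
proof -
  have "S * real (Suc i) - S * real i = S" by (simp add: algebra_simps)
  then show ?thesis unfolding grid_def diff_divide_distrib[symmetric] by simp
qed

section \<open>Riemann sums with tags between grid points\<close>

lemma LBINT_eq_integral:
  fixes k :: "real \<Rightarrow> real"
  assumes "continuous_on {a..b} k"
  shows "(LBINT u:{a..b}. k u) = integral {a..b} k"
  using assms by (intro set_borel_integral_eq_integral borel_integrable_atLeastAtMost')

text \<open>The cells of this Riemann sum run from one tag to the next, and each contains one grid
  point, where \<open>\<phi>\<close> and \<open>y\<close> are evaluated. By mean value theorems for
  \<open>G\<close> and for the indefinite integral \<open>\<Psi>\<close>, a summand and the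
  increment of \<open>\<Psi>\<close> are both the cell length times values of \<open>k1\<close> and
  \<open>k2\<close> at points of the same cell. Uniform continuity of \<open>k1\<close> and
  \<open>k2\<close> then suffices, so \<open>y\<close> need only be continuous.\<close>

lemma tagged_sum_tendsto:
  fixes G g \<phi> y :: "real \<Rightarrow> real"
  assumes S: "S > 0" and y: "continuous_on {0..S} y" and g: "continuous_on {0..S} g"
    and \<phi>: "continuous_on {0..S} \<phi>" "\<And>t. t \<in> {0..S} \<Longrightarrow> \<phi> t > 0"
    and G: "\<And>t. t \<in> {0..S} \<Longrightarrow> (G has_real_derivative g t * \<phi> t) (at t)"
    and \<xi>: "\<And>m i. i \<le> m \<Longrightarrow> grid S m i < \<xi> m i \<and> \<xi> m i < grid S m (Suc i)"
  shows "(\<lambda>m. diff_exponent m (\<lambda>i. \<phi> (grid S m i)) (\<lambda>i. G (\<xi> m i)) (\<lambda>j. y (grid S m j)))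
     \<longlonglongrightarrow> (LBINT u:{0..S}. g u * (y u)\<^sup>2) - G S / \<phi> S * (y S)\<^sup>2"
proof -
  define k1 where "k1 t = g t * \<phi> t" for t
  define k2 where "k2 t = (y t)\<^sup>2 / \<phi> t" for t
  define \<Psi> where "\<Psi> t = integral {0..t} (\<lambda>u. g u * (y u)\<^sup>2)" for t
  have ck1: "continuous_on {0..S} k1" unfolding k1_def by (intro continuous_intros g \<phi>)
  have ck2: "continuous_on {0..S} k2" unfolding k2_def using \<phi>
    by (intro continuous_intros y) (auto simp: less_imp_neq[symmetric])
  have k12: "k1 t * k2 t = g t * (y t)\<^sup>2" if "t \<in> {0..S}" for t
    using \<phi>(2)[OF that] by (simp add: k1_def k2_def)
  have ck: "continuous_on {0..S} (\<lambda>u. g u * (y u)\<^sup>2)" by (intro continuous_intros g y)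
  have \<Psi>': "(\<Psi> has_real_derivative g t * (y t)\<^sup>2) (at t within {0..S})" if "t \<in> {0..S}" for t
    unfolding \<Psi>_def by (rule integral_has_real_derivative[OF ck that])
  have mesh: "(\<lambda>m. S / real (Suc m)) \<longlonglongrightarrow> 0" by real_asymp
  have \<xi>0: "(\<lambda>m. \<xi> m 0) \<longlonglongrightarrow> 0"
  proof (rule tendsto_sandwich[OF _ _ tendsto_const mesh])
    show "\<forall>\<^sub>F m in sequentially. 0 \<le> \<xi> m 0"
      using \<xi>[of 0] by (intro always_eventually) (auto intro: less_imp_le)
    show "\<forall>\<^sub>F m in sequentially. \<xi> m 0 \<le> S / real (Suc m)"
      using \<xi>[of 0] grid_Suc_diff[of S _ 0] by (intro always_eventually) (auto intro: less_imp_le)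
  qed
  have \<xi>S: "(\<lambda>m. \<xi> m m) \<longlonglongrightarrow> S"
  proof (rule tendsto_sandwich[OF _ _ _ tendsto_const])
    show "\<forall>\<^sub>F m in sequentially. S - S / real (Suc m) \<le> \<xi> m m"
    proof (intro always_eventually allI)
      fix m show "S - S / real (Suc m) \<le> \<xi> m m"
        using \<xi>[of m m] grid_Suc_diff[of S m m] by simp
    qed
    show "\<forall>\<^sub>F m in sequentially. \<xi> m m \<le> S"
    proof (intro always_eventually allI)
      fix m show "\<xi> m m \<le> S" using \<xi>[of m m] by simp
    qed
    show "(\<lambda>m. S - S / real (Suc m)) \<longlonglongrightarrow> S" using tendsto_diff[OF tendsto_const mesh, of S] by simp
  qed
  have \<xi>in: "\<xi> m i \<in> {0..S}" if "i \<le> m" for m i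
    using \<xi>[OF that] grid_nonneg[OF S, of m i] grid_le[OF S, of "Suc i" m] that by auto
  have \<xi>mono: "\<xi> m i < \<xi> m (Suc i)" if "i < m" for m i
    using \<xi>[of i m] \<xi>[of "Suc i" m] that by auto
  define A where "A m = (\<Sum>i<m. (G (\<xi> m (Suc i)) - G (\<xi> m i)) / \<phi> (grid S m (Suc i)) * (y (grid S m (Suc i)))\<^sup>2)" for m
  have "(\<lambda>m. A m - (\<Psi> (\<xi> m m) - \<Psi> (\<xi> m 0))) \<longlonglongrightarrow> 0"
  proof (rule LIMSEQ_I)
    fix r :: real assume r: "r > 0"
    obtain K1 where K1: "\<And>t. t \<in> {0..S} \<Longrightarrow> \<bar>k1 t\<bar> \<le> K1" "K1 \<ge> 0"
      using compact_imp_bounded[OF compact_continuous_image[OF ck1 compact_Icc]] S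
      unfolding bounded_iff by (auto simp: image_iff) (metis abs_ge_zero atLeastAtMost_iff less_imp_le order.trans order_refl)
    obtain K2 where K2: "\<And>t. t \<in> {0..S} \<Longrightarrow> \<bar>k2 t\<bar> \<le> K2" "K2 \<ge> 0"
      using compact_imp_bounded[OF compact_continuous_image[OF ck2 compact_Icc]] S
      unfolding bounded_iff by (auto simp: image_iff) (metis abs_ge_zero atLeastAtMost_iff less_imp_le order.trans order_refl)
    \<comment> \<open>Chosen so that the error per unit length, \<open>e * K2 + K1 * e\<close>,
      stays below \<open>r / (2 * S)\<close>, hence below \<open>r / 2\<close> in total. The summand
      1 keeps the denominator positive.\<close>
    define e where "e = r / (2 * S * (K1 + K2 + 1))"
    have e: "e > 0" using r S K1 K2 by (simp add: e_def)
    obtain d1 where d1: "d1 > 0" "\<And>s t. s \<in> {0..S} \<Longrightarrow> t \<in> {0..S} \<Longrightarrow> \<bar>s - t\<bar> < d1 \<Longrightarrow> \<bar>k1 s - k1 t\<bar> < e"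
      using compact_uniformly_continuous[OF ck1 compact_Icc] e
      unfolding uniformly_continuous_on_def dist_real_def by metis
    obtain d2 where d2: "d2 > 0" "\<And>s t. s \<in> {0..S} \<Longrightarrow> t \<in> {0..S} \<Longrightarrow> \<bar>s - t\<bar> < d2 \<Longrightarrow> \<bar>k2 s - k2 t\<bar> < e"
      using compact_uniformly_continuous[OF ck2 compact_Icc] e
      unfolding uniformly_continuous_on_def dist_real_def by metis
    have "\<forall>\<^sub>F m in sequentially. S / real (Suc m) < min d1 d2 / 2"
      by (rule order_tendstoD(2)[OF mesh]) (use d1(1) d2(1) in auto)
    then obtain m0 where m0: "\<And>m. m \<ge> m0 \<Longrightarrow> S / real (Suc m) < min d1 d2 / 2"
      unfolding eventually_sequentially by blast
    have "\<bar>A m - (\<Psi> (\<xi> m m) - \<Psi> (\<xi> m 0))\<bar> < r" if m: "m \<ge> m0" for m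
    proof -
      have tel: "\<Psi> (\<xi> m m) - \<Psi> (\<xi> m 0) = (\<Sum>i<m. \<Psi> (\<xi> m (Suc i)) - \<Psi> (\<xi> m i))"
        by (rule sum_lessThan_telescope[symmetric])
      have step: "\<bar>(G (\<xi> m (Suc i)) - G (\<xi> m i)) / \<phi> (grid S m (Suc i)) * (y (grid S m (Suc i)))\<^sup>2
           - (\<Psi> (\<xi> m (Suc i)) - \<Psi> (\<xi> m i))\<bar> \<le> r / (2 * S) * (\<xi> m (Suc i) - \<xi> m i)" if i: "i < m" for i
      proof -
        let ?a = "\<xi> m i" and ?b = "\<xi> m (Suc i)" and ?t = "grid S m (Suc i)"
        have ab: "?a < ?b" "?a \<in> {0..S}" "?b \<in> {0..S}" using \<xi>mono[OF i] \<xi>in[of i m] \<xi>in[of "Suc i" m] i by auto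
        have t: "?a < ?t" "?t < ?b" using \<xi>[of i m] \<xi>[of "Suc i" m] i by auto
        \<comment> \<open>Consecutive tags lie in adjacent grid cells and are less than two meshes
          apart; this is why the mesh was taken below half of \<open>min d1 d2\<close>.\<close>
        have len: "?b - ?a < min d1 d2"
          using \<xi>[of i m] \<xi>[of "Suc i" m] i grid_Suc_diff[of S m i] grid_Suc_diff[of S m "Suc i"] m0[OF m]
          by linarith
        obtain p where p: "p > ?a" "p < ?b" "G ?b - G ?a = (?b - ?a) * k1 p"
          using MVT2[OF ab(1), of G k1] G ab unfolding k1_def by auto
        obtain q where q: "q \<in> {?a<..<?b}" "\<Psi> ?b - \<Psi> ?a = g q * (y q)\<^sup>2 * (?b - ?a)"
        proof -
          have "\<exists>x\<in>{?a<..<?b}. \<Psi> ?b - \<Psi> ?a = (*) (g x * (y x)\<^sup>2) (?b - ?a)"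
          proof (rule mvt_simple[OF ab(1)])
            fix x assume "?a \<le> x" "x \<le> ?b"
            then show "(\<Psi> has_derivative (*) (g x * (y x)\<^sup>2)) (at x within {?a..?b})"
              using \<Psi>'[of x] ab unfolding has_field_derivative_def
              by (auto elim!: has_derivative_subset)
          qed
          then show ?thesis using that by blast
        qed
        have mem: "p \<in> {0..S}" "q \<in> {0..S}" "?t \<in> {0..S}" using p q t ab by auto
        have "(G ?b - G ?a) / \<phi> ?t * (y ?t)\<^sup>2 = (?b - ?a) * (k1 p * k2 ?t)"
          unfolding p k2_def by simp
        moreover have "\<Psi> ?b - \<Psi> ?a = (?b - ?a) * (k1 q * k2 q)"
          using q(2) k12[OF mem(2)] by simp
        ultimately have "\<bar>(G ?b - G ?a) / \<phi> ?t * (y ?t)\<^sup>2 - (\<Psi> ?b - \<Psi> ?a)\<bar> = \<bar>(?b - ?a) * (k1 p * k2 ?t - k1 q * k2 q)\<bar>"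
          by (simp add: right_diff_distrib)
        also have "\<dots> = (?b - ?a) * \<bar>k1 p * k2 ?t - k1 q * k2 q\<bar>" using ab by (simp add: abs_mult)
        also have "\<dots> \<le> (?b - ?a) * (r / (2 * S))"
        proof (rule mult_left_mono)
          have "k1 p * k2 ?t - k1 q * k2 q = (k1 p - k1 q) * k2 ?t + k1 q * (k2 ?t - k2 q)" by algebra
          then have "\<bar>k1 p * k2 ?t - k1 q * k2 q\<bar> \<le> \<bar>k1 p - k1 q\<bar> * \<bar>k2 ?t\<bar> + \<bar>k1 q\<bar> * \<bar>k2 ?t - k2 q\<bar>"
            by (metis abs_mult abs_triangle_ineq)
          also have "\<dots> \<le> e * K2 + K1 * e"
            using d1(2)[of p q] d2(2)[of ?t q] mem p q t len K1 K2 e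
            by (intro add_mono mult_mono) (auto intro: less_imp_le)
          also have "\<dots> \<le> e * (K1 + K2 + 1)" using e by (simp add: algebra_simps)
          also have "\<dots> = r / (2 * S)" using K1(2) K2(2) by (simp add: e_def)
          finally show "\<bar>k1 p * k2 ?t - k1 q * k2 q\<bar> \<le> r / (2 * S)" .
        qed (use ab in auto)
        finally show ?thesis by (simp add: mult.commute)
      qed
      have "\<bar>A m - (\<Psi> (\<xi> m m) - \<Psi> (\<xi> m 0))\<bar> \<le> (\<Sum>i<m. r / (2 * S) * (\<xi> m (Suc i) - \<xi> m i))"
        unfolding tel A_def sum_subtractf[symmetric]
        by (rule order.trans[OF sum_abs sum_mono]) (use step in auto)
      also have "\<dots> = r / (2 * S) * (\<xi> m m - \<xi> m 0)"
        by (simp only: sum_distrib_left[symmetric] sum_lessThan_telescope)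
      also have "\<dots> \<le> r / (2 * S) * S"
        using \<xi>in[of m m] \<xi>in[of 0 m] S r by (intro mult_left_mono) auto
      also have "\<dots> < r" using S r by simp
      finally show ?thesis .
    qed
    then show "\<exists>no. \<forall>n\<ge>no. norm (A n - (\<Psi> (\<xi> n n) - \<Psi> (\<xi> n 0)) - 0) < r" by auto
  qed
  moreover have "(\<lambda>m. \<Psi> (\<xi> m m) - \<Psi> (\<xi> m 0)) \<longlonglongrightarrow> \<Psi> S - \<Psi> 0"
  proof -
    have c\<Psi>: "continuous_on {0..S} \<Psi>" using \<Psi>' by (rule DERIV_continuous_on)
    show ?thesis
      by (intro tendsto_diff continuous_on_tendsto_compose[OF c\<Psi>] \<xi>S \<xi>0)
         (use S \<xi>in in \<open>auto intro!: always_eventually\<close>)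
  qed
  ultimately have "A \<longlonglongrightarrow> \<Psi> S - \<Psi> 0" using tendsto_add by fastforce
  moreover have "\<Psi> S - \<Psi> 0 = (LBINT u:{0..S}. g u * (y u)\<^sup>2)"
    unfolding \<Psi>_def by (simp add: LBINT_eq_integral[OF ck])
  moreover have "(\<lambda>m. G (\<xi> m m)) \<longlonglongrightarrow> G S"
    using DERIV_isCont[OF G[of S]] S \<xi>S isCont_tendsto_compose by fastforce
  ultimately have "(\<lambda>m. A m - G (\<xi> m m) / \<phi> S * (y S)\<^sup>2) \<longlonglongrightarrow> (LBINT u:{0..S}. g u * (y u)\<^sup>2) - G S / \<phi> S * (y S)\<^sup>2"
    using \<phi>(2)[of S] S by (intro tendsto_intros) auto
  then show ?thesis unfolding diff_exponent_def A_def by simp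
qed

text \<open>Instead of the joint law, this records the one consequence that is used: the exact
  Gaussian identity on uniform grids, with \<open>\<tau>\<close> as variance function. Its
  functionals are bounded and Lipschitz, so the property passes directly to mean-square
  limits.\<close>

definition gaussian_increments :: "'a measure \<Rightarrow> (real \<Rightarrow> 'a \<Rightarrow> real) \<Rightarrow> (real \<Rightarrow> real) \<Rightarrow> real \<Rightarrow> bool" where
  "gaussian_increments M Y \<tau> S \<longleftrightarrow>
     (\<forall>m f \<gamma>. (\<forall>i\<le>Suc m. f i > 0) \<and> (\<forall>i\<le>m. \<gamma> i \<le> 0) \<and> (\<forall>i<m. \<gamma> i \<le> \<gamma> (Suc i)) \<and>
        (\<forall>i\<le>m. f (Suc i) - f i = \<gamma> i * (\<tau> (grid S m (Suc i)) - \<tau> (grid S m i))) \<longrightarrow>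
        (\<integral>\<omega>. exp (- diff_exponent m f \<gamma> (\<lambda>j. Y (grid S m j) \<omega>) / 2) \<partial>M) = sqrt (f (Suc m) / f 0))"

text \<open>Here \<open>G\<close> is \<open>\<phi>' / \<tau>'\<close>. With slopes
  \<open>G (\<xi> m i)\<close> and values of \<open>\<phi>\<close> on the grid, the conditions of
  \<open>gaussian_increments\<close> hold exactly, so the expectation is the same constant for every
  \<open>m\<close> and only the exponent has to converge.\<close>

lemma path_expectation_exp_quadratic:
  fixes G g \<phi> \<tau> h :: "real \<Rightarrow> real"
  assumes M: "prob_space M" and S: "S > 0"
    and Y: "\<And>t. t \<in> {0..S} \<Longrightarrow> Y t \<in> borel_measurable M"
    and cont: "AE \<omega> in M. continuous_on {0..S} (\<lambda>t. Y t \<omega>)"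
    and gauss: "gaussian_increments M Y \<tau> S"
    and \<tau>: "\<And>t. t \<in> {0..S} \<Longrightarrow> (\<tau> has_real_derivative h t) (at t)" "\<And>t. t \<in> {0..S} \<Longrightarrow> h t > 0"
    and \<phi>: "\<And>t. t \<in> {0..S} \<Longrightarrow> (\<phi> has_real_derivative G t * h t) (at t)" "\<And>t. t \<in> {0..S} \<Longrightarrow> \<phi> t > 0"
    and G: "\<And>t. t \<in> {0..S} \<Longrightarrow> (G has_real_derivative g t * \<phi> t) (at t)" "\<And>t. t \<in> {0..S} \<Longrightarrow> G t \<le> 0"
    and g: "continuous_on {0..S} g" "\<And>t. t \<in> {0..S} \<Longrightarrow> g t \<ge> 0"
  defines "F \<equiv> \<lambda>\<omega>. exp (- ((LBINT u:{0..S}. g u * (Y u \<omega>)\<^sup>2) - G S / \<phi> S * (Y S \<omega>)\<^sup>2) / 2)"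
  shows "F \<in> borel_measurable (completion M)" "path_expectation M F = sqrt (\<phi> S / \<phi> 0)"
proof -
  have mem: "grid S m j \<in> {0..S}" if "j \<le> Suc m" for m j
    using grid_nonneg[OF S] grid_le[OF S that] by auto
  have "\<exists>x. grid S m i < x \<and> x < grid S m (Suc i) \<and>
      \<phi> (grid S m (Suc i)) - \<phi> (grid S m i) = G x * (\<tau> (grid S m (Suc i)) - \<tau> (grid S m i))" if "i \<le> m" for m i
  proof -
    let ?a = "grid S m i" and ?b = "grid S m (Suc i)"
    have ab: "?a < ?b" using grid_mono[OF S] by simp
    have mem_ab: "x \<in> {0..S}" if "?a \<le> x" "x \<le> ?b" for x
      using mem[of i m] mem[of "Suc i" m] \<open>i \<le> m\<close> that by auto
    \<comment> \<open>Cauchy's mean value theorem for the pair \<open>\<phi>\<close>,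
      \<open>\<tau>\<close>; the common factor \<open>h c\<close> is positive and cancels, leaving
      the slope \<open>G c\<close>.\<close>
    have "\<exists>c. ?a < c \<and> c < ?b \<and> (\<phi> ?b - \<phi> ?a) * h c = (\<tau> ?b - \<tau> ?a) * (G c * h c)"
      by (rule GMVT'[OF ab]) (use mem_ab \<tau>(1) \<phi>(1) in \<open>auto intro!: DERIV_isCont\<close>)
    then obtain c where c: "?a < c" "c < ?b" "(\<phi> ?b - \<phi> ?a) * h c = (\<tau> ?b - \<tau> ?a) * (G c * h c)"
      by blast
    have "h c \<noteq> 0" using \<tau>(2)[of c] mem_ab c by force
    then have "\<phi> ?b - \<phi> ?a = G c * (\<tau> ?b - \<tau> ?a)" using c(3) by (simp add: ac_simps)
    then show ?thesis using c by blast
  qed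
  note ex = this
  define \<xi> where "\<xi> m i = (SOME x. grid S m i < x \<and> x < grid S m (Suc i) \<and>
      \<phi> (grid S m (Suc i)) - \<phi> (grid S m i) = G x * (\<tau> (grid S m (Suc i)) - \<tau> (grid S m i)))" for m i
  have \<xi>: "grid S m i < \<xi> m i \<and> \<xi> m i < grid S m (Suc i)"
    and \<xi>eq: "\<phi> (grid S m (Suc i)) - \<phi> (grid S m i) = G (\<xi> m i) * (\<tau> (grid S m (Suc i)) - \<tau> (grid S m i))"
    if "i \<le> m" for m i
    using someI_ex[OF ex[OF that]] unfolding \<xi>_def by blast+
  define E where "E m \<omega> = diff_exponent m (\<lambda>i. \<phi> (grid S m i)) (\<lambda>i. G (\<xi> m i)) (\<lambda>j. Y (grid S m j) \<omega>)" for m \<omega>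
  have \<xi>mem: "\<xi> m i \<in> {0..S}" if "i \<le> m" for m i
    using \<xi>[OF that] mem[of i m] mem[of "Suc i" m] that by auto
  have Gmono: "G (\<xi> m i) \<le> G (\<xi> m (Suc i))" if "i < m" for m i
  proof (rule DERIV_nonneg_imp_nondecreasing[where f = G])
    show "\<xi> m i \<le> \<xi> m (Suc i)" using \<xi>[of i m] \<xi>[of "Suc i" m] that by auto
    fix x assume "\<xi> m i \<le> x" "x \<le> \<xi> m (Suc i)"
    then have "x \<in> {0..S}" using \<xi>mem[of i m] \<xi>mem[of "Suc i" m] that by auto
    then show "\<exists>y. (G has_real_derivative y) (at x) \<and> 0 \<le> y"
      using G(1) g(2) less_imp_le[OF \<phi>(2)]
      by (intro exI[of _ "g x * \<phi> x"]) (auto intro!: mult_nonneg_nonneg)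
  qed
  have E0: "E m \<omega> \<ge> 0" for m \<omega>
    unfolding E_def using Gmono G(2) \<xi>mem \<phi>(2) mem by (intro diff_exponent_nonneg) auto
  have [measurable]: "E m \<in> borel_measurable M" for m
    unfolding E_def by (intro borel_measurable_diff_exponent Y mem)
  have c\<phi>: "continuous_on {0..S} \<phi>"
    by (rule continuous_at_imp_continuous_on) (use DERIV_isCont[OF \<phi>(1)] in auto)
  have meas: "(\<lambda>\<omega>. exp (- E m \<omega> / 2)) \<in> borel_measurable M" for m by measurable
  have exp_E: "path_expectation M (\<lambda>\<omega>. exp (- E m \<omega> / 2)) = sqrt (\<phi> S / \<phi> 0)" for m
  proof -
    have "(\<integral>\<omega>. exp (- E m \<omega> / 2) \<partial>M) = sqrt (\<phi> (grid S m (Suc m)) / \<phi> (grid S m 0))"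
      unfolding E_def
    proof (rule gauss[unfolded gaussian_increments_def, rule_format], intro conjI allI impI)
      show "\<phi> (grid S m i) > 0" if "i \<le> Suc m" for i using \<phi>(2) mem that by simp
      show "G (\<xi> m i) \<le> 0" if "i \<le> m" for i using G(2) \<xi>mem that by simp
    qed (use Gmono \<xi>eq in simp_all)
    then show ?thesis using integral_completion[OF meas] by (simp add: path_expectation_def)
  qed
  have lim: "AE \<omega> in M. (\<lambda>m. exp (- E m \<omega> / 2)) \<longlonglongrightarrow> F \<omega>"
    using cont
  proof eventually_elim
    case (elim \<omega>)
    have "(\<lambda>m. E m \<omega>) \<longlonglongrightarrow> (LBINT u:{0..S}. g u * (Y u \<omega>)\<^sup>2) - G S / \<phi> S * (Y S \<omega>)\<^sup>2"
      unfolding E_def by (rule tagged_sum_tendsto[OF S elim g(1) c\<phi> \<phi>(2) G(1) \<xi>])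
    then show ?case unfolding F_def by (intro tendsto_intros) auto
  qed
  have bound: "AE \<omega> in M. \<bar>exp (- E m \<omega> / 2)\<bar> \<le> 1" for m using E0[of m] by simp
  have "(\<lambda>m. path_expectation M (\<lambda>\<omega>. exp (- E m \<omega> / 2))) \<longlonglongrightarrow> sqrt (\<phi> S / \<phi> 0)"
    unfolding exp_E by simp
  note path_expectation_limit[OF M measurable_completion[OF meas] bound lim this]
  then show "F \<in> borel_measurable (completion M)" "path_expectation M F = sqrt (\<phi> S / \<phi> 0)"
    by auto
qed

section \<open>The Wiener integral\<close>

lemma wiener_increment_second_moment:
  assumes B: "wiener_process M I B" and st: "s \<in> I" "t \<in> I"
  shows "has_bochner_integral M (\<lambda>\<omega>. (B t \<omega> - B s \<omega>)\<^sup>2) \<bar>t - s\<bar>"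
proof -
  interpret prob_space M using B by (simp add: wiener_process_def)
  have *: "has_bochner_integral M (\<lambda>\<omega>. (B t \<omega> - B s \<omega>)\<^sup>2) (t - s)" if st: "s \<in> I" "t \<in> I" "s < t" for s t
  proof -
    have D: "distributed M lborel (\<lambda>\<omega>. B t \<omega> - B s \<omega>) (normal_density 0 (sqrt (t - s)))"
      using B st unfolding wiener_process_def by blast
    have [simp]: "sqrt (t - s) > 0" using st by simp
    have m: "has_bochner_integral lborel (\<lambda>x. normal_density 0 (sqrt (t - s)) x * x\<^sup>2) (t - s)"
    proof -
      have "fact (2 * 1) / ((2 / (sqrt (t - s))\<^sup>2) ^ 1 * fact 1) = t - s"
        using st by (simp add: field_simps)
      then show ?thesis using normal_moment_even[of "sqrt (t - s)" 0 1] st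
        by (simp only: mult_1_right diff_zero) auto
    qed
    have "integrable M (\<lambda>\<omega>. (B t \<omega> - B s \<omega>)\<^sup>2)"
      using distributed_integrable[OF D, of "\<lambda>x. x\<^sup>2"] m by (auto simp: has_bochner_integral_iff)
    moreover have "expectation (\<lambda>\<omega>. (B t \<omega> - B s \<omega>)\<^sup>2) = t - s"
      using distributed_integral[OF D, of "\<lambda>x. x\<^sup>2"] m by (auto simp: has_bochner_integral_iff)
    ultimately show ?thesis by (simp add: has_bochner_integral_iff)
  qed
  show ?thesis
  proof (cases s t rule: linorder_cases)
    case greater
    then show ?thesis using *[of t s] st by (simp add: power2_commute)
  qed (use * st in \<open>auto simp: has_bochner_integral_zero\<close>)
qed

text \<open>Polarization: the product of two increments is half a signed sum of four squared
  increments. Absolute values in the second moment spare any case distinction on the order of the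
  endpoints.\<close>

lemma wiener_increment_covariance:
  assumes B: "wiener_process M I B" and I: "l \<in> I" "r \<in> I" "l' \<in> I" "r' \<in> I"
  shows "has_bochner_integral M (\<lambda>\<omega>. (B r \<omega> - B l \<omega>) * (B r' \<omega> - B l' \<omega>))
    ((\<bar>r - l'\<bar> + \<bar>l - r'\<bar> - \<bar>r - r'\<bar> - \<bar>l - l'\<bar>) / 2)"
proof -
  have "has_bochner_integral M (\<lambda>\<omega>. ((B r \<omega> - B l' \<omega>)\<^sup>2 + (B l \<omega> - B r' \<omega>)\<^sup>2 - (B r \<omega> - B r' \<omega>)\<^sup>2 - (B l \<omega> - B l' \<omega>)\<^sup>2) / 2)
     ((\<bar>r - l'\<bar> + \<bar>l - r'\<bar> - \<bar>r - r'\<bar> - \<bar>l - l'\<bar>) / 2)"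
    by (intro has_bochner_integral_divide has_bochner_integral_diff has_bochner_integral_add
        wiener_increment_second_moment[OF B] I)
  moreover have "((B r \<omega> - B l' \<omega>)\<^sup>2 + (B l \<omega> - B r' \<omega>)\<^sup>2 - (B r \<omega> - B r' \<omega>)\<^sup>2 - (B l \<omega> - B l' \<omega>)\<^sup>2) / 2 =
    (B r \<omega> - B l \<omega>) * (B r' \<omega> - B l' \<omega>)" for \<omega>
    by (simp add: power2_eq_square field_simps)
  ultimately show ?thesis by simp
qed

text \<open>The overlap length of two intervals is written in the same form as the covariance of
  increments, so that the isometry reduces to equality of coefficients.\<close>

lemma has_bochner_integral_indicator_Ioc_mult:
  fixes l r l' r' :: real
  assumes "l \<le> r" "l' \<le> r'"
  shows "has_bochner_integral lborel (\<lambda>s. indicator {l<..r} s * indicator {l'<..r'} s :: real)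
    ((\<bar>r - l'\<bar> + \<bar>l - r'\<bar> - \<bar>r - r'\<bar> - \<bar>l - l'\<bar>) / 2)"
proof -
  have "(\<lambda>s. indicator {l<..r} s * indicator {l'<..r'} s :: real) = indicator {max l l'<..min r r'}"
    by (auto simp: indicator_def fun_eq_iff)
  moreover have "has_bochner_integral lborel (indicator {max l l'<..min r r'} :: real \<Rightarrow> real)
      (measure lborel {max l l'<..min r r'})"
    by (rule has_bochner_integral_real_indicator) (auto intro: le_less_trans[OF emeasure_mono[of _ "{min l r'..max l r'}"]])
  moreover have "measure lborel {max l l'<..min r r'} = (\<bar>r - l'\<bar> + \<bar>l - r'\<bar> - \<bar>r - r'\<bar> - \<bar>l - l'\<bar>) / 2"
    using assms by (cases "max l l' \<le> min r r'") (auto simp: max_def min_def split: if_splits)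
  ultimately show ?thesis by simp
qed

text \<open>Both sides expand into the same double sum. The intervals may overlap, so step functions
  over different partitions can be subtracted without a common refinement.\<close>

lemma wiener_isometry:
  fixes a l r :: "'i \<Rightarrow> real"
  assumes B: "wiener_process M I B" and "finite J"
    and J: "\<And>i. i \<in> J \<Longrightarrow> l i \<in> I \<and> r i \<in> I \<and> l i \<le> r i"
  shows "(\<integral>\<^sup>+\<omega>. ennreal ((\<Sum>i\<in>J. a i * (B (r i) \<omega> - B (l i) \<omega>))\<^sup>2) \<partial>M) =
    (\<integral>\<^sup>+s. ennreal ((\<Sum>i\<in>J. a i * indicator {l i<..r i} s)\<^sup>2) \<partial>lborel)"
proof -
  define C where "C i j = a i * a j * ((\<bar>r i - l j\<bar> + \<bar>l i - r j\<bar> - \<bar>r i - r j\<bar> - \<bar>l i - l j\<bar>) / 2)" for i j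
  have 1: "has_bochner_integral M (\<lambda>\<omega>. (\<Sum>i\<in>J. a i * (B (r i) \<omega> - B (l i) \<omega>))\<^sup>2) (\<Sum>i\<in>J. \<Sum>j\<in>J. C i j)"
  proof -
    have "has_bochner_integral M (\<lambda>\<omega>. \<Sum>i\<in>J. \<Sum>j\<in>J. a i * a j * ((B (r i) \<omega> - B (l i) \<omega>) * (B (r j) \<omega> - B (l j) \<omega>)))
        (\<Sum>i\<in>J. \<Sum>j\<in>J. C i j)"
      unfolding C_def using J
      by (intro has_bochner_integral_sum has_bochner_integral_mult_right wiener_increment_covariance[OF B]) auto
    then show ?thesis by (simp add: power2_eq_square sum_product mult_ac)
  qed
  have 2: "has_bochner_integral lborel (\<lambda>s. (\<Sum>i\<in>J. a i * indicator {l i<..r i} s)\<^sup>2) (\<Sum>i\<in>J. \<Sum>j\<in>J. C i j)"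
  proof -
    have "has_bochner_integral lborel (\<lambda>s. \<Sum>i\<in>J. \<Sum>j\<in>J. a i * a j * (indicator {l i<..r i} s * indicator {l j<..r j} s))
        (\<Sum>i\<in>J. \<Sum>j\<in>J. C i j)"
      unfolding C_def using J
      by (intro has_bochner_integral_sum has_bochner_integral_mult_right has_bochner_integral_indicator_Ioc_mult) auto
    then show ?thesis by (simp add: power2_eq_square sum_product mult_ac)
  qed
  show ?thesis
    using 1 2 by (simp add: has_bochner_integral_iff nn_integral_eq_integral)
qed

text \<open>The two partitions are joined into one family over the disjoint union of their index
  sets, the second with negated coefficients.\<close>

lemma step_integral_isometry:
  assumes B: "wiener_process M I B"
    and p: "\<And>i. i \<le> m \<Longrightarrow> p i \<in> I" "\<And>i. i < m \<Longrightarrow> p i \<le> p (Suc i)"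
    and p': "\<And>i. i \<le> m' \<Longrightarrow> p' i \<in> I" "\<And>i. i < m' \<Longrightarrow> p' i \<le> p' (Suc i)"
  shows "(\<integral>\<^sup>+\<omega>. ennreal ((step_integral B m p a \<omega> - step_integral B m' p' a' \<omega>)\<^sup>2) \<partial>M) =
    (\<integral>\<^sup>+s. ennreal ((step_fun m p a s - step_fun m' p' a' s)\<^sup>2) \<partial>lborel)"
proof -
  define c where "c = case_sum a (\<lambda>i. - a' i)"
  define l where "l = case_sum p p'"
  define r where "r = case_sum (\<lambda>i. p (Suc i)) (\<lambda>i. p' (Suc i))"
  have "(\<integral>\<^sup>+\<omega>. ennreal ((\<Sum>i\<in>{..<m} <+> {..<m'}. c i * (B (r i) \<omega> - B (l i) \<omega>))\<^sup>2) \<partial>M) =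
    (\<integral>\<^sup>+s. ennreal ((\<Sum>i\<in>{..<m} <+> {..<m'}. c i * indicator {l i<..r i} s)\<^sup>2) \<partial>lborel)"
    by (rule wiener_isometry[OF B]) (use p p' in \<open>auto simp: l_def r_def\<close>)
  moreover have "(\<Sum>i\<in>{..<m} <+> {..<m'}. c i * (B (r i) \<omega> - B (l i) \<omega>)) =
      step_integral B m p a \<omega> - step_integral B m' p' a' \<omega>" for \<omega>
    unfolding step_integral_def
    by (subst sum.Plus) (auto simp: c_def l_def r_def o_def sum_negf simp del: mult_minus_left intro!: sum.cong)
  moreover have "(\<Sum>i\<in>{..<m} <+> {..<m'}. c i * indicator {l i<..r i} s) =
      step_fun m p a s - step_fun m' p' a' s" for s
    unfolding step_fun_def c_def l_def r_def
    by (subst sum.Plus)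
       (simp_all only: o_def old.sum.case mult_minus_left sum_negf finite_lessThan add_uminus_conv_diff)
  ultimately show ?thesis by simp
qed

lemma nn_integral_square_diff_le:
  fixes f g h :: "'b \<Rightarrow> real"
  assumes [measurable]: "f \<in> borel_measurable N" "g \<in> borel_measurable N" "h \<in> borel_measurable N"
  shows "(\<integral>\<^sup>+x. ennreal ((f x - h x)\<^sup>2) \<partial>N) \<le>
     2 * (\<integral>\<^sup>+x. ennreal ((f x - g x)\<^sup>2) \<partial>N) + 2 * (\<integral>\<^sup>+x. ennreal ((g x - h x)\<^sup>2) \<partial>N)"
proof -
  have "(\<integral>\<^sup>+x. ennreal ((f x - h x)\<^sup>2) \<partial>N) \<le> (\<integral>\<^sup>+x. 2 * ennreal ((f x - g x)\<^sup>2) + 2 * ennreal ((g x - h x)\<^sup>2) \<partial>N)"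
  proof (rule nn_integral_mono)
    fix x
    have "(f x - h x)\<^sup>2 \<le> 2 * (f x - g x)\<^sup>2 + 2 * (g x - h x)\<^sup>2"
      using zero_le_power2[of "f x - g x - (g x - h x)"] by (simp add: power2_eq_square algebra_simps)
    then have "ennreal ((f x - h x)\<^sup>2) \<le> ennreal (2 * (f x - g x)\<^sup>2 + 2 * (g x - h x)\<^sup>2)"
      by (rule ennreal_leI)
    also have "\<dots> = 2 * ennreal ((f x - g x)\<^sup>2) + 2 * ennreal ((g x - h x)\<^sup>2)"
      by (simp add: ennreal_plus ennreal_mult)
    finally show "ennreal ((f x - h x)\<^sup>2) \<le> 2 * ennreal ((f x - g x)\<^sup>2) + 2 * ennreal ((g x - h x)\<^sup>2)" .
  qed
  also have "\<dots> = 2 * (\<integral>\<^sup>+x. ennreal ((f x - g x)\<^sup>2) \<partial>N) + 2 * (\<integral>\<^sup>+x. ennreal ((g x - h x)\<^sup>2) \<partial>N)"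
    by (subst nn_integral_add) (auto simp: nn_integral_cmult)
  finally show ?thesis .
qed

section \<open>Approximation of Wiener integrals by step integrals\<close>

lemma partition_mono:
  fixes p :: "nat \<Rightarrow> real"
  assumes "\<And>i. i < m \<Longrightarrow> p i \<le> p (Suc i)" "i \<le> j" "j \<le> m"
  shows "p i \<le> p j"
  using \<open>i \<le> j\<close> \<open>j \<le> m\<close>
proof (induction rule: dec_induct)
  case (step n)
  then show ?case using assms(1)[of n] by simp
qed simp

lemma borel_measurable_step_fun [measurable]: "step_fun m p a \<in> borel_measurable borel"
  unfolding step_fun_def by measurable

lemma step_fun_outside:
  assumes "\<And>i. i < m \<Longrightarrow> p i \<le> p (Suc i)" "s \<notin> {p 0..p m}"
  shows "step_fun m p a s = 0"
proof -
  have "s \<notin> {p i<..p (Suc i)}" if "i < m" for i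
    using partition_mono[of m p 0 i] partition_mono[of m p "Suc i" m] assms that by auto
  then show ?thesis unfolding step_fun_def by (intro sum.neutral) auto
qed

text \<open>The factor 4 arises because the step functions are compared with the approximating ones of the
  definition, to which the isometry applies, by two triangle inequalities.\<close>

lemma wiener_integral_approx:
  assumes B: "wiener_process M {0..} B" and Y: "has_wiener_integral M B f t Y"
    and p: "p 0 = 0" "p m = t" "\<And>i. i < m \<Longrightarrow> p i \<le> p (Suc i)"
  shows "(\<integral>\<^sup>+\<omega>. ennreal ((Y \<omega> - step_integral B m p a \<omega>)\<^sup>2) \<partial>M) \<le>
    4 * (\<integral>\<^sup>+s\<in>{0..t}. ennreal ((f s - step_fun m p a s)\<^sup>2) \<partial>lborel)" (is "?L \<le> 4 * ?R")
proof -
  have f: "set_borel_measurable lborel {0..t} f" and [measurable]: "Y \<in> borel_measurable M"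
    using Y by (auto simp: has_wiener_integral_def)
  obtain k q b where q: "\<And>n. q n 0 = 0" "\<And>n. q n (k n) = t" "\<And>n i. i < k n \<Longrightarrow> q n i < q n (Suc i)"
    and lim1: "(\<lambda>n. \<integral>\<^sup>+s\<in>{0..t}. ennreal ((f s - step_fun (k n) (q n) (b n) s)\<^sup>2) \<partial>lborel) \<longlonglongrightarrow> 0"
    and lim2: "(\<lambda>n. \<integral>\<^sup>+\<omega>. ennreal ((Y \<omega> - step_integral B (k n) (q n) (b n) \<omega>)\<^sup>2) \<partial>M) \<longlonglongrightarrow> 0"
    using Y unfolding has_wiener_integral_def by blast
  have p0: "p i \<in> {0..}" if "i \<le> m" for i using partition_mono[of m p 0 i] p that by auto
  have q0: "q n i \<in> {0..}" if "i \<le> k n" for n i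
    using partition_mono[of "k n" "q n" 0 i, OF less_imp_le[OF q(3)]] q(1) that by auto
  have Bm: "B s \<in> borel_measurable M" if "s \<in> {0..}" for s
    using B that by (auto simp: wiener_process_def)
  have step_meas: "step_integral B m' p' a' \<in> borel_measurable M" if "\<And>i. i \<le> m' \<Longrightarrow> p' i \<in> {0..}" for m' p' a'
    unfolding step_integral_def[abs_def]
    using that by (intro borel_measurable_sum borel_measurable_times borel_measurable_diff borel_measurable_const Bm) auto
  have [measurable]: "step_integral B m p a \<in> borel_measurable M" using p0 by (rule step_meas)
  have [measurable]: "step_integral B (k n) (q n) (b n) \<in> borel_measurable M" for n using q0 by (rule step_meas)
  \<comment> \<open>The integrand is measurable only on \<open>{0..t}\<close>, hence the cut-off; it
    does not change the step functions, which vanish outside their partition.\<close>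
  define F where "F s = indicator {0..t} s * f s" for s
  define P where "P s = indicator {0..t} s * step_fun m p a s" for s
  define Q where "Q n s = indicator {0..t} s * step_fun (k n) (q n) (b n) s" for n s
  have [measurable]: "F \<in> borel_measurable lborel"
    using f by (simp add: F_def[abs_def] set_borel_measurable_def)
  have [measurable]: "P \<in> borel_measurable lborel" "Q n \<in> borel_measurable lborel" for n
    unfolding P_def Q_def by measurable
  have P: "P s = step_fun m p a s" for s
    using step_fun_outside[of m p s a] p by (auto simp: P_def indicator_def)
  have Q: "Q n s = step_fun (k n) (q n) (b n) s" for n s
    using step_fun_outside[of "k n" "q n" s "b n"] q by (auto simp: Q_def indicator_def less_imp_le)
  have R: "?R = (\<integral>\<^sup>+s. ennreal ((F s - P s)\<^sup>2) \<partial>lborel)"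
    by (intro nn_integral_cong) (auto simp: F_def P_def indicator_def)
  have R1: "(\<integral>\<^sup>+s\<in>{0..t}. ennreal ((f s - step_fun (k n) (q n) (b n) s)\<^sup>2) \<partial>lborel)
      = (\<integral>\<^sup>+s. ennreal ((Q n s - F s)\<^sup>2) \<partial>lborel)" for n
    by (intro nn_integral_cong) (auto simp: F_def Q_def indicator_def power2_commute)
  \<comment> \<open>This holds for every approximating index \<open>n\<close>; as \<open>n\<close>
    grows, only the last term \<open>4 * ?R\<close> survives.\<close>
  have "?L \<le> 2 * (\<integral>\<^sup>+\<omega>. ennreal ((Y \<omega> - step_integral B (k n) (q n) (b n) \<omega>)\<^sup>2) \<partial>M)
      + 2 * (2 * (\<integral>\<^sup>+s\<in>{0..t}. ennreal ((f s - step_fun (k n) (q n) (b n) s)\<^sup>2) \<partial>lborel) + 2 * ?R)" for n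
  proof -
    have "(\<integral>\<^sup>+\<omega>. ennreal ((step_integral B (k n) (q n) (b n) \<omega> - step_integral B m p a \<omega>)\<^sup>2) \<partial>M) =
        (\<integral>\<^sup>+s. ennreal ((Q n s - P s)\<^sup>2) \<partial>lborel)"
      unfolding P Q using p0 q0 p(3) q(3) by (intro step_integral_isometry[OF B]) (auto intro: less_imp_le)
    also have "\<dots> \<le> 2 * (\<integral>\<^sup>+s. ennreal ((Q n s - F s)\<^sup>2) \<partial>lborel) + 2 * (\<integral>\<^sup>+s. ennreal ((F s - P s)\<^sup>2) \<partial>lborel)"
      by (rule nn_integral_square_diff_le) auto
    finally have "(\<integral>\<^sup>+\<omega>. ennreal ((step_integral B (k n) (q n) (b n) \<omega> - step_integral B m p a \<omega>)\<^sup>2) \<partial>M)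
      \<le> 2 * (\<integral>\<^sup>+s\<in>{0..t}. ennreal ((f s - step_fun (k n) (q n) (b n) s)\<^sup>2) \<partial>lborel) + 2 * ?R"
      unfolding R R1 .
    then show ?thesis
      by (intro order.trans[OF nn_integral_square_diff_le[of Y _ "step_integral B (k n) (q n) (b n)"]]
          add_left_mono mult_left_mono) auto
  qed
  moreover have "(\<lambda>n. 2 * (\<integral>\<^sup>+\<omega>. ennreal ((Y \<omega> - step_integral B (k n) (q n) (b n) \<omega>)\<^sup>2) \<partial>M)
      + 2 * (2 * (\<integral>\<^sup>+s\<in>{0..t}. ennreal ((f s - step_fun (k n) (q n) (b n) s)\<^sup>2) \<partial>lborel) + 2 * ?R))
      \<longlonglongrightarrow> 2 * 0 + 2 * (2 * 0 + 2 * ?R)"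
    by (intro tendsto_add ennreal_tendsto_cmult tendsto_const lim1 lim2) auto
  ultimately have "?L \<le> 2 * 0 + 2 * (2 * 0 + 2 * ?R)"
    by (intro LIMSEQ_le_const) auto
  also have "\<dots> = 4 * ?R" by (simp add: mult.assoc[symmetric])
  finally show ?thesis .
qed

text \<open>With \<open>u = sqrt q * \<bar>x\<bar>\<close> the derivative has modulus
  \<open>sqrt q * u * exp (- u^2 / 2)\<close>, and
  \<open>u \<le> 1 + u^2 / 2 \<le> exp (u^2 / 2)\<close>.\<close>

lemma exp_neg_square_lipschitz:
  fixes q y z :: real
  assumes q: "q \<ge> 0"
  shows "\<bar>exp (- (q * y\<^sup>2) / 2) - exp (- (q * z\<^sup>2) / 2)\<bar> \<le> sqrt q * \<bar>y - z\<bar>"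
proof -
  have "norm (exp (- (q * y\<^sup>2) / 2) - exp (- (q * z\<^sup>2) / 2)) \<le> sqrt q * norm (y - z)"
  proof (rule field_differentiable_bound[where S = UNIV and f' = "\<lambda>x. - (q * x) * exp (- (q * x\<^sup>2) / 2)"])
    fix x :: real
    show "((\<lambda>x. exp (- (q * x\<^sup>2) / 2)) has_field_derivative - (q * x) * exp (- (q * x\<^sup>2) / 2)) (at x within UNIV)"
      by (auto intro!: derivative_eq_intros)
    define u where "u = sqrt q * \<bar>x\<bar>"
    have u2: "u\<^sup>2 = q * x\<^sup>2" using q by (simp add: u_def power_mult_distrib)
    have "u \<le> 1 + u\<^sup>2 / 2"
      using zero_le_power2[of "u - 1"] by (simp add: power2_eq_square algebra_simps)
    also have "\<dots> \<le> exp (u\<^sup>2 / 2)" by (rule exp_ge_add_one_self)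
    finally have "u * exp (- (u\<^sup>2) / 2) \<le> 1" by (simp add: exp_minus field_simps)
    then have "sqrt q * (u * exp (- (u\<^sup>2) / 2)) \<le> sqrt q * 1" using q by (intro mult_left_mono) auto
    moreover have "norm (- (q * x) * exp (- (q * x\<^sup>2) / 2)) = sqrt q * (u * exp (- (u\<^sup>2) / 2))"
      unfolding u2 using q by (simp add: u_def abs_mult mult.assoc[symmetric])
    ultimately show "norm (- (q * x) * exp (- (q * x\<^sup>2) / 2)) \<le> sqrt q" by simp
  qed auto
  then show ?thesis by simp
qed

text \<open>The exponential is a product of factors in \<open>{0..1}\<close>, so the difference of
  two products is at most the sum of the differences of the factors. This converts closeness in mean
  of the grid values into closeness of expectations.\<close>

lemma exp_diff_exponent_lipschitz:
  assumes f: "\<And>i. i \<le> Suc m \<Longrightarrow> f i > 0" and \<gamma>: "\<And>i. i < m \<Longrightarrow> \<gamma> i \<le> \<gamma> (Suc i)" "\<gamma> m \<le> 0"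
  obtains C where "C \<ge> 0"
    "\<And>y z. \<bar>exp (- diff_exponent m f \<gamma> y / 2) - exp (- diff_exponent m f \<gamma> z / 2)\<bar> \<le>
       C * (\<Sum>j\<le>m. \<bar>y (Suc j) - z (Suc j)\<bar>)"
proof -
  \<comment> \<open>The boundary term is absorbed as the weight with index \<open>m\<close>, which
    makes the exponent a single nonnegative diagonal form.\<close>
  define q where "q j = (if j < m then (\<gamma> (Suc j) - \<gamma> j) / f (Suc j) else - \<gamma> m / f (Suc m))" for j
  have q: "q j \<ge> 0" if "j \<le> m" for j
    using that f[of "Suc j"] \<gamma> by (auto simp: q_def not_less intro!: divide_nonneg_nonneg divide_nonpos_pos)
  have E: "diff_exponent m f \<gamma> y = (\<Sum>j\<le>m. q j * (y (Suc j))\<^sup>2)" for y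
    unfolding diff_exponent_def lessThan_Suc_atMost[symmetric] sum.lessThan_Suc by (simp add: q_def)
  have P: "exp (- diff_exponent m f \<gamma> y / 2) = (\<Prod>j\<le>m. exp (- (q j * (y (Suc j))\<^sup>2) / 2))" for y
    unfolding E by (simp add: exp_sum[symmetric] sum_divide_distrib sum_negf)
  define C where "C = (\<Sum>j\<le>m. sqrt (q j))"
  have C: "sqrt (q j) \<le> C" if "j \<le> m" for j
    unfolding C_def using that q by (intro member_le_sum) auto
  show ?thesis
  proof (rule that[of C])
    show "C \<ge> 0" unfolding C_def using q by (intro sum_nonneg) auto
    fix y z :: "nat \<Rightarrow> real"
    have "\<bar>exp (- diff_exponent m f \<gamma> y / 2) - exp (- diff_exponent m f \<gamma> z / 2)\<bar> \<le>
       (\<Sum>j\<le>m. norm (exp (- (q j * (y (Suc j))\<^sup>2) / 2) - exp (- (q j * (z (Suc j))\<^sup>2) / 2)))"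
      unfolding P real_norm_def[symmetric]
      using q by (intro norm_prod_diff) auto
    also have "\<dots> \<le> (\<Sum>j\<le>m. C * \<bar>y (Suc j) - z (Suc j)\<bar>)"
      using q C unfolding real_norm_def
      by (intro sum_mono order.trans[OF exp_neg_square_lipschitz] mult_right_mono) auto
    finally show "\<bar>exp (- diff_exponent m f \<gamma> y / 2) - exp (- diff_exponent m f \<gamma> z / 2)\<bar> \<le>
       C * (\<Sum>j\<le>m. \<bar>y (Suc j) - z (Suc j)\<bar>)" by (simp add: sum_distrib_left)
  qed
qed

text \<open>Splitting each of the \<open>Suc m\<close> cells into \<open>N\<close> gives
  \<open>Suc m * N\<close> cells, which is parameter \<open>Suc m * N - 1\<close>.\<close>

lemma grid_refine: "N > 0 \<Longrightarrow> grid S (Suc m * N - 1) (i * N) = grid S m i"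
proof -
  assume N: "N > 0"
  then have "real (Suc (Suc m * N - 1)) = real (Suc m) * real N" by (simp add: algebra_simps)
  then show ?thesis unfolding grid_def using N by simp
qed

text \<open>The increments over the grid cells are independent and normal with the cell lengths as
  variances, and they sum to the path. A bounded time interval is allowed because the Wiener process
  on \<open>{0..1}\<close> is not assumed to extend further.\<close>

lemma wiener_gaussian_increments:
  assumes B: "wiener_process M {0..S} B" and S: "S > 0"
  shows "gaussian_increments M B (\<lambda>t. t) S"
  unfolding gaussian_increments_def
proof (intro allI impI, elim conjE)
  interpret prob_space M using B by (simp add: wiener_process_def)
  fix m f \<gamma>
  assume f: "\<forall>i\<le>Suc m. f i > 0" and \<gamma>: "\<forall>i\<le>m. \<gamma> i \<le> 0" "\<forall>i<m. \<gamma> i \<le> \<gamma> (Suc i)"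
    and f\<gamma>: "\<forall>i\<le>m. f (Suc i) - f i = \<gamma> i * (grid S m (Suc i) - grid S m i)"
  define D where "D i \<omega> = B (grid S m (Suc i)) \<omega> - B (grid S m i) \<omega>" for i \<omega>
  have mem: "grid S m i \<in> {0..S}" if "i \<le> Suc m" for i
    using grid_nonneg[OF S] grid_le[OF S that] by auto
  have mD: "D i \<in> borel_measurable M" if "i \<le> m" for i
  proof -
    have [measurable]: "B (grid S m i) \<in> borel_measurable M" "B (grid S m (Suc i)) \<in> borel_measurable M"
      using B mem[of i] mem[of "Suc i"] that unfolding wiener_process_def by auto
    show ?thesis unfolding D_def by measurable
  qed
  have "\<forall>i<Suc m. grid S m i < grid S m (Suc i)" using grid_mono[OF S] by simp
  then have "indep_vars (\<lambda>_. borel) D {..<Suc m}"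
    using B mem unfolding wiener_process_def D_def by blast
  moreover have "distributed M lborel (D i) (normal_density 0 (sqrt (grid S m (Suc i) - grid S m i)))" if "i \<le> m" for i
    using B mem[of i] mem[of "Suc i"] grid_mono[OF S, of i "Suc i" m] that
    unfolding wiener_process_def D_def by simp
  ultimately have *: "expectation (\<lambda>\<omega>. exp (- diff_exponent m f \<gamma> (\<lambda>j. \<Sum>i<j. D i \<omega>) / 2)) = sqrt (f (Suc m) / f 0)"
    using f \<gamma> f\<gamma> grid_mono[OF S] by (intro expectation_exp_diff_exponent) auto
  have "expectation (\<lambda>\<omega>. exp (- diff_exponent m f \<gamma> (\<lambda>j. B (grid S m j) \<omega>) / 2)) =
      expectation (\<lambda>\<omega>. exp (- diff_exponent m f \<gamma> (\<lambda>j. \<Sum>i<j. D i \<omega>) / 2))"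
  \<comment> \<open>The telescoping sum recovers \<open>B\<close> only where
    \<open>B 0 \<omega> = 0\<close>, which holds almost surely.\<close>
  proof (rule integral_cong_AE)
    have "B (grid S m j) \<in> borel_measurable M" if "j \<le> Suc m" for j
      using B mem[OF that] by (auto simp: wiener_process_def)
    then have [measurable]: "(\<lambda>\<omega>. diff_exponent m f \<gamma> (\<lambda>j. B (grid S m j) \<omega>)) \<in> borel_measurable M"
      by (rule borel_measurable_diff_exponent)
    have [measurable]: "(\<lambda>\<omega>. diff_exponent m f \<gamma> (\<lambda>j. \<Sum>i<j. D i \<omega>)) \<in> borel_measurable M"
      by (intro borel_measurable_diff_exponent borel_measurable_sum mD) auto
    show "(\<lambda>\<omega>. exp (- diff_exponent m f \<gamma> (\<lambda>j. B (grid S m j) \<omega>) / 2)) \<in> borel_measurable M"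
      "(\<lambda>\<omega>. exp (- diff_exponent m f \<gamma> (\<lambda>j. \<Sum>i<j. D i \<omega>) / 2)) \<in> borel_measurable M" by measurable
    have "AE \<omega> in M. B 0 \<omega> = 0" using B by (simp add: wiener_process_def)
    then show "AE \<omega> in M. exp (- diff_exponent m f \<gamma> (\<lambda>j. B (grid S m j) \<omega>) / 2) =
        exp (- diff_exponent m f \<gamma> (\<lambda>j. \<Sum>i<j. D i \<omega>) / 2)"
    proof eventually_elim
      case (elim \<omega>)
      have "(\<Sum>i<j. D i \<omega>) = B (grid S m j) \<omega>" for j
        unfolding D_def by (subst sum_lessThan_telescope) (simp add: elim)
      then show ?case by simp
    qed
  qed
  then show "expectation (\<lambda>\<omega>. exp (- diff_exponent m f \<gamma> (\<lambda>j. B (grid S m j) \<omega>) / 2)) = sqrt (f (Suc m) / f 0)"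
    using * by simp
qed

text \<open>Each coarse cell is a block \<open>K i\<close> of \<open>N\<close> fine cells. Sums over
  disjoint blocks are independent and normal, and the condition on \<open>c\<close> makes their
  variances exactly the increments of \<open>\<tau>\<close>, so there is no error in the
  expectation. Coefficients must be nonzero for the scaled increments to have normal
  densities.\<close>

lemma step_integral_expectation:
  fixes c :: "nat \<Rightarrow> real" and m N :: nat and S :: real
  assumes B: "wiener_process M {0..} B" and S: "S > 0" and N: "N > 0"
  defines "p \<equiv> grid S (Suc m * N - 1)"
  assumes c: "\<And>k. c k \<noteq> 0" "\<And>k. k < Suc m * N \<Longrightarrow> (c k)\<^sup>2 * (p (Suc k) - p k) = \<tau> (p (Suc k)) - \<tau> (p k)"
    and f: "\<And>i. i \<le> Suc m \<Longrightarrow> f i > 0" and \<gamma>: "\<And>i. i \<le> m \<Longrightarrow> \<gamma> i \<le> 0"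
    and f\<gamma>: "\<And>i. i \<le> m \<Longrightarrow> f (Suc i) - f i = \<gamma> i * (\<tau> (grid S m (Suc i)) - \<tau> (grid S m i))"
  shows "(\<integral>\<omega>. exp (- diff_exponent m f \<gamma> (\<lambda>j. step_integral B (j * N) p c \<omega>) / 2) \<partial>M) = sqrt (f (Suc m) / f 0)"
proof -
  interpret prob_space M using B by (simp add: wiener_process_def)
  define K where "K i = {N * i..<N * i + N}" for i
  define d where "d k \<omega> = B (p (Suc k)) \<omega> - B (p k) \<omega>" for k \<omega>
  define D where "D i \<omega> = (\<Sum>k\<in>K i. c k * d k \<omega>)" for i \<omega>
  have K: "K i \<subseteq> {..<Suc m * N}" if "i < Suc m" for i
  proof -
    have "N * i + N = N * Suc i" by simp
    also have "\<dots> \<le> N * Suc m" using that by (intro mult_le_mono2) auto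
    also have "N * Suc m = Suc m * N" by (rule mult.commute)
    finally show ?thesis unfolding K_def
      by (intro subsetI) (simp only: atLeastLessThan_iff lessThan_iff, linarith)
  qed
  have pm: "p k < p (Suc k)" for k unfolding p_def by (rule grid_mono[OF S]) simp
  have p0: "p k \<ge> 0" for k unfolding p_def by (rule grid_nonneg[OF S])
  have pN: "p (N * i) = grid S m i" for i
    unfolding p_def using grid_refine[OF N, of S m i] by (simp add: mult.commute)
  have ind: "indep_vars (\<lambda>_. borel) d {..<Suc m * N}"
    using B pm p0 unfolding wiener_process_def d_def by simp
  have ind_cd: "indep_vars (\<lambda>_. borel) (\<lambda>k \<omega>. c k * d k \<omega>) {..<Suc m * N}"
    by (rule indep_vars_compose2[OF ind]) simp
  have "indep_vars (\<lambda>i. borel) (\<lambda>i \<omega>. (\<lambda>x. \<Sum>k\<in>K i. x k) (restrict (\<lambda>k. c k * d k \<omega>) (K i))) {..<Suc m}"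
  proof (rule indep_vars_compose2[OF indep_vars_restrict[OF ind_cd]])
    show "disjoint_family_on K {..<Suc m}"
    proof -
      have "K i \<inter> K j = {}" if "i < j" for i j
      proof -
        have "N * i + N = N * Suc i" by simp
        also have "\<dots> \<le> N * j" using that by (intro mult_le_mono2) auto
        finally show ?thesis unfolding K_def by auto
      qed
      then show ?thesis unfolding disjoint_family_on_def by (metis Int_commute linorder_neqE_nat)
    qed
  qed (use K in auto)
  then have indD: "indep_vars (\<lambda>i. borel) D {..<Suc m}"
    unfolding D_def by simp
  have normD: "distributed M lborel (D i) (normal_density 0 (sqrt (\<tau> (grid S m (Suc i)) - \<tau> (grid S m i))))" if "i \<le> m" for i
  proof -
    have Ki: "K i \<subseteq> {..<Suc m * N}" using K that by simp
    have "distributed M lborel (\<lambda>\<omega>. \<Sum>k\<in>K i. c k * d k \<omega>)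
      (normal_density (\<Sum>k\<in>K i. 0) (sqrt (\<Sum>k\<in>K i. (\<bar>c k\<bar> * sqrt (p (Suc k) - p k))\<^sup>2)))"
    proof (rule sum_indep_normal)
      show "indep_vars (\<lambda>i. borel) (\<lambda>k \<omega>. c k * d k \<omega>) (K i)" by (rule indep_vars_subset[OF ind_cd Ki])
      show "0 < \<bar>c k\<bar> * sqrt (p (Suc k) - p k)" for k using c(1) pm by simp
      fix k
      have "distributed M lborel (d k) (normal_density 0 (sqrt (p (Suc k) - p k)))"
        using B pm p0 unfolding wiener_process_def d_def by simp
      from normal_density_affine[OF this _ c(1)[of k], of 0]
      show "distributed M lborel (\<lambda>\<omega>. c k * d k \<omega>) (normal_density 0 (\<bar>c k\<bar> * sqrt (p (Suc k) - p k)))"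
        using pm by simp
    qed (use N in \<open>auto simp: K_def\<close>)
    moreover have "(\<Sum>k\<in>K i. (\<bar>c k\<bar> * sqrt (p (Suc k) - p k))\<^sup>2) = (\<Sum>k\<in>K i. \<tau> (p (Suc k)) - \<tau> (p k))"
      using Ki c(2) less_imp_le[OF pm] by (intro sum.cong) (auto simp: power_mult_distrib)
    moreover have "\<dots> = \<tau> (p (N * i + N)) - \<tau> (p (N * i))"
      unfolding K_def by (rule sum_Suc_diff') simp
    moreover have "N * i + N = N * Suc i" by simp
    ultimately show ?thesis unfolding D_def pN[symmetric] by simp
  qed
  have Z: "(\<Sum>i<j. D i \<omega>) = step_integral B (j * N) p c \<omega>" for j \<omega>
    unfolding D_def K_def step_integral_def d_def
    using sum.nat_group[of "\<lambda>k. c k * (B (p (Suc k)) \<omega> - B (p k) \<omega>)" N j] by (simp add: mult.commute)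
  have pos: "\<tau> (grid S m (Suc i)) - \<tau> (grid S m i) > 0" if "i \<le> m" for i
  proof -
    have "(\<Sum>k\<in>K i. \<tau> (p (Suc k)) - \<tau> (p k)) > 0"
    proof (rule sum_pos)
      fix k assume "k \<in> K i"
      then have "k < Suc m * N" using K[of i] that by auto
      from c(2)[OF this] show "\<tau> (p (Suc k)) - \<tau> (p k) > 0"
        using c(1)[of k] pm[of k] by (metis diff_gt_0_iff_gt mult_pos_pos zero_less_power2)
    qed (use N in \<open>auto simp: K_def\<close>)
    also have "(\<Sum>k\<in>K i. \<tau> (p (Suc k)) - \<tau> (p k)) = \<tau> (p (N * i + N)) - \<tau> (p (N * i))"
      unfolding K_def by (rule sum_Suc_diff') simp
    also have "N * i + N = N * Suc i" by simp
    finally show ?thesis unfolding pN .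
  qed
  show ?thesis
    using expectation_exp_diff_exponent[OF indD normD pos f \<gamma> f\<gamma>] unfolding Z by blast
qed

lemma step_fun_eq:
  assumes p: "\<And>i. i < m \<Longrightarrow> p i \<le> p (Suc i)" and i: "i < m" "s \<in> {p i<..p (Suc i)}"
  shows "step_fun m p a s = a i"
proof -
  have "s \<notin> {p j<..p (Suc j)}" if "j < m" "j \<noteq> i" for j
  proof (cases "j < i")
    case True
    then show ?thesis using partition_mono[of m p "Suc j" i] p i by auto
  next
    case False
    then show ?thesis using partition_mono[of m p "Suc i" j] p i that by auto
  qed
  then have "step_fun m p a s = (\<Sum>j<m. if j = i then a i else 0)"
    unfolding step_fun_def using i by (intro sum.cong) auto
  then show ?thesis using i by simp
qed

lemma partition_cell:
  fixes p :: "nat \<Rightarrow> real"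
  assumes "s \<in> {p 0<..p m}"
  obtains i where "i < m" "s \<in> {p i<..p (Suc i)}"
proof -
  define k where "k = (LEAST k. s \<le> p k)"
  have k: "s \<le> p k" unfolding k_def by (rule LeastI[of _ m]) (use assms in auto)
  have km: "k \<le> m" unfolding k_def by (rule Least_le) (use assms in auto)
  have "k \<noteq> 0" using k assms by (cases "k = 0") auto
  then obtain i where i: "k = Suc i" by (cases k) auto
  have "p i < s" using not_less_Least[of i "\<lambda>k. s \<le> p k"] i unfolding k_def by force
  then show ?thesis using that[of i] k km i by auto
qed

lemma step_integral_scale: "step_integral B m p (\<lambda>k. w * c k) \<omega> = w * step_integral B m p c \<omega>"
  by (simp add: step_integral_def sum_distrib_left mult.assoc)

lemma step_fun_scale: "step_fun m p (\<lambda>k. w * c k) s = w * step_fun m p c s"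
  unfolding step_fun_def sum_distrib_left by (intro sum.cong) auto

text \<open>From \<open>\<bar>x\<bar> \<le> e + x^2 / e\<close>: a second moment of order
  \<open>e^2\<close> gives a first absolute moment of order \<open>e\<close>.\<close>

lemma (in prob_space) expectation_abs_le:
  fixes d :: "'a \<Rightarrow> real"
  assumes [measurable]: "d \<in> borel_measurable M" and e: "e > 0" "b \<ge> 0"
    and d: "(\<integral>\<^sup>+\<omega>. ennreal ((d \<omega>)\<^sup>2) \<partial>M) \<le> ennreal (b * e\<^sup>2)"
  shows "integrable M d" "expectation (\<lambda>\<omega>. \<bar>d \<omega>\<bar>) \<le> (1 + b) * e"
proof -
  have i2: "integrable M (\<lambda>\<omega>. (d \<omega>)\<^sup>2)"
    using d by (intro integrableI_bounded) (auto simp: ennreal_less_top le_less_trans)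
  have E2: "expectation (\<lambda>\<omega>. (d \<omega>)\<^sup>2) \<le> b * e\<^sup>2"
    using d e nn_integral_eq_integral[OF i2] by (auto simp: ennreal_le_iff)
  have le: "\<bar>x\<bar> \<le> e + x\<^sup>2 / e" for x
  proof (cases "\<bar>x\<bar> \<le> e")
    case True
    then show ?thesis using e by (simp add: add_increasing2)
  next
    case False
    then have "\<bar>x\<bar> * e \<le> \<bar>x\<bar> * \<bar>x\<bar>" by (intro mult_left_mono) auto
    then have "\<bar>x\<bar> \<le> x\<^sup>2 / e" using e by (simp add: power2_eq_square field_simps)
    then show ?thesis using e by simp
  qed
  have i1: "integrable M (\<lambda>\<omega>. e + (d \<omega>)\<^sup>2 / e)" using i2 by simp
  show d1: "integrable M d"
    by (rule Bochner_Integration.integrable_bound[OF i1]) (use le e in \<open>auto simp: abs_of_nonneg\<close>)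
  have "expectation (\<lambda>\<omega>. \<bar>d \<omega>\<bar>) \<le> expectation (\<lambda>\<omega>. e + (d \<omega>)\<^sup>2 / e)"
    by (rule integral_mono) (use d1 i1 le in auto)
  also have "\<dots> = e + expectation (\<lambda>\<omega>. (d \<omega>)\<^sup>2) / e"
    using i2 by (simp add: prob_space)
  also have "\<dots> \<le> e + b * e\<^sup>2 / e" using E2 e by (intro add_left_mono divide_right_mono) auto
  also have "\<dots> = (1 + b) * e" using e by (simp add: power2_eq_square algebra_simps)
  finally show "expectation (\<lambda>\<omega>. \<bar>d \<omega>\<bar>) \<le> (1 + b) * e" .
qed

text \<open>Since the kernel factors as \<open>w t * h s\<close>, one step function approximating
  \<open>h\<close> serves all grid times at once. Its coefficients are values of \<open>h\<close> at
  mean value points, chosen so that the approximating process satisfies the identity exactly; only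
  the mean distance of \<open>X t / w t\<close> to that process remains to be made small.\<close>

lemma wiener_integral_gaussian_increments:
  fixes h w \<tau> :: "real \<Rightarrow> real"
  assumes B: "wiener_process M {0..} B" and S: "S > 0"
    and X: "\<And>t. t \<in> {0..S} \<Longrightarrow> has_wiener_integral M B (\<lambda>s. w t * h s) t (X t)"
    and w: "\<And>t. t \<in> {0..S} \<Longrightarrow> w t > 0"
    and h: "continuous_on {0..S} h" "\<And>t. t \<in> {0..S} \<Longrightarrow> h t > 0"
    and \<tau>: "\<And>t. t \<in> {0..S} \<Longrightarrow> (\<tau> has_real_derivative (h t)\<^sup>2) (at t)"
  shows "gaussian_increments M (\<lambda>t \<omega>. X t \<omega> / w t) \<tau> S"
  unfolding gaussian_increments_def
proof (intro allI impI, elim conjE)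
  interpret prob_space M using B by (simp add: wiener_process_def)
  fix m f \<gamma>
  assume f: "\<forall>i\<le>Suc m. f i > 0" and \<gamma>: "\<forall>i\<le>m. \<gamma> i \<le> 0" "\<forall>i<m. \<gamma> i \<le> \<gamma> (Suc i)"
    and f\<gamma>: "\<forall>i\<le>m. f (Suc i) - f i = \<gamma> i * (\<tau> (grid S m (Suc i)) - \<tau> (grid S m i))"
  define Y where "Y j \<omega> = X (grid S m j) \<omega> / w (grid S m j)" for j \<omega>
  define V where "V = sqrt (f (Suc m) / f 0)"
  define A where "A = expectation (\<lambda>\<omega>. exp (- diff_exponent m f \<gamma> (\<lambda>j. Y j \<omega>) / 2))"
  have mem: "grid S m j \<in> {0..S}" if "j \<le> Suc m" for j
    using grid_nonneg[OF S] grid_le[OF S that] by auto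
  have mX: "X t \<in> borel_measurable M" if "t \<in> {0..S}" for t
    using X[OF that] by (simp add: has_wiener_integral_def)
  have mY: "Y j \<in> borel_measurable M" if "j \<le> Suc m" for j
    unfolding Y_def using mX[OF mem[OF that]] by measurable
  have mEY: "(\<lambda>\<omega>. diff_exponent m f \<gamma> (\<lambda>j. Y j \<omega>)) \<in> borel_measurable M"
    by (rule borel_measurable_diff_exponent) (rule mY)
  obtain C where C: "C \<ge> 0" "\<And>y z. \<bar>exp (- diff_exponent m f \<gamma> y / 2) - exp (- diff_exponent m f \<gamma> z / 2)\<bar> \<le>
       C * (\<Sum>j\<le>m. \<bar>y (Suc j) - z (Suc j)\<bar>)"
    using exp_diff_exponent_lipschitz[of m f \<gamma>] f \<gamma> by auto
  \<comment> \<open>Each of the \<open>Suc m\<close> grid values contributes at most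
    \<open>C * (1 + 4 * S) * e\<close>, where \<open>4 * S\<close> is the factor of
    \<open>wiener_integral_approx\<close> times the length of the interval.\<close>
  have approx: "\<bar>A - V\<bar> \<le> (C * real (Suc m) * (1 + 4 * S)) * e" if e: "e > 0" for e
  proof -
    obtain \<delta> where \<delta>: "\<delta> > 0" "\<And>s t. s \<in> {0..S} \<Longrightarrow> t \<in> {0..S} \<Longrightarrow> \<bar>s - t\<bar> < \<delta> \<Longrightarrow> \<bar>h s - h t\<bar> < e"
      using compact_uniformly_continuous[OF h(1) compact_Icc] e
      unfolding uniformly_continuous_on_def dist_real_def by metis
    obtain N :: nat where N: "N > 0" "S / (real (Suc m) * real N) < \<delta>"
    proof -
      obtain N :: nat where N: "S / (real (Suc m) * \<delta>) < real N" using reals_Archimedean2 by blast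
      have "0 < S / (real (Suc m) * \<delta>)" using S \<delta> by simp
      then have "N > 0" using N by (cases N) auto
      moreover have "S / (real (Suc m) * real N) < \<delta>"
        using N \<delta>(1) \<open>N > 0\<close> by (simp add: field_simps del: of_nat_Suc)
      ultimately show ?thesis by (rule that)
    qed
    define L where "L = Suc m * N"
    have L: "Suc (L - 1) = L" using N(1) by (simp add: L_def)
    define p where "p = grid S (L - 1)"
    have pm: "p k < p (Suc k)" for k unfolding p_def by (rule grid_mono[OF S]) simp
    have pN: "p (j * N) = grid S m j" for j unfolding p_def L_def by (rule grid_refine[OF N(1)])
    have p_mem: "p k \<in> {0..S}" if "k \<le> L" for k
      unfolding p_def using grid_nonneg[OF S] grid_le[OF S, of k "L - 1"] that L by auto
    have p_diff: "p (Suc k) - p k < \<delta>" for k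
      unfolding p_def grid_Suc_diff L using N(2) by (simp add: L_def algebra_simps)
    have "\<forall>k. \<exists>x. k < L \<longrightarrow> p k < x \<and> x < p (Suc k) \<and> (h x)\<^sup>2 * (p (Suc k) - p k) = \<tau> (p (Suc k)) - \<tau> (p k)"
    proof
      fix k
      show "\<exists>x. k < L \<longrightarrow> p k < x \<and> x < p (Suc k) \<and> (h x)\<^sup>2 * (p (Suc k) - p k) = \<tau> (p (Suc k)) - \<tau> (p k)"
      proof (cases "k < L")
        case True
        then have "\<exists>z>p k. z < p (Suc k) \<and> \<tau> (p (Suc k)) - \<tau> (p k) = (p (Suc k) - p k) * (h z)\<^sup>2"
          using p_mem[of k] p_mem[of "Suc k"] by (intro MVT2[OF pm]) (auto intro!: \<tau>)
        then show ?thesis by (auto simp: mult.commute)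
      qed auto
    qed
    from choice[OF this] obtain \<zeta> where \<zeta>: "\<And>k. k < L \<Longrightarrow> p k < \<zeta> k" "\<And>k. k < L \<Longrightarrow> \<zeta> k < p (Suc k)"
      "\<And>k. k < L \<Longrightarrow> (h (\<zeta> k))\<^sup>2 * (p (Suc k) - p k) = \<tau> (p (Suc k)) - \<tau> (p k)"
      by blast
    \<comment> \<open>The value 1 beyond \<open>L\<close> only ensures that all coefficients are
      nonzero.\<close>
    define c where "c k = (if k < L then h (\<zeta> k) else 1)" for k
    have \<zeta>_mem: "\<zeta> k \<in> {0..S}" if "k < L" for k
      using \<zeta>(1,2)[OF that] p_mem[of k] p_mem[of "Suc k"] that by auto
    have c0: "c k \<noteq> 0" for k using h(2)[OF \<zeta>_mem, of k] by (auto simp: c_def)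
    define Z where "Z j \<omega> = step_integral B (j * N) p c \<omega>" for j \<omega>
    have EZ: "expectation (\<lambda>\<omega>. exp (- diff_exponent m f \<gamma> (\<lambda>j. Z j \<omega>) / 2)) = V"
      unfolding Z_def V_def p_def L_def
      by (rule step_integral_expectation[OF B S N(1), where \<tau> = \<tau>])
         (use c0 \<zeta>(3) f \<gamma> f\<gamma> in \<open>auto simp: c_def p_def L_def\<close>)
    have mZ: "Z j \<in> borel_measurable M" for j
    proof -
      have "B (p k) \<in> borel_measurable M" for k
        using B grid_nonneg[OF S] by (auto simp: wiener_process_def p_def)
      then show ?thesis unfolding Z_def step_integral_def by measurable
    qed
    have L2: "(\<integral>\<^sup>+\<omega>. ennreal ((Y j \<omega> - Z j \<omega>)\<^sup>2) \<partial>M) \<le> ennreal (4 * S * e\<^sup>2)" if j: "j \<le> Suc m" for j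
    proof -
      define t where "t = grid S m j"
      have t: "t \<in> {0..S}" using mem[OF j] by (simp add: t_def)
      have jL: "j * N \<le> L" unfolding L_def using j by (rule mult_le_mono1)
      have "(\<integral>\<^sup>+\<omega>. ennreal ((X t \<omega> - step_integral B (j * N) p (\<lambda>k. w t * c k) \<omega>)\<^sup>2) \<partial>M)
        \<le> 4 * (\<integral>\<^sup>+s\<in>{0..t}. ennreal ((w t * h s - step_fun (j * N) p (\<lambda>k. w t * c k) s)\<^sup>2) \<partial>lborel)"
        by (rule wiener_integral_approx[OF B X[OF t]])
           (use pm pN[of j] pN[of 0] in \<open>auto simp: t_def less_imp_le\<close>)
      also have "(\<integral>\<^sup>+s\<in>{0..t}. ennreal ((w t * h s - step_fun (j * N) p (\<lambda>k. w t * c k) s)\<^sup>2) \<partial>lborel)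
        \<le> (\<integral>\<^sup>+s. ennreal ((w t)\<^sup>2 * e\<^sup>2) * indicator {0..t} s \<partial>lborel)"
      proof (rule nn_integral_mono_AE)
        show "AE s in lborel. ennreal ((w t * h s - step_fun (j * N) p (\<lambda>k. w t * c k) s)\<^sup>2) * indicator {0..t} s
          \<le> ennreal ((w t)\<^sup>2 * e\<^sup>2) * indicator {0..t} s"
          \<comment> \<open>The half-open cells do not cover the point 0, where the step function
            vanishes while \<open>h\<close> does not.\<close>
          using AE_lborel_singleton[of 0]
        proof eventually_elim
          case (elim s)
          show ?case
          proof (cases "s \<in> {0..t}")
            case True
            then have "s \<in> {p 0<..p (j * N)}" using elim unfolding pN by (simp add: t_def p_def)
            then obtain i where i: "i < j * N" "s \<in> {p i<..p (Suc i)}" by (rule partition_cell)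
            have iL: "i < L" using i jL by simp
            have "step_fun (j * N) p c s = h (\<zeta> i)"
              using step_fun_eq[of "j * N" p i s c] pm i iL by (simp add: less_imp_le c_def)
            moreover have "\<bar>h s - h (\<zeta> i)\<bar> < e"
              using \<zeta>(1,2)[OF iL] i(2) p_diff[of i] True t by (intro \<delta>(2) \<zeta>_mem iL) auto
            ultimately have "\<bar>h s - step_fun (j * N) p c s\<bar> \<le> \<bar>e\<bar>" by simp
            then have "(h s - step_fun (j * N) p c s)\<^sup>2 \<le> e\<^sup>2" by (rule abs_le_square_iff[THEN iffD1])
            then have "(w t)\<^sup>2 * (h s - step_fun (j * N) p c s)\<^sup>2 \<le> (w t)\<^sup>2 * e\<^sup>2" by (rule mult_left_mono) simp
            then show ?thesis
              unfolding step_fun_scale right_diff_distrib[symmetric] power_mult_distrib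
              by (intro mult_right_mono ennreal_leI) auto
          qed simp
        qed
      qed
      also have "\<dots> = ennreal ((w t)\<^sup>2 * e\<^sup>2 * t)"
        using t by (subst nn_integral_cmult_indicator) (auto simp: ennreal_mult)
      also have "\<dots> \<le> ennreal ((w t)\<^sup>2 * e\<^sup>2 * S)" using t by (intro ennreal_leI mult_left_mono) auto
      finally have *: "(\<integral>\<^sup>+\<omega>. ennreal ((X t \<omega> - w t * Z j \<omega>)\<^sup>2) \<partial>M) \<le> 4 * ennreal ((w t)\<^sup>2 * e\<^sup>2 * S)"
        unfolding step_integral_scale Z_def by (simp add: mult_left_mono)
      have [measurable]: "X t \<in> borel_measurable M" "Z j \<in> borel_measurable M" using mX[OF t] mZ by auto
      have "(\<integral>\<^sup>+\<omega>. ennreal ((Y j \<omega> - Z j \<omega>)\<^sup>2) \<partial>M) = (\<integral>\<^sup>+\<omega>. ennreal (1 / (w t)\<^sup>2) * ennreal ((X t \<omega> - w t * Z j \<omega>)\<^sup>2) \<partial>M)"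
      proof (intro nn_integral_cong)
        fix \<omega>
        have "Y j \<omega> - Z j \<omega> = (X t \<omega> - w t * Z j \<omega>) / w t"
          using w[OF t] by (simp add: Y_def t_def[symmetric] diff_divide_distrib)
        then show "ennreal ((Y j \<omega> - Z j \<omega>)\<^sup>2) = ennreal (1 / (w t)\<^sup>2) * ennreal ((X t \<omega> - w t * Z j \<omega>)\<^sup>2)"
          by (simp add: ennreal_mult[symmetric] power_divide)
      qed
      also have "\<dots> = ennreal (1 / (w t)\<^sup>2) * (\<integral>\<^sup>+\<omega>. ennreal ((X t \<omega> - w t * Z j \<omega>)\<^sup>2) \<partial>M)"
        by (rule nn_integral_cmult) measurable
      also have "\<dots> \<le> ennreal (1 / (w t)\<^sup>2) * (4 * ennreal ((w t)\<^sup>2 * e\<^sup>2 * S))"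
        using * by (rule mult_left_mono) simp
      also have "\<dots> = ennreal (1 / (w t)\<^sup>2) * ennreal (4 * ((w t)\<^sup>2 * e\<^sup>2 * S))"
        using S by (subst (2) ennreal_mult) auto
      also have "\<dots> = ennreal (1 / (w t)\<^sup>2 * (4 * ((w t)\<^sup>2 * e\<^sup>2 * S)))"
        using S by (subst ennreal_mult) auto
      also have "1 / (w t)\<^sup>2 * (4 * ((w t)\<^sup>2 * e\<^sup>2 * S)) = 4 * S * e\<^sup>2" using w[OF t] by simp
      finally show ?thesis .
    qed
    have d: "integrable M (\<lambda>\<omega>. Y j \<omega> - Z j \<omega>)" "expectation (\<lambda>\<omega>. \<bar>Y j \<omega> - Z j \<omega>\<bar>) \<le> (1 + 4 * S) * e"
      if "j \<le> Suc m" for j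
      using expectation_abs_le[OF _ e _ L2[OF that]] mY[OF that] mZ[of j] S by auto
    have mEZ: "(\<lambda>\<omega>. diff_exponent m f \<gamma> (\<lambda>j. Z j \<omega>)) \<in> borel_measurable M"
      by (rule borel_measurable_diff_exponent) (rule mZ)
    have E0: "diff_exponent m f \<gamma> y \<ge> 0" for y using f \<gamma> by (intro diff_exponent_nonneg) auto
    have int: "integrable M (\<lambda>\<omega>. exp (- diff_exponent m f \<gamma> (\<lambda>j. Y j \<omega>) / 2))"
      "integrable M (\<lambda>\<omega>. exp (- diff_exponent m f \<gamma> (\<lambda>j. Z j \<omega>) / 2))"
      using mEY mEZ E0 by (auto intro!: integrable_const_bound[where B = 1])
    have "\<bar>A - V\<bar> = \<bar>expectation (\<lambda>\<omega>. exp (- diff_exponent m f \<gamma> (\<lambda>j. Y j \<omega>) / 2) - exp (- diff_exponent m f \<gamma> (\<lambda>j. Z j \<omega>) / 2))\<bar>"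
      unfolding A_def EZ[symmetric] by (subst Bochner_Integration.integral_diff[OF int]) simp
    also have "\<dots> \<le> expectation (\<lambda>\<omega>. \<bar>exp (- diff_exponent m f \<gamma> (\<lambda>j. Y j \<omega>) / 2) - exp (- diff_exponent m f \<gamma> (\<lambda>j. Z j \<omega>) / 2)\<bar>)"
      by (rule integral_abs_bound)
    also have "\<dots> \<le> expectation (\<lambda>\<omega>. C * (\<Sum>j\<le>m. \<bar>Y (Suc j) \<omega> - Z (Suc j) \<omega>\<bar>))"
      using int d C(2) by (intro integral_mono) auto
    also have "\<dots> = C * (\<Sum>j\<le>m. expectation (\<lambda>\<omega>. \<bar>Y (Suc j) \<omega> - Z (Suc j) \<omega>\<bar>))"
      using d by (simp add: Bochner_Integration.integral_sum)
    also have "\<dots> \<le> C * (\<Sum>j\<le>m. (1 + 4 * S) * e)"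
      using d C(1) by (intro mult_left_mono sum_mono) auto
    also have "\<dots> = (C * real (Suc m) * (1 + 4 * S)) * e" by simp
    finally show ?thesis .
  qed
  define D where "D = C * real (Suc m) * (1 + 4 * S)"
  have D: "D \<ge> 0" using C(1) S by (simp add: D_def)
  have "A = V"
  proof (rule ccontr)
    assume "A \<noteq> V"
    then have *: "\<bar>A - V\<bar> > 0" by simp
    define e where "e = \<bar>A - V\<bar> / 2 / (D + 1)"
    have "e > 0" using * D by (simp add: e_def)
    from approx[OF this] have "\<bar>A - V\<bar> \<le> D * e" by (simp add: D_def)
    also have "\<dots> \<le> (D + 1) * e" using \<open>e > 0\<close> by simp
    also have "(D + 1) * e = e * (D + 1)" by (rule mult.commute)
    also have "\<dots> = \<bar>A - V\<bar> / 2"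
      by (rule nonzero_eq_divide_eq[THEN iffD1]) (use D in \<open>simp_all add: e_def\<close>)
    finally show False using * by simp
  qed
  then show "expectation (\<lambda>\<omega>. exp (- diff_exponent m f \<gamma> (\<lambda>j. X (grid S m j) \<omega> / w (grid S m j)) / 2)) = sqrt (f (Suc m) / f 0)"
    by (simp add: A_def V_def Y_def)
qed

section \<open>Hadamard factorization in order one half\<close>

text \<open>The map from \<open>u\<close> to \<open>u / (2 * A - u)\<close> takes the half-plane
  \<open>Re u < A\<close> into the unit disc and fixes 0. The Schwarz lemma applies to its
  composition with \<open>h\<close>, rescaled to the unit disc, and the resulting inequality is
  solved for \<open>norm (h w)\<close>.\<close>

lemma Borel_Caratheodory:
  assumes h: "h holomorphic_on ball 0 R" "h 0 = 0" and A: "A > 0" and R: "R > 0"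
    and Re: "\<And>z. norm z < R \<Longrightarrow> Re (h z) < A" and w: "norm w < R"
  shows "norm (h w) \<le> 2 * A * norm w / (R - norm w)"
proof -
  define k where "k z = h (of_real R * z) / (2 * of_real A - h (of_real R * z))" for z :: complex
  have in_ball: "norm (of_real R * z) < R" if "norm z < 1" for z :: complex
    using that R by (simp add: norm_mult)
  have den: "2 * of_real A - h z \<noteq> 0" if "norm z < R" for z
    using Re[OF that] A by (auto simp: complex_eq_iff)
  have lt: "norm (h z) < norm (2 * of_real A - h z)" if "norm z < R" for z
  proof -
    have "(Re (h z))\<^sup>2 < (2 * A - Re (h z))\<^sup>2"
    proof -
      have "0 < 4 * A * (A - Re (h z))" using Re[OF that] A by simp
      then show ?thesis by (simp add: power2_eq_square algebra_simps)
    qed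
    then show ?thesis by (simp add: cmod_def)
  qed
  have "norm (k \<xi>) \<le> norm \<xi>" if "norm \<xi> < 1" for \<xi>
  proof (rule Schwarz_Lemma(1)[OF _ _ _ that])
    show "k holomorphic_on ball 0 1"
      unfolding k_def
    proof (intro holomorphic_on_divide holomorphic_on_diff holomorphic_on_const)
      have "(h \<circ> (\<lambda>z. of_real R * z)) holomorphic_on ball 0 1"
        by (rule holomorphic_on_compose_gen[OF _ h(1)]) (auto intro!: holomorphic_intros in_ball)
      then show "(\<lambda>z. h (of_real R * z)) holomorphic_on ball 0 1" "(\<lambda>z. h (of_real R * z)) holomorphic_on ball 0 1"
        by (simp_all add: o_def)
    qed (use den in_ball in auto)
    show "k 0 = 0" using h by (simp add: k_def)
    fix z :: complex assume "norm z < 1"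
    then have "norm (of_real R * z) < R" by (rule in_ball)
    from lt[OF this] show "norm (k z) < 1"
      unfolding k_def norm_divide by (subst divide_less_eq_1_pos) (use norm_ge_zero le_less_trans in blast)+
  qed
  from this[of "w / of_real R"] w R
  have "norm (h w / (2 * of_real A - h w)) \<le> norm w / R" by (simp add: k_def norm_divide)
  then have "norm (h w) * R \<le> norm w * norm (2 * of_real A - h w)"
    using den[OF w] R by (simp add: norm_divide field_simps)
  also have "\<dots> \<le> norm w * (2 * A + norm (h w))"
    using norm_triangle_ineq4[of "2 * of_real A" "h w"] A by (intro mult_left_mono) (auto simp: norm_mult)
  finally have "norm (h w) * (R - norm w) \<le> 2 * A * norm w" by (simp add: algebra_simps)
  then show ?thesis using w by (simp add: field_simps)
qed

text \<open>Zeros are removed one at a time. If \<open>g a = 0\<close>, the product rule gives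
  \<open>deriv f a = P a * deriv g a\<close>, so simplicity of the zero of \<open>f\<close> passes
  to \<open>g\<close>, and the quotient no longer vanishes at \<open>a\<close>.\<close>

lemma divide_by_simple_zeros:
  fixes f :: "complex \<Rightarrow> complex"
  assumes f: "f holomorphic_on UNIV" and simple: "\<And>z. f z = 0 \<Longrightarrow> deriv f z \<noteq> 0"
    and A: "finite A" "\<And>a. a \<in> A \<Longrightarrow> f a = 0" "0 \<notin> A"
  shows "\<exists>g. g holomorphic_on UNIV \<and> (\<forall>z. f z = (\<Prod>a\<in>A. 1 - z / a) * g z) \<and> (\<forall>z. g z = 0 \<longrightarrow> f z = 0 \<and> z \<notin> A)"
  using A
proof (induction rule: finite_induct)
  case empty
  then show ?case using f by auto
next
  case (insert a A)
  define P where "P z = (\<Prod>a\<in>A. 1 - z / a)" for z :: complex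
  obtain g where g: "g holomorphic_on UNIV" "\<And>z. f z = P z * g z" "\<And>z. g z = 0 \<Longrightarrow> f z = 0 \<and> z \<notin> A"
    using insert.IH insert.prems unfolding P_def by blast
  have a: "a \<noteq> 0" "f a = 0" using insert.prems by auto
  have A0: "b \<noteq> 0" if "b \<in> A" for b using insert.prems that by auto
  have Pa: "P a \<noteq> 0" using insert.hyps A0 unfolding P_def by (auto simp: prod_zero_iff)
  then have ga: "g a = 0" using g(2)[of a] a by simp
  have g': "(g has_field_derivative deriv g a) (at a)"
    by (rule holomorphic_derivI[OF g(1)]) auto
  have P': "(P has_field_derivative deriv P a) (at a)"
  proof (rule holomorphic_derivI[of _ UNIV])
    show "P holomorphic_on UNIV" unfolding P_def[abs_def] using A0 by (intro holomorphic_intros) auto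
  qed auto
  have "((\<lambda>z. P z * g z) has_field_derivative P a * deriv g a + deriv P a * g a) (at a)"
    by (rule DERIV_mult'[OF P' g', THEN DERIV_cong]) simp
  moreover have "(\<lambda>z. P z * g z) = f" by (rule ext) (simp only: g(2))
  ultimately have "(f has_field_derivative P a * deriv g a + deriv P a * g a) (at a)" by simp
  from DERIV_imp_deriv[OF this] have "deriv f a = P a * deriv g a" by (simp only: ga mult_zero_right add_0_right)
  then have dga: "deriv g a \<noteq> 0" using simple[OF a(2)] by auto
  \<comment> \<open>The difference quotient of \<open>g\<close> at \<open>a\<close>, completed by
    the derivative at the removable singularity; the factor \<open>- a\<close> turns
    \<open>z - a\<close> into \<open>1 - z / a\<close>.\<close>
  define k where "k z = - a * (if z = a then deriv g a else (g z - g a) / (z - a))" for z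
  have k_hol: "k holomorphic_on UNIV"
    unfolding k_def by (intro holomorphic_intros pole_lemma_open[OF g(1)]) auto
  have gk: "g z = (1 - z / a) * k z" for z
    using a ga by (auto simp: k_def field_simps)
  have fk: "f z = (\<Prod>a\<in>insert a A. 1 - z / a) * k z" for z
    unfolding g(2)[of z] gk[of z] using insert.hyps by (simp add: P_def)
  have k0: "f z = 0 \<and> z \<notin> insert a A" if "k z = 0" for z
  proof -
    have "g z = 0" using gk[of z] that by simp
    moreover have "z \<noteq> a" using that dga a by (auto simp: k_def)
    ultimately show ?thesis using g(3)[of z] by simp
  qed
  show ?case
    using k_hol fk k0 by (intro exI[of _ k] conjI allI impI) blast+
qed

text \<open>The quotient of \<open>f\<close> by the product over the zeros of
  modulus less than \<open>R\<close> has no zero in the disc of radius \<open>R\<close>, and on the circle of radius \<open>2 R\<close>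
  each factor has modulus at least 1, so the maximum principle bounds the quotient by the growth
  of \<open>f\<close>; Borel-Caratheodory then forces its logarithm to 0.\<close>

lemma hadamard_product_order_half:
  fixes f :: "complex \<Rightarrow> complex" and a :: "nat \<Rightarrow> complex"
  assumes f: "f holomorphic_on UNIV" "f 0 = 1"
    and growth: "\<And>z. norm (f z) \<le> exp (C * sqrt (norm z))" and C: "C \<ge> 0"
    and simple: "\<And>z. f z = 0 \<Longrightarrow> deriv f z \<noteq> 0"
    and a: "strict_mono (\<lambda>n. norm (a n))" "range a = {z. f z = 0}"
  shows "(\<lambda>n. \<Prod>k<n. 1 - w / a k) \<longlonglongrightarrow> f w"
proof -
  define R where "R n = norm (a n)" for n
  have fa: "f (a n) = 0" for n
  proof -
    have "a n \<in> range a" by (rule rangeI)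
    then show ?thesis unfolding a(2) by simp
  qed
  have a0: "a n \<noteq> 0" for n
    using fa[of n] f(2) by (cases "a n = 0") simp_all
  then have R0: "R n > 0" for n by (simp add: R_def)
  have inj: "inj a"
    by (rule injI) (metis a(1) strict_mono_eq)
  have nconst: "\<not> f constant_on UNIV"
  proof
    assume "f constant_on UNIV"
    then have "f (a 0) = f 0" by (auto simp: constant_on_def)
    then show False using f(2) fa[of 0] by simp
  qed
  have mono: "R n \<le> R k" if "n \<le> k" for n k
    using monoD[OF strict_mono_mono[OF a(1)] that] by (simp add: R_def)
  \<comment> \<open>Otherwise infinitely many zeros would lie in one closed disc, which is
    impossible for a nonconstant entire function.\<close>
  have Rtop: "filterlim R at_top sequentially"
    unfolding filterlim_at_top
  proof
    fix Z
    have "\<exists>n. R n > Z"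
    proof (rule ccontr)
      assume "\<not> (\<exists>n. R n > Z)"
      then have "range a \<subseteq> {z \<in> cball 0 Z. f z = 0}" by (auto simp: R_def not_less fa)
      moreover have "finite {z \<in> cball 0 Z. f z = 0}"
        by (rule holomorphic_compact_finite_zeros[OF f(1) open_UNIV connected_UNIV compact_cball _ nconst]) auto
      ultimately have "finite (range a)" by (rule finite_subset)
      then show False using inj by (simp add: finite_image_iff)
    qed
    then obtain n where n: "R n > Z" by blast
    show "eventually (\<lambda>n. Z \<le> R n) sequentially"
      unfolding eventually_sequentially
    proof (intro exI allI impI)
      fix k assume "n \<le> k"
      from mono[OF this] show "Z \<le> R k" using n by simp
    qed
  qed
  have ex: "\<exists>g. g holomorphic_on UNIV \<and> (\<forall>z. f z = (\<Prod>k<n. 1 - z / a k) * g z) \<and> (\<forall>z. g z = 0 \<longrightarrow> norm z \<ge> R n)" for n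
  proof -
    have "\<exists>g. g holomorphic_on UNIV \<and> (\<forall>z. f z = (\<Prod>b\<in>a ` {..<n}. 1 - z / b) * g z) \<and> (\<forall>z. g z = 0 \<longrightarrow> f z = 0 \<and> z \<notin> a ` {..<n})"
      by (rule divide_by_simple_zeros[OF f(1) simple]) (use fa a0 in \<open>auto simp: image_iff\<close>)
    then obtain g where g: "g holomorphic_on UNIV" "\<And>z. f z = (\<Prod>b\<in>a ` {..<n}. 1 - z / b) * g z"
      "\<And>z. g z = 0 \<Longrightarrow> f z = 0 \<and> z \<notin> a ` {..<n}" by blast
    have "(\<Prod>b\<in>a ` {..<n}. 1 - z / b) = (\<Prod>k<n. 1 - z / a k)" for z
      using inj by (subst prod.reindex) (auto intro: inj_on_subset)
    \<comment> \<open>Strictly increasing moduli make the first \<open>n\<close> listed zeros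
      precisely those of modulus below \<open>R n\<close>.\<close>
    moreover have "norm z \<ge> R n" if "g z = 0" for z
    proof -
      have "z \<in> range a" using g(3)[OF that] a(2) by auto
      then obtain k where k: "z = a k" by auto
      then have "n \<le> k" using g(3)[OF that] by (metis image_eqI lessThan_iff not_less)
      from mono[OF this] show ?thesis by (simp add: k R_def)
    qed
    ultimately show ?thesis using g(1,2) by metis
  qed
  \<comment> \<open>The Borel-Caratheodory bound with \<open>A = C * sqrt (2 * r) + 1\<close>, the 1
    providing strict inequality and positivity. It decays like \<open>1 / sqrt r\<close>, because
    the growth exponent 1/2 is below 1.\<close>
  define K where "K r = 2 * (C * sqrt (2 * r) + 1) * norm w / (r - norm w)" for r
  have K: "(\<lambda>n. K (R n)) \<longlonglongrightarrow> 0"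
  proof (rule filterlim_compose[OF _ Rtop])
    show "(K \<longlongrightarrow> 0) at_top" unfolding K_def by real_asymp
  qed
  have key: "\<exists>h. norm h \<le> K (R n) \<and> f w = (\<Prod>k<n. 1 - w / a k) * exp h" if n: "norm w < R n" for n
  proof -
    obtain g where g: "g holomorphic_on UNIV" "\<And>z. f z = (\<Prod>k<n. 1 - z / a k) * g z"
      "\<And>z. g z = 0 \<Longrightarrow> norm z \<ge> R n" using ex[of n] by blast
    have bound: "norm (g z) \<le> exp (C * sqrt (2 * R n))" if "norm z \<le> 2 * R n" for z
    proof (rule maximum_modulus_frontier[of g "cball 0 (2 * R n)"])
      fix z :: complex assume "z \<in> frontier (cball 0 (2 * R n))"
      then have z: "norm z = 2 * R n" using R0[of n] by (simp add: frontier_cball)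
      have "1 \<le> norm (1 - z / a k)" if "k < n" for k
      proof -
        have "2 \<le> norm z / norm (a k)" using mono[of k n] that a0[of k] unfolding z by (simp add: R_def field_simps)
        then show ?thesis using norm_triangle_ineq3[of "z / a k" 1] norm_minus_commute[of 1 "z / a k"]
          by (simp add: norm_divide)
      qed
      then have "1 \<le> norm (\<Prod>k<n. 1 - z / a k)"
        unfolding prod_norm[symmetric] by (intro prod_ge_1) auto
      then have "norm (g z) \<le> norm (\<Prod>k<n. 1 - z / a k) * norm (g z)"
        using mult_right_mono[of 1 "norm (\<Prod>k<n. 1 - z / a k)" "norm (g z)"] by simp
      also have "\<dots> = norm (f z)" by (simp only: g(2) norm_mult)
      also have "\<dots> \<le> exp (C * sqrt (2 * R n))" using growth[of z] unfolding z .
      finally show "norm (g z) \<le> exp (C * sqrt (2 * R n))" .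
    qed (use that g(1) in \<open>auto intro: holomorphic_on_imp_continuous_on holomorphic_on_subset\<close>)
    obtain h where h: "h holomorphic_on ball 0 (R n)" "\<And>z. z \<in> ball 0 (R n) \<Longrightarrow> exp (h z) = g z"
    proof (rule holomorphic_logarithm_exists[of "ball 0 (R n)" g 0])
      show "g z \<noteq> 0" if "z \<in> ball 0 (R n)" for z using g(3)[of z] that by auto
    qed (use R0[of n] g(1) in \<open>auto intro: holomorphic_on_subset\<close>)
    have g0: "g 0 = 1" using g(2)[of 0] f(2) by simp
    \<comment> \<open>Normalizing the logarithm to vanish at 0 is harmless, since
      \<open>exp (h 0) = g 0 = 1\<close>.\<close>
    define H where "H z = h z - h 0" for z
    have expH: "exp (H z) = g z" if "norm z < R n" for z
      using h(2)[of z] h(2)[of 0] that R0[of n] g0 by (simp add: H_def exp_diff)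
    have "norm (H w) \<le> 2 * (C * sqrt (2 * R n) + 1) * norm w / (R n - norm w)"
    proof (rule Borel_Caratheodory[OF _ _ _ R0 _ n])
      show "H holomorphic_on ball 0 (R n)" unfolding H_def by (intro holomorphic_intros h)
      show "C * sqrt (2 * R n) + 1 > 0" using C R0[of n] by (simp add: add_nonneg_pos)
      fix z :: complex assume z: "norm z < R n"
      have "exp (Re (H z)) = norm (g z)" using expH[OF z] by (metis norm_exp_eq_Re)
      also have "\<dots> \<le> exp (C * sqrt (2 * R n))" using z R0[of n] by (intro bound) simp
      finally show "Re (H z) < C * sqrt (2 * R n) + 1" by simp
    qed (simp add: H_def)
    then show ?thesis using g(2)[of w] expH[OF n] unfolding K_def by metis
  qed
  have ev: "eventually (\<lambda>n. norm w < R n) sequentially"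
    using Rtop by (simp add: filterlim_at_top_dense)
  define H where "H n = (SOME h. norm h \<le> K (R n) \<and> f w = (\<Prod>k<n. 1 - w / a k) * exp h)" for n
  have H: "norm (H n) \<le> K (R n) \<and> f w = (\<Prod>k<n. 1 - w / a k) * exp (H n)" if "norm w < R n" for n
    using someI_ex[OF key[OF that]] unfolding H_def .
  have "H \<longlonglongrightarrow> 0"
    by (rule Lim_null_comparison[OF _ K]) (use ev H in \<open>auto elim: eventually_mono\<close>)
  then have "(\<lambda>n. f w * exp (- H n)) \<longlonglongrightarrow> f w * exp (- 0)"
    by (intro tendsto_intros)
  moreover have "eventually (\<lambda>n. f w * exp (- H n) = (\<Prod>k<n. 1 - w / a k)) sequentially"
    using ev
  proof eventually_elim
    case (elim n)
    show ?case using H[OF elim] by (simp add: exp_minus field_simps)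
  qed
  ultimately show ?thesis by (simp add: tendsto_cong)
qed

section \<open>The Bessel functions\<close>

text \<open>The Taylor coefficients of the hypergeometric function 0F1 with parameter
  \<open>\<nu> + 1\<close>. The Pochhammer symbol in place of Gamma makes the value at 0 equal to
  1.\<close>

definition bessel_coeff :: "real \<Rightarrow> nat \<Rightarrow> real" where
  "bessel_coeff \<nu> k = 1 / (fact k * pochhammer (\<nu> + 1) k)"

text \<open>\<open>J\<^sub>\<nu>(x)\<close> equals \<open>(x/2)\<^sup>\<nu> / \<Gamma>(\<nu> + 1)\<close> times the value at \<open>- x\<^sup>2 / 4\<close> of this entire function, and
  \<open>I\<^sub>\<nu>(x)\<close> is the same multiple of its value at \<open>x\<^sup>2 / 4\<close>.\<close>

definition bessel_entire :: "real \<Rightarrow> 'a::{real_normed_field,banach} \<Rightarrow> 'a" where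
  "bessel_entire \<nu> z = (\<Sum>k. of_real (bessel_coeff \<nu> k) * z ^ k)"

section \<open>Power series, positivity and growth\<close>

lemma cosh_even_series: "(\<lambda>k. x ^ (2 * k) / fact (2 * k)) sums cosh (x::real)"
proof -
  have "(\<lambda>n. sum (\<lambda>n. if even n then x ^ n /\<^sub>R fact n else 0) {n * 2..<n * 2 + 2}) sums cosh x"
    by (rule sums_group[OF cosh_converges]) simp
  moreover have "sum (\<lambda>n. if even n then x ^ n /\<^sub>R fact n else 0) {n * 2..<n * 2 + 2} = x ^ (2 * n) / fact (2 * n)" for n
  proof -
    have "{n * 2..<n * 2 + 2} = {2 * n, Suc (2 * n)}" by auto
    then show ?thesis by (simp add: divide_inverse mult.commute)
  qed
  ultimately show ?thesis by simp
qed

lemma sinh_odd_series: "(\<lambda>k. x ^ (2 * k + 1) / fact (2 * k + 1)) sums sinh (x::real)"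
proof -
  have "(\<lambda>n. sum (\<lambda>n. if even n then 0 else x ^ n /\<^sub>R fact n) {n * 2..<n * 2 + 2}) sums sinh x"
    by (rule sums_group[OF sinh_converges]) simp
  moreover have "sum (\<lambda>n. if even n then 0 else x ^ n /\<^sub>R fact n) {n * 2..<n * 2 + 2} = x ^ (2 * n + 1) / fact (2 * n + 1)" for n
  proof -
    have "{n * 2..<n * 2 + 2} = {2 * n, Suc (2 * n)}" by auto
    then show ?thesis by (simp add: divide_inverse mult.commute del: fact_Suc)
  qed
  ultimately show ?thesis by simp
qed

lemma bessel_coeff_pos: "\<nu> \<ge> - 1 / 2 \<Longrightarrow> bessel_coeff \<nu> k > 0"
  by (simp add: bessel_coeff_def pochhammer_pos)

text \<open>The Pochhammer symbol is smallest at \<open>\<nu> = - 1 / 2\<close>, where the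
  duplication formula turns the coefficient into that of \<open>cosh (2 * sqrt z)\<close>. Summation
  then gives the growth bound \<open>exp (2 * sqrt (norm z))\<close>.\<close>

lemma bessel_coeff_le:
  assumes "\<nu> \<ge> - 1 / 2"
  shows "bessel_coeff \<nu> k \<le> 4 ^ k / fact (2 * k)"
proof -
  have "pochhammer (1 / 2) k \<le> pochhammer (\<nu> + 1) k"
    unfolding pochhammer_prod using assms by (intro prod_mono) auto
  then have "fact k * pochhammer (1 / 2) k \<le> fact k * pochhammer (\<nu> + 1) k" by simp
  moreover have "fact k * pochhammer (1 / 2) k = fact (2 * k) / (4 ^ k :: real)"
    by (simp add: fact_double power_mult)
  ultimately have "fact (2 * k) / 4 ^ k \<le> fact k * pochhammer (\<nu> + 1) k" by simp
  then have "1 / (fact k * pochhammer (\<nu> + 1) k) \<le> 1 / (fact (2 * k) / 4 ^ k)"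
    by (intro divide_left_mono mult_pos_pos) (use assms in \<open>auto simp: pochhammer_pos\<close>)
  then show ?thesis by (simp add: bessel_coeff_def)
qed

lemma bessel_term_le:
  fixes z :: "'a::{real_normed_field,banach}"
  assumes "\<nu> \<ge> - 1 / 2"
  shows "norm (of_real (bessel_coeff \<nu> k) * z ^ k) \<le> (2 * sqrt (norm z)) ^ (2 * k) / fact (2 * k)"
proof -
  have "norm (of_real (bessel_coeff \<nu> k) * z ^ k) = bessel_coeff \<nu> k * norm z ^ k"
    using bessel_coeff_pos[OF assms, of k] by (simp add: norm_mult norm_power)
  also have "\<dots> \<le> 4 ^ k / fact (2 * k) * norm z ^ k"
    by (rule mult_right_mono[OF bessel_coeff_le[OF assms]]) simp
  also have "\<dots> = (2 * sqrt (norm z)) ^ (2 * k) / fact (2 * k)"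
    by (simp add: power_mult power_mult_distrib)
  finally show ?thesis .
qed

lemma summable_bessel:
  fixes z :: "'a::{real_normed_field,banach}"
  assumes "\<nu> \<ge> - 1 / 2"
  shows "summable (\<lambda>k. of_real (bessel_coeff \<nu> k) * z ^ k)"
  by (rule summable_comparison_test'[OF sums_summable[OF cosh_even_series] bessel_term_le[OF assms]])

lemma norm_bessel_entire_le:
  fixes z :: "'a::{real_normed_field,banach}"
  assumes "\<nu> \<ge> - 1 / 2"
  shows "norm (bessel_entire \<nu> z) \<le> exp (2 * sqrt (norm z))"
proof -
  let ?b = "\<lambda>k. (2 * sqrt (norm z)) ^ (2 * k) / fact (2 * k)"
  have s: "?b sums cosh (2 * sqrt (norm z))" by (rule cosh_even_series)
  have "norm (bessel_entire \<nu> z) \<le> (\<Sum>k. ?b k)"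
    unfolding bessel_entire_def
    by (rule norm_suminf_le[OF bessel_term_le[OF assms] sums_summable[OF s]])
  also have "\<dots> = cosh (2 * sqrt (norm z))" using s by (simp add: sums_iff)
  also have "\<dots> \<le> exp (2 * sqrt (norm z))" by (simp add: cosh_def)
  finally show ?thesis .
qed

lemma bessel_entire_0 [simp]: "bessel_entire \<nu> 0 = 1"
  unfolding bessel_entire_def
  by (subst suminf_finite[of "{0}"]) (auto simp: bessel_coeff_def)

lemma bessel_entire_of_real:
  assumes "\<nu> \<ge> - 1 / 2"
  shows "bessel_entire \<nu> (of_real x) = of_real (bessel_entire \<nu> x)"
  unfolding bessel_entire_def
  using suminf_of_real[OF summable_bessel[OF assms, of x], where ?'a = 'a] by simp

lemma bessel_entire_ge_1:
  fixes x :: real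
  assumes "\<nu> \<ge> - 1 / 2" "x \<ge> 0"
  shows "bessel_entire \<nu> x \<ge> 1"
proof -
  have "(\<Sum>k\<in>{0}. of_real (bessel_coeff \<nu> k) * x ^ k) \<le> bessel_entire \<nu> x"
    unfolding bessel_entire_def using assms less_imp_le[OF bessel_coeff_pos[OF assms(1)]]
    by (intro sum_le_suminf summable_bessel) (auto intro!: mult_nonneg_nonneg)
  then show ?thesis by (simp add: bessel_coeff_def)
qed

section \<open>Derivatives, contiguous relation and the elementary case\<close>

lemma bessel_coeff_Suc:
  assumes "\<nu> \<ge> - 1 / 2"
  shows "real (Suc k) * bessel_coeff \<nu> (Suc k) = bessel_coeff (\<nu> + 1) k / (\<nu> + 1)"
proof -
  have "pochhammer (\<nu> + 1) (Suc k) = (\<nu> + 1) * pochhammer (\<nu> + 1 + 1) k" by (rule pochhammer_rec)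
  moreover have "fact (Suc k) = real (Suc k) * fact k" by simp
  ultimately show ?thesis
    using assms unfolding bessel_coeff_def by (simp add: divide_simps del: of_nat_Suc fact_Suc)
qed

text \<open>The counterpart of the rule that the derivative of \<open>x powr (- \<nu>)\<close> times
  the Bessel function of order \<open>\<nu>\<close> is minus \<open>x powr (- \<nu>)\<close> times
  that of order \<open>\<nu> + 1\<close>.\<close>

lemma bessel_entire_deriv:
  fixes z :: "'a::{real_normed_field,banach}"
  assumes "\<nu> \<ge> - 1 / 2"
  shows "(bessel_entire \<nu> has_field_derivative bessel_entire (\<nu> + 1) z / of_real (\<nu> + 1)) (at z)"
proof -
  have "((\<lambda>z. \<Sum>k. of_real (bessel_coeff \<nu> k) * z ^ k) has_field_derivative
      (\<Sum>k. diffs (\<lambda>k. of_real (bessel_coeff \<nu> k)) k * z ^ k)) (at z)"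
    by (rule termdiffs_strong_converges_everywhere[OF summable_bessel[OF assms]])
  moreover have "diffs (\<lambda>k. of_real (bessel_coeff \<nu> k) :: 'a) k = of_real (bessel_coeff (\<nu> + 1) k) / of_real (\<nu> + 1)" for k
  proof -
    have "diffs (\<lambda>k. of_real (bessel_coeff \<nu> k) :: 'a) k = of_real (real (Suc k) * bessel_coeff \<nu> (Suc k))"
      unfolding diffs_def by (simp del: of_nat_Suc)
    then show ?thesis unfolding bessel_coeff_Suc[OF assms] by simp
  qed
  moreover have "(\<Sum>k. of_real (bessel_coeff (\<nu> + 1) k) / of_real (\<nu> + 1) * z ^ k) = bessel_entire (\<nu> + 1) z / of_real (\<nu> + 1)"
    using suminf_divide[OF summable_bessel[of "\<nu> + 1" z], of "of_real (\<nu> + 1)"] assms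
    by (simp add: bessel_entire_def)
  ultimately show ?thesis unfolding bessel_entire_def[abs_def] by simp
qed

lemmas bessel_entire_deriv' [derivative_intros] = DERIV_chain2[OF bessel_entire_deriv]

text \<open>The three-term Bessel recurrence, proved by comparing coefficients. In view of the
  derivative formula it is also the differential equation \<open>z F'' + (\<nu> + 1) F' = F\<close>
  for \<open>F = bessel_entire \<nu>\<close>.\<close>

lemma bessel_entire_contiguous:
  fixes z :: "'a::{real_normed_field,banach}"
  assumes "\<nu> \<ge> - 1 / 2"
  shows "bessel_entire \<nu> z = bessel_entire (\<nu> + 1) z + z * bessel_entire (\<nu> + 2) z / of_real ((\<nu> + 1) * (\<nu> + 2))"
proof -
  have c: "bessel_coeff \<nu> (Suc k) = bessel_coeff (\<nu> + 1) (Suc k) + bessel_coeff (\<nu> + 2) k / ((\<nu> + 1) * (\<nu> + 2))" for k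
  proof -
    define P where "P = pochhammer (\<nu> + 2) k"
    define Q where "Q = pochhammer (\<nu> + 3) k"
    have PQ: "P > 0" "Q > 0" using assms by (simp_all add: P_def Q_def pochhammer_pos)
    have r1: "pochhammer (\<nu> + 1) (Suc k) = (\<nu> + 1) * P"
      using pochhammer_rec[of "\<nu> + 1" k] by (simp add: P_def add.assoc)
    have r2: "pochhammer (\<nu> + 2) (Suc k) = (\<nu> + 2) * Q"
      using pochhammer_rec[of "\<nu> + 2" k] by (simp add: Q_def add.assoc)
    have r3: "pochhammer (\<nu> + 2) (Suc k) = P * (\<nu> + 2 + real k)"
      by (simp add: P_def pochhammer_Suc)
    have Q: "Q = P * (\<nu> + 2 + real k) / (\<nu> + 2)" using r2 r3 assms by (simp add: field_simps)
    define F where "F = (fact k :: real)"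
    have F: "F > 0" by (simp add: F_def)
    have n: "\<nu> + 1 > 0" "\<nu> + 2 > 0" "\<nu> + 2 + real k > 0" using assms by auto
    have e1: "bessel_coeff \<nu> (Suc k) = 1 / (real (Suc k) * F * ((\<nu> + 1) * P))"
      unfolding bessel_coeff_def r1 F_def by simp
    have e2: "bessel_coeff (\<nu> + 1) (Suc k) = 1 / (real (Suc k) * F * (P * (\<nu> + 2 + real k)))"
      unfolding bessel_coeff_def F_def using r3 by (simp add: add.assoc)
    have e3: "bessel_coeff (\<nu> + 2) k = 1 / (F * Q)"
      unfolding bessel_coeff_def F_def Q_def by (simp add: add.assoc)
    show ?thesis
      unfolding e1 e2 e3 Q using n F PQ(1) by (simp add: divide_simps del: of_nat_Suc)
  qed
  have n: "\<nu> + 1 \<ge> - 1 / 2" "\<nu> + 2 \<ge> - 1 / 2" using assms by auto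
  have h: "bessel_entire \<mu> z = 1 + (\<Sum>k. of_real (bessel_coeff \<mu> (Suc k)) * z ^ Suc k)" if "\<mu> \<ge> - 1 / 2" for \<mu>
    unfolding bessel_entire_def
    using suminf_split_head[OF summable_bessel[OF that, of z]] by (simp add: bessel_coeff_def)
  have s: "summable (\<lambda>k. of_real (bessel_coeff \<mu> (Suc k)) * z ^ Suc k)" if "\<mu> \<ge> - 1 / 2" for \<mu>
    using summable_bessel[OF that, of z] by (subst summable_Suc_iff)
  have s2: "summable (\<lambda>k. z / of_real ((\<nu> + 1) * (\<nu> + 2)) * (of_real (bessel_coeff (\<nu> + 2) k) * z ^ k))"
    by (intro summable_mult summable_bessel n)
  have "bessel_entire \<nu> z = 1 + (\<Sum>k. of_real (bessel_coeff (\<nu> + 1) (Suc k)) * z ^ Suc k +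
      z / of_real ((\<nu> + 1) * (\<nu> + 2)) * (of_real (bessel_coeff (\<nu> + 2) k) * z ^ k))"
    unfolding h[OF assms] c by (simp add: algebra_simps)
  also have "\<dots> = 1 + (\<Sum>k. of_real (bessel_coeff (\<nu> + 1) (Suc k)) * z ^ Suc k) +
      z / of_real ((\<nu> + 1) * (\<nu> + 2)) * bessel_entire (\<nu> + 2) z"
    unfolding bessel_entire_def
    by (subst suminf_add[OF s[OF n(1)] s2, symmetric]) (simp only: suminf_mult[OF summable_bessel[OF n(2)]] add.assoc)
  finally show ?thesis unfolding h[OF n(1)] by simp
qed

text \<open>Here \<open>4 ^ k * k!\<close> times the Pochhammer symbol of 3/2 is
  \<open>(2 k + 1)!\<close>. This follows from the duplication formula at \<open>Suc k\<close> after
  cancelling the factor \<open>2 * Suc k\<close>.\<close>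

lemma bessel_entire_half: "x \<noteq> 0 \<Longrightarrow> bessel_entire (1 / 2) (x\<^sup>2 / 4) = sinh x / (x :: real)"
proof -
  assume x: "x \<noteq> 0"
  have c: "bessel_coeff (1 / 2) k = 4 ^ k / fact (2 * k + 1)" for k
  proof -
    have "fact (2 * Suc k) = (4 ^ Suc k * pochhammer (1 / 2) (Suc k) * fact (Suc k) :: real)"
      using fact_double[of "Suc k", where ?'a = real] by (simp add: power_mult)
    moreover have "pochhammer (1 / 2 :: real) (Suc k) = (1 / 2) * pochhammer (1 / 2 + 1) k" by (rule pochhammer_rec)
    moreover have "fact (2 * Suc k) = (2 * real (Suc k)) * (fact (2 * k + 1) :: real)" by simp
    ultimately have "fact (2 * k + 1) = (4 ^ k * pochhammer (1 / 2 + 1) k * fact k :: real)"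
      by (simp del: of_nat_Suc)
    then show ?thesis unfolding bessel_coeff_def by (simp add: field_simps del: fact_Suc)
  qed
  have "(\<lambda>k. x ^ (2 * k + 1) / fact (2 * k + 1) / x) sums (sinh x / x)"
    by (rule sums_divide[OF sinh_odd_series])
  moreover have "x ^ (2 * k + 1) / fact (2 * k + 1) / x = of_real (bessel_coeff (1 / 2) k) * (x\<^sup>2 / 4) ^ k" for k
    unfolding c using x by (simp add: power_divide power_mult del: fact_Suc)
  ultimately show ?thesis unfolding bessel_entire_def by (simp add: sums_iff)
qed

section \<open>Zeros: simple, real and negative\<close>

lemma bessel_entire_holomorphic: "\<nu> \<ge> - 1 / 2 \<Longrightarrow> bessel_entire \<nu> holomorphic_on A"
  using bessel_entire_deriv by (auto simp: holomorphic_on_def field_differentiable_def intro: has_field_derivative_at_within)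

lemma bessel_entire_higher_deriv:
  assumes "\<nu> \<ge> - 1 / 2"
  shows "(deriv ^^ n) (bessel_entire \<nu>) z = bessel_entire (\<nu> + real n) (z::complex) / of_real (pochhammer (\<nu> + 1) n)"
proof (induction n arbitrary: z)
  case (Suc n)
  have "(deriv ^^ Suc n) (bessel_entire \<nu>) z = deriv (\<lambda>z. bessel_entire (\<nu> + real n) z / of_real (pochhammer (\<nu> + 1) n)) z"
  proof -
    have "(deriv ^^ n) (bessel_entire \<nu>) = (\<lambda>z. bessel_entire (\<nu> + real n) z / complex_of_real (pochhammer (\<nu> + 1) n))"
      by (rule ext) (rule Suc.IH)
    then show ?thesis by simp
  qed
  also have "\<dots> = bessel_entire (\<nu> + real n + 1) z / of_real (\<nu> + real n + 1) / of_real (pochhammer (\<nu> + 1) n)"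
    using assms by (intro DERIV_imp_deriv DERIV_cdivide bessel_entire_deriv) auto
  also have "\<dots> = bessel_entire (\<nu> + real (Suc n)) z / of_real (pochhammer (\<nu> + 1) (Suc n))"
    by (simp add: pochhammer_Suc add_ac mult.commute)
  finally show ?case .
qed simp

text \<open>A common zero of orders \<open>\<nu>\<close> and \<open>\<nu> + 1\<close> is nonzero, so
  the contiguous relation propagates it to all orders \<open>\<nu> + m\<close>. Then every
  derivative vanishes there and the function is identically 0, against its value 1 at 0.\<close>

lemma bessel_entire_simple_zero:
  assumes \<nu>: "\<nu> \<ge> - 1 / 2" and z: "bessel_entire \<nu> (z::complex) = 0"
  shows "bessel_entire (\<nu> + 1) z \<noteq> 0"
proof
  assume z1: "bessel_entire (\<nu> + 1) z = 0"
  have z0: "z \<noteq> 0" using z by auto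
  have "bessel_entire (\<nu> + real m) z = 0 \<and> bessel_entire (\<nu> + real (Suc m)) z = 0" for m
  proof (induction m)
    case 0
    then show ?case using z z1 by simp
  next
    case (Suc m)
    have "z * bessel_entire (\<nu> + real m + 2) z / of_real ((\<nu> + real m + 1) * (\<nu> + real m + 2)) = 0"
      using bessel_entire_contiguous[of "\<nu> + real m" z] Suc \<nu> by (simp add: add_ac)
    moreover have "of_real ((\<nu> + real m + 1) * (\<nu> + real m + 2)) \<noteq> (0 :: complex)"
      using \<nu> unfolding of_real_eq_0_iff by auto
    ultimately have "bessel_entire (\<nu> + real m + 2) z = 0" using z0 by (auto simp del: of_real_mult)
    then show ?case using Suc by (simp add: add_ac)
  qed
  then have "(deriv ^^ n) (bessel_entire \<nu>) z = 0" for n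
    unfolding bessel_entire_higher_deriv[OF \<nu>] by simp
  then have "bessel_entire \<nu> (0 :: complex) = 0"
    by (intro holomorphic_fun_eq_0_on_connected[OF bessel_entire_holomorphic[OF \<nu>], of UNIV z]) auto
  then show False by simp
qed

text \<open>For fixed \<open>\<mu>\<close>, \<open>U(x) = bessel_entire \<nu> (\<mu>x)\<close> satisfies \<open>(x\<^bsup>\<nu>+1\<^esup> U')' = \<mu> x\<^sup>\<nu> U\<close>, so
  \<open>x\<^bsup>\<nu>+1\<^esup> Im (U' cnj U)\<close> has derivative \<open>Im \<mu> x\<^sup>\<nu> |U|\<^sup>2\<close>. It vanishes at 0 and at the
  smallest positive zero of \<open>U\<close>, and Rolle's theorem yields a still smaller zero unless
  \<open>\<mu>\<close> is real.\<close>

lemma bessel_entire_zero_real: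
  assumes \<nu>: "\<nu> \<ge> - 1 / 2" and zero: "bessel_entire \<nu> (\<mu>::complex) = 0"
  shows "Im \<mu> = 0"
proof (rule ccontr)
  assume Im: "Im \<mu> \<noteq> 0"
  define U where "U x = bessel_entire \<nu> (\<mu> * complex_of_real x)" for x
  \<comment> \<open>\<open>V\<close> and \<open>W\<close> are the first and second derivatives of
    \<open>U\<close>, written through higher orders so that the contiguous relation supplies the
    differential equation.\<close>
  define V where "V x = \<mu> * bessel_entire (\<nu> + 1) (\<mu> * complex_of_real x) / of_real (\<nu> + 1)" for x
  define W where "W x = \<mu>\<^sup>2 * bessel_entire (\<nu> + 2) (\<mu> * complex_of_real x) / of_real ((\<nu> + 1) * (\<nu> + 2))" for x
  have U': "(U has_vector_derivative V x) (at x)" for x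
  proof -
    have "((\<lambda>z. bessel_entire \<nu> (\<mu> * z)) has_field_derivative V x) (at (complex_of_real x))"
      by (rule DERIV_cong[OF bessel_entire_deriv'[OF \<nu> DERIV_cmult_Id]]) (simp add: V_def)
    then show ?thesis unfolding U_def by (rule has_vector_derivative_real_field)
  qed
  have V': "(V has_vector_derivative W x) (at x)" for x
  proof -
    have \<nu>1: "\<nu> + 1 \<ge> - 1 / 2" using \<nu> by simp
    have "((\<lambda>z. \<mu> * bessel_entire (\<nu> + 1) (\<mu> * z) / of_real (\<nu> + 1)) has_field_derivative W x) (at (complex_of_real x))"
      by (rule DERIV_cong[OF DERIV_cdivide[OF DERIV_cmult[OF bessel_entire_deriv'[OF \<nu>1 DERIV_cmult_Id]]]])
         (simp add: W_def power2_eq_square add_ac mult_ac)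
    then show ?thesis unfolding V_def by (rule has_vector_derivative_real_field)
  qed
  have ode: "of_real (\<nu> + 1) * V x + of_real x * W x = \<mu> * U x" for x
  proof -
    have n: "of_real (\<nu> + 1) \<noteq> (0 :: complex)" using \<nu> unfolding of_real_eq_0_iff by auto
    show ?thesis
      using bessel_entire_contiguous[OF \<nu>, of "\<mu> * of_real x"] n
      by (simp add: U_def V_def W_def power2_eq_square algebra_simps del: of_real_add)
  qed
  have cU: "continuous_on A U" for A
    using U' by (meson continuous_at_imp_continuous_on has_vector_derivative_continuous)
  have cV: "continuous_on A V" for A
    using V' by (meson continuous_at_imp_continuous_on has_vector_derivative_continuous)
  define Z where "Z = {x \<in> {0..1}. U x = 0}"
  have "compact Z"
  proof -
    have "Z = {0..1} \<inter> U -` {0}" by (auto simp: Z_def)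
    then show ?thesis
      using continuous_on_closed_vimage[of "{0..1::real}" U] cU by (auto simp: compact_eq_bounded_closed Int_commute intro: bounded_subset[OF bounded_closed_interval])
  qed
  moreover have "1 \<in> Z" using zero by (simp add: Z_def U_def)
  ultimately obtain b where b: "b \<in> Z" "\<And>x. x \<in> Z \<Longrightarrow> b \<le> x"
    using compact_attains_inf[of Z] by blast
  have Ub: "U b = 0" and b01: "b \<in> {0..1}" using b(1) by (auto simp: Z_def)
  have "b \<noteq> 0" using Ub by (auto simp: U_def)
  then have b0: "b > 0" using b01 by simp
  define K where "K x = x powr (\<nu> + 1) * Im (V x * cnj (U x))" for x
  have K': "(K has_real_derivative x powr \<nu> * (Im \<mu> * (norm (U x))\<^sup>2)) (at x)" if x: "x > 0" for x
  proof -
    have "((\<lambda>x. V x * cnj (U x)) has_vector_derivative V x * cnj (V x) + W x * cnj (U x)) (at x)"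
      by (intro has_vector_derivative_mult V' has_vector_derivative_cnj U')
    from bounded_linear.has_vector_derivative[OF bounded_linear_Im this]
    have I: "((\<lambda>x. Im (V x * cnj (U x))) has_real_derivative Im (W x * cnj (U x))) (at x)"
      by (simp add: has_real_derivative_iff_has_vector_derivative)
    have "(K has_real_derivative (\<nu> + 1) * x powr \<nu> * Im (V x * cnj (U x)) + x powr (\<nu> + 1) * Im (W x * cnj (U x))) (at x)"
      unfolding K_def[abs_def]
      by (rule DERIV_cong[OF DERIV_mult[OF has_real_derivative_powr[OF x] I]])
         (simp only: add_diff_cancel_right' mult_ac)
    moreover have "(\<nu> + 1) * x powr \<nu> * Im (V x * cnj (U x)) + x powr (\<nu> + 1) * Im (W x * cnj (U x)) =
        x powr \<nu> * Im ((of_real (\<nu> + 1) * V x + of_real x * W x) * cnj (U x))"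
    proof -
      define a b where "a = V x * cnj (U x)" and "b = W x * cnj (U x)"
      have "(of_real (\<nu> + 1) * V x + of_real x * W x) * cnj (U x) = of_real (\<nu> + 1) * a + of_real x * b"
        by (simp add: a_def b_def distrib_right mult.assoc del: of_real_add)
      then have "Im ((of_real (\<nu> + 1) * V x + of_real x * W x) * cnj (U x)) = (\<nu> + 1) * Im a + x * Im b"
        by (simp del: of_real_add)
      then show ?thesis
        using x unfolding a_def[symmetric] b_def[symmetric] by (simp add: powr_add algebra_simps)
    qed
    moreover have "Im ((of_real (\<nu> + 1) * V x + of_real x * W x) * cnj (U x)) = Im \<mu> * (norm (U x))\<^sup>2"
      unfolding ode mult.assoc complex_norm_square[symmetric] by (simp flip: of_real_power)
    ultimately show ?thesis by simp
  qed
  \<comment> \<open>At 0 the positive exponent \<open>\<nu> + 1\<close> makes \<open>K\<close>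
    continuous and zero; at \<open>b\<close> it is \<open>U b = 0\<close> that makes
    \<open>K\<close> vanish.\<close>
  have "\<exists>x>0. x < b \<and> (K has_real_derivative 0) (at x)"
  proof (rule Rolle)
    show "continuous_on {0..b} K"
      unfolding K_def using \<nu> by (intro continuous_intros continuous_on_powr' cU cV) auto
    show "K 0 = K b" using \<nu> by (simp add: K_def Ub)
    show "K differentiable (at x)" if "0 < x" "x < b" for x
      using K'[OF that(1)] real_differentiable_def by blast
  qed (rule b0)
  then obtain x where x: "0 < x" "x < b" "(K has_real_derivative 0) (at x)" by blast
  have "x powr \<nu> * (Im \<mu> * (norm (U x))\<^sup>2) = 0" using DERIV_unique[OF K'[OF x(1)] x(3)] .
  then have "U x = 0" using Im x(1) by simp
  then have "x \<in> Z" using x b01 by (simp add: Z_def)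
  from b(2)[OF this] show False using x by simp
qed

text \<open>Real nonnegative arguments are excluded because all coefficients are positive and the
  constant term is 1.\<close>

lemma bessel_entire_zero_negative:
  assumes \<nu>: "\<nu> \<ge> - 1 / 2" and zero: "bessel_entire \<nu> (\<mu>::complex) = 0"
  obtains r where "r > 0" "\<mu> = of_real (- r)"
proof -
  have "\<mu> = of_real (Re \<mu>)" using bessel_entire_zero_real[OF \<nu> zero] by (simp add: complex_eq_iff)
  moreover have "Re \<mu> < 0"
  proof (rule ccontr)
    assume "\<not> Re \<mu> < 0"
    then have "bessel_entire \<nu> (Re \<mu>) \<ge> 1" using bessel_entire_ge_1[OF \<nu>] by simp
    moreover have "of_real (bessel_entire \<nu> (Re \<mu>)) = (0 :: complex)"
      using zero \<open>\<mu> = of_real (Re \<mu>)\<close> bessel_entire_of_real[OF \<nu>] by metis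
    ultimately show False by simp
  qed
  ultimately show ?thesis using that[of "- Re \<mu>"] by simp
qed

lemma Bessel_J_eq:
  assumes \<nu>: "\<nu> \<ge> - 1 / 2" and x: "x > 0"
  shows "Bessel_J \<nu> x = (x / 2) powr \<nu> / Gamma (\<nu> + 1) * bessel_entire \<nu> (- (x\<^sup>2 / 4))"
proof -
  have g: "Gamma (\<nu> + 1) > 0" using \<nu> by (intro Gamma_real_pos) auto
  have "(- 1) ^ k / (fact k * Gamma (real k + \<nu> + 1)) * (x / 2) powr (2 * real k + \<nu>) =
    (x / 2) powr \<nu> / Gamma (\<nu> + 1) * (of_real (bessel_coeff \<nu> k) * (- (x\<^sup>2 / 4)) ^ k)" for k
  proof -
    have "\<nu> + 1 \<notin> \<int>\<^sub>\<le>\<^sub>0" using \<nu> nonpos_Ints_nonpos[of "\<nu> + 1"] by auto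
    from pochhammer_Gamma[OF this, of k] have G: "Gamma (real k + \<nu> + 1) = pochhammer (\<nu> + 1) k * Gamma (\<nu> + 1)"
      using g by (simp add: add_ac)
    have "(x / 2) powr (2 * real k) = (x / 2) ^ (2 * k)"
      using x powr_realpow[of "x / 2" "2 * k"] by simp
    then have p: "(x / 2) powr (2 * real k + \<nu>) = (x\<^sup>2 / 4) ^ k * (x / 2) powr \<nu>"
      by (simp add: powr_add power_mult power_divide)
    have "(- (x\<^sup>2 / 4)) ^ k = (- 1) ^ k * (x\<^sup>2 / 4) ^ k" by (rule power_minus)
    then show ?thesis unfolding G p bessel_coeff_def by (simp add: mult_ac)
  qed
  then show ?thesis
    unfolding Bessel_J_def bessel_entire_def
    using suminf_mult[OF summable_bessel[OF \<nu>, of "- (x\<^sup>2 / 4)"], of "(x / 2) powr \<nu> / Gamma (\<nu> + 1)"]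
    by simp
qed

text \<open>The zeros of the entire function are exactly the numbers \<open>- (z k)^2 / 4\<close>;
  evaluating its product at the positive point \<open>x^2 / 4\<close> turns the factors into
  \<open>1 + x^2 / (z k)^2\<close>.\<close>

lemma bessel_product:
  assumes \<nu>: "\<nu> \<ge> - 1 / 2" and z: "lists_Bessel_zeros \<nu> z"
  shows "(\<lambda>n. \<Prod>k<n. 1 + x\<^sup>2 / (z k)\<^sup>2) \<longlonglongrightarrow> bessel_entire \<nu> (x\<^sup>2 / 4)"
proof -
  have mono: "strict_mono z" and rng: "range z = {x. 0 < x \<and> Bessel_J \<nu> x = 0}"
    using z by (auto simp: lists_Bessel_zeros_def)
  have zk: "z k > 0" "Bessel_J \<nu> (z k) = 0" for k using rng by (auto simp: set_eq_iff image_iff)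
  have J0: "Bessel_J \<nu> y = 0 \<longleftrightarrow> bessel_entire \<nu> (- (y\<^sup>2 / 4)) = 0" if "y > 0" for y
  proof -
    have "Gamma (\<nu> + 1) > 0" using \<nu> by (intro Gamma_real_pos) auto
    then show ?thesis using Bessel_J_eq[OF \<nu> that] that by simp
  qed
  define a where "a k = complex_of_real (- ((z k)\<^sup>2 / 4))" for k
  have "(\<lambda>n. \<Prod>k<n. 1 - complex_of_real (x\<^sup>2 / 4) / a k) \<longlonglongrightarrow> bessel_entire \<nu> (complex_of_real (x\<^sup>2 / 4))"
  proof (rule hadamard_product_order_half[where C = 2])
    show "bessel_entire \<nu> holomorphic_on UNIV" by (rule bessel_entire_holomorphic[OF \<nu>])
    show "norm (bessel_entire \<nu> z) \<le> exp (2 * sqrt (norm z))" for z :: complex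
      by (rule norm_bessel_entire_le[OF \<nu>])
    show "deriv (bessel_entire \<nu>) z \<noteq> 0" if "bessel_entire \<nu> z = 0" for z :: complex
    proof -
      have "of_real (\<nu> + 1) \<noteq> (0 :: complex)" using \<nu> unfolding of_real_eq_0_iff by auto
      then show ?thesis
        unfolding DERIV_imp_deriv[OF bessel_entire_deriv[OF \<nu>]] using bessel_entire_simple_zero[OF \<nu> that]
        by (simp del: of_real_add)
    qed
    show "strict_mono (\<lambda>n. norm (a n))"
    proof (rule strict_monoI)
      fix i j :: nat assume "i < j"
      then have "z i < z j" using mono by (simp add: strict_mono_def)
      then have "(z i)\<^sup>2 < (z j)\<^sup>2" using zk(1)[of i] by (intro power_strict_mono) auto
      then show "norm (a i) < norm (a j)" unfolding a_def norm_of_real by simp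
    qed
    show "range a = {w. bessel_entire \<nu> w = 0}"
    proof (intro set_eqI iffI)
      fix w assume "w \<in> range a"
      then obtain k where k: "w = a k" by auto
      have "bessel_entire \<nu> (- ((z k)\<^sup>2 / 4)) = 0" using J0[OF zk(1)] zk(2) by simp
      then show "w \<in> {w. bessel_entire \<nu> w = 0}" unfolding k a_def by (simp only: mem_Collect_eq bessel_entire_of_real[OF \<nu>] of_real_0)
    next
      fix w :: complex assume "w \<in> {w. bessel_entire \<nu> w = 0}"
      then have w0: "bessel_entire \<nu> w = 0" by simp
      then obtain r where r: "r > 0" "w = of_real (- r)" by (rule bessel_entire_zero_negative[OF \<nu>])
      define y where "y = 2 * sqrt r"
      have y: "y > 0" "y\<^sup>2 / 4 = r" using r(1) by (simp_all add: y_def power_mult_distrib)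
      have "bessel_entire \<nu> (- r) = 0"
        using w0 unfolding r(2) bessel_entire_of_real[OF \<nu>] by (simp only: of_real_eq_0_iff)
      then have "Bessel_J \<nu> y = 0" using J0[OF y(1)] y(2) by simp
      then have "y \<in> range z" using rng y(1) by simp
      then obtain k where "y = z k" by auto
      then have "w = a k" using y(2) r(2) by (simp add: a_def)
      then show "w \<in> range a" by simp
    qed
  qed simp_all
  moreover have "1 - complex_of_real (x\<^sup>2 / 4) / a k = complex_of_real (1 + x\<^sup>2 / (z k)\<^sup>2)" for k
    using zk(1)[of k] by (simp add: a_def)
  ultimately have "(\<lambda>n. complex_of_real (\<Prod>k<n. 1 + x\<^sup>2 / (z k)\<^sup>2)) \<longlonglongrightarrow> complex_of_real (bessel_entire \<nu> (x\<^sup>2 / 4))"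
    by (simp only: bessel_entire_of_real[OF \<nu>] of_real_prod)
  then show ?thesis by (rule tendsto_of_real_iff[THEN iffD1])
qed

section \<open>The Laplace transforms\<close>

lemma has_wiener_integral_cong:
  assumes Y: "has_wiener_integral M B f t Y" and eq: "\<And>s. s \<in> {0..t} \<Longrightarrow> f s = g s"
  shows "has_wiener_integral M B g t Y"
proof -
  have 1: "set_borel_measurable lborel {0..t} f = set_borel_measurable lborel {0..t} g"
    unfolding set_borel_measurable_def by (intro measurable_cong) (auto simp: eq indicator_def)
  have 2: "(\<integral>\<^sup>+s\<in>{0..t}. ennreal ((f s - k s)\<^sup>2) \<partial>lborel) = (\<integral>\<^sup>+s\<in>{0..t}. ennreal ((g s - k s)\<^sup>2) \<partial>lborel)" for k
    by (intro nn_integral_cong) (auto simp: eq indicator_def)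
  show ?thesis using Y unfolding has_wiener_integral_def 1 2 .
qed

text \<open>Supplies the variance function of the rescaled bridge. The logarithmic case
  \<open>\<beta> = - 1\<close> is the bridge with \<open>\<alpha> = 1 / 2\<close>.\<close>

lemma powr_primitive:
  fixes T \<beta> :: real
  obtains \<tau> where "\<And>t. t < T \<Longrightarrow> (\<tau> has_real_derivative (T - t) powr \<beta>) (at t)"
proof (cases "\<beta> = - 1")
  case True
  have "((\<lambda>t. - ln (T - t)) has_real_derivative (T - t) powr \<beta>) (at t)" if "t < T" for t
    using that True by (auto intro!: derivative_eq_intros simp: powr_minus divide_inverse)
  then show ?thesis by (rule that)
next
  case False
  then have \<beta>: "- (\<beta> + 1) \<noteq> 0" by simp
  have "((\<lambda>t. (T - t) powr (\<beta> + 1) / (- (\<beta> + 1))) has_real_derivative (T - t) powr \<beta>) (at t)" if "t < T" for t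
  proof -
    have "((\<lambda>t. (T - t) powr (\<beta> + 1)) has_real_derivative - (\<beta> + 1) * (T - t) powr \<beta>) (at t)"
      using that by (auto intro!: derivative_eq_intros simp: algebra_simps)
    from DERIV_cdivide[OF this, of "- (\<beta> + 1)"] show ?thesis
      unfolding nonzero_mult_div_cancel_left[OF \<beta>] .
  qed
  then show ?thesis by (rule that)
qed

text \<open>The kernel splits into \<open>(T - t) powr \<alpha>\<close> and
  \<open>(T - s) powr (- \<alpha>)\<close>, which is the factored form required of a Wiener integral
  above. Stopping at \<open>S < T\<close> keeps both factors positive and continuous.\<close>

lemma bridge_expectation_exp_quadratic:
  fixes G g \<phi> :: "real \<Rightarrow> real"
  assumes B: "wiener_process M {0..} B" and X: "alpha_wiener_bridge M B \<alpha> T X"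
    and S: "0 < S" "S < T"
    and \<phi>: "\<And>t. t \<in> {0..S} \<Longrightarrow> (\<phi> has_real_derivative G t * (T - t) powr (- 2 * \<alpha>)) (at t)"
      "\<And>t. t \<in> {0..S} \<Longrightarrow> \<phi> t > 0"
    and G: "\<And>t. t \<in> {0..S} \<Longrightarrow> (G has_real_derivative g t * \<phi> t) (at t)" "\<And>t. t \<in> {0..S} \<Longrightarrow> G t \<le> 0"
    and g: "continuous_on {0..S} g" "\<And>t. t \<in> {0..S} \<Longrightarrow> g t \<ge> 0"
  defines "F \<equiv> \<lambda>\<omega>. exp (- ((LBINT u:{0..S}. g u * (X u \<omega> / (T - u) powr \<alpha>)\<^sup>2) - G S / \<phi> S * (X S \<omega> / (T - S) powr \<alpha>)\<^sup>2) / 2)"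
  shows "F \<in> borel_measurable (completion M)" "path_expectation M F = sqrt (\<phi> S / \<phi> 0)"
proof -
  define Y where "Y t \<omega> = X t \<omega> / (T - t) powr \<alpha>" for t \<omega>
  have M: "prob_space M" using B by (simp add: wiener_process_def)
  obtain \<tau> where \<tau>: "\<And>t. t < T \<Longrightarrow> (\<tau> has_real_derivative (T - t) powr (- 2 * \<alpha>)) (at t)"
    using powr_primitive by blast
  have XI: "has_wiener_integral M B (\<lambda>s. (T - t) powr \<alpha> * (T - s) powr (- \<alpha>)) t (X t)" if "t \<in> {0..S}" for t
  proof (rule has_wiener_integral_cong)
    show "has_wiener_integral M B (\<lambda>s. ((T - t) / (T - s)) powr \<alpha>) t (X t)"
      using X that S by (auto simp: alpha_wiener_bridge_def)
    show "((T - t) / (T - s)) powr \<alpha> = (T - t) powr \<alpha> * (T - s) powr (- \<alpha>)" if "s \<in> {0..t}" for s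
    proof -
      have "((T - t) / (T - s)) powr \<alpha> = (T - t) powr \<alpha> / (T - s) powr \<alpha>"
        by (rule powr_divide)
      then show ?thesis by (simp add: powr_minus_divide)
    qed
  qed
  have gauss: "gaussian_increments M Y \<tau> S"
    unfolding Y_def
  proof (rule wiener_integral_gaussian_increments[OF B S(1) XI])
    show "continuous_on {0..S} (\<lambda>s. (T - s) powr (- \<alpha>))" using S by (intro continuous_intros) auto
    show "(\<tau> has_real_derivative ((T - t) powr (- \<alpha>))\<^sup>2) (at t)" if "t \<in> {0..S}" for t
      using \<tau>[of t] that S by (simp add: power2_eq_square powr_add[symmetric])
  qed (use S in auto)
  have mY: "Y t \<in> borel_measurable M" if "t \<in> {0..S}" for t
  proof -
    have [measurable]: "X t \<in> borel_measurable M" using XI[OF that] by (simp add: has_wiener_integral_def)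
    show ?thesis unfolding Y_def by measurable
  qed
  have cont: "AE \<omega> in M. continuous_on {0..S} (\<lambda>t. Y t \<omega>)"
  proof -
    have "AE \<omega> in M. continuous_on {0..T} (\<lambda>t. X t \<omega>)" using X by (simp add: alpha_wiener_bridge_def)
    then show ?thesis
    proof eventually_elim
      case (elim \<omega>)
      have "continuous_on {0..S} (\<lambda>t. X t \<omega>)" by (rule continuous_on_subset[OF elim]) (use S in auto)
      then show ?case unfolding Y_def using S by (intro continuous_intros) auto
    qed
  qed
  have h0: "(T - t) powr (- 2 * \<alpha>) > 0" if "t \<in> {0..S}" for t using that S by simp
  have \<tau>': "(\<tau> has_real_derivative (T - t) powr (- 2 * \<alpha>)) (at t)" if "t \<in> {0..S}" for t
    using \<tau> that S by simp
  show "F \<in> borel_measurable (completion M)" "path_expectation M F = sqrt (\<phi> S / \<phi> 0)"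
    using path_expectation_exp_quadratic[OF M S(1) mY cont gauss \<tau>' h0 \<phi> G g]
    unfolding F_def Y_def by blast+
qed

lemma set_integral_power2_nonneg:
  fixes f :: "real \<Rightarrow> real"
  shows "0 \<le> (LBINT u:A. (f u)\<^sup>2)"
  unfolding set_lebesgue_integral_def by (intro Bochner_Integration.integral_nonneg) auto

text \<open>On \<open>{0..S}\<close> the identity still carries a boundary term in
  \<open>X S\<close>. Its coefficient tends to 0 as \<open>S\<close> tends to \<open>T\<close>,
  because \<open>\<phi>\<close> is regular at \<open>T\<close>, and \<open>\<phi> T = 1\<close>
  leaves \<open>1 / sqrt (\<phi> 0)\<close>.\<close>

lemma bridge_laplace_transform:
  assumes B: "wiener_process M {0..} B" and X: "alpha_wiener_bridge M B \<alpha> T X"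
    and T: "T > 0" and \<alpha>: "\<alpha> > 0" and c: "c \<ge> 0"
  shows "path_expectation M (\<lambda>\<omega>. exp (- c * (LBINT u:{0..T}. (X u \<omega>)\<^sup>2))) =
    1 / sqrt (bessel_entire (\<alpha> - 1 / 2) (c * T\<^sup>2 / 2))"
proof -
  define \<nu> where "\<nu> = \<alpha> - 1 / 2"
  have \<nu>: "\<nu> \<ge> - 1 / 2" "\<nu> + 1 \<ge> - 1 / 2" "\<nu> + 1 > 0" using \<alpha> by (simp_all add: \<nu>_def)
  define \<phi> where "\<phi> t = bessel_entire \<nu> (c / 2 * (T - t)\<^sup>2)" for t
  define \<psi> where "\<psi> t = bessel_entire (\<nu> + 1) (c / 2 * (T - t)\<^sup>2) / (\<nu> + 1)" for t
  \<comment> \<open>This is \<open>\<phi>'\<close> divided by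
    \<open>(T - t) powr (- 2 * \<alpha>)\<close>; the exponent \<open>2 * \<nu> + 2\<close> equals
    \<open>2 * \<alpha> + 1\<close>.\<close>
  define G where "G t = - c * (T - t) powr (2 * \<nu> + 2) * \<psi> t" for t
  have \<phi>1: "\<phi> t \<ge> 1" for t unfolding \<phi>_def using c by (intro bessel_entire_ge_1 \<nu>) simp
  have \<psi>0: "\<psi> t \<ge> 0" for t
    unfolding \<psi>_def using c bessel_entire_ge_1[OF \<nu>(2), of "c / 2 * (T - t)\<^sup>2"] \<nu>(3) by simp
  have inner: "((\<lambda>t. c / 2 * (T - t)\<^sup>2) has_real_derivative - c * (T - t)) (at t)" for t
    by (auto intro!: derivative_eq_intros simp: field_simps)
  have \<phi>': "(\<phi> has_real_derivative - c * (T - t) * \<psi> t) (at t)" for t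
    unfolding \<phi>_def \<psi>_def by (rule DERIV_cong[OF bessel_entire_deriv'[OF \<nu>(1) inner]]) simp
  have \<psi>': "(\<psi> has_real_derivative - c * (T - t) * (bessel_entire (\<nu> + 2) (c / 2 * (T - t)\<^sup>2) / ((\<nu> + 1) * (\<nu> + 2)))) (at t)" for t
    unfolding \<psi>_def
    by (rule DERIV_cong[OF DERIV_cdivide[OF bessel_entire_deriv'[OF \<nu>(2) inner]]]) (simp add: add_ac mult_ac)
  have G': "(G has_real_derivative 2 * c * (T - t) powr (2 * \<alpha>) * \<phi> t) (at t)" if t: "t < T" for t
  proof -
    define s where "s = T - t"
    define R where "R = bessel_entire (\<nu> + 2) (c / 2 * s\<^sup>2) / ((\<nu> + 1) * (\<nu> + 2))"
    have s: "s > 0" using t by (simp add: s_def)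
    have p: "s powr (2 * \<nu> + 2) = s * s powr (2 * \<alpha>)" "s powr (2 * \<nu> + 2 - 1) = s powr (2 * \<alpha>)"
      using s powr_add[of s "2 * \<alpha>" 1] by (simp_all add: \<nu>_def algebra_simps)
    \<comment> \<open>The contiguous relation plays the part of the differential equation: the two
      terms of the product rule for \<open>G\<close> combine into a multiple of
      \<open>\<phi>\<close>.\<close>
    have cont: "\<phi> t = (\<nu> + 1) * \<psi> t + c / 2 * s\<^sup>2 * R"
      using bessel_entire_contiguous[OF \<nu>(1), of "c / 2 * s\<^sup>2"] \<nu>(3) by (simp add: \<phi>_def \<psi>_def R_def s_def)
    have "((\<lambda>t. (T - t) powr (2 * \<nu> + 2)) has_real_derivative - (2 * \<nu> + 2) * s powr (2 * \<nu> + 2 - 1)) (at t)"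
      using t by (auto intro!: derivative_eq_intros simp: s_def algebra_simps)
    from DERIV_mult[OF DERIV_cmult[OF this, of "- c"] \<psi>']
    have "(G has_real_derivative (- c * (- (2 * \<nu> + 2) * s powr (2 * \<nu> + 2 - 1)) * \<psi> t + - c * s * R * (- c * s powr (2 * \<nu> + 2)))) (at t)"
      unfolding G_def[abs_def] R_def s_def .
    moreover have "- c * (- (2 * \<nu> + 2) * s powr (2 * \<nu> + 2 - 1)) * \<psi> t + - c * s * R * (- c * s powr (2 * \<nu> + 2)) =
      2 * c * s powr (2 * \<alpha>) * \<phi> t"
      unfolding p cont by (simp add: power2_eq_square algebra_simps)
    ultimately show ?thesis by (simp add: s_def)
  qed
  define S where "S n = T * (real n + 1) / (real n + 2)" for n
  have S: "0 < S n" "S n < T" for n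
  proof -
    show "0 < S n" unfolding S_def using T by (intro divide_pos_pos mult_pos_pos) auto
    show "S n < T" using T by (simp add: S_def field_simps)
  qed
  have Slim: "S \<longlonglongrightarrow> T" unfolding S_def using T by real_asymp
  \<comment> \<open>Minus the boundary coefficient \<open>G / \<phi>\<close> after the division of
    \<open>X\<close> by \<open>(T - S n) powr \<alpha>\<close> is undone. The remaining factor
    \<open>T - S n\<close> drives it to 0.\<close>
  define r where "r n = c * (T - S n) * \<psi> (S n) / \<phi> (S n)" for n
  define F where "F n \<omega> = exp (- c * (LBINT u:{0..S n}. (X u \<omega>)\<^sup>2) - r n * (X (S n) \<omega>)\<^sup>2 / 2)" for n \<omega>
  have F: "F n \<in> borel_measurable (completion M)" "path_expectation M (F n) = sqrt (\<phi> (S n) / \<phi> 0)" for n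
  proof -
    have mem: "t < T" if "t \<in> {0..S n}" for t using that S[of n] by simp
    have \<phi>G: "(\<phi> has_real_derivative G t * (T - t) powr (- 2 * \<alpha>)) (at t)" if "t \<in> {0..S n}" for t
    proof -
      have "(T - t) powr (2 * \<nu> + 2) * (T - t) powr (- 2 * \<alpha>) = T - t"
        using mem[OF that] by (simp add: powr_add[symmetric] \<nu>_def)
      then have "G t * (T - t) powr (- 2 * \<alpha>) = - c * (T - t) * \<psi> t" by (simp add: G_def)
      then show ?thesis using \<phi>' by simp
    qed
    have I: "(LBINT u:{0..S n}. 2 * c * (T - u) powr (2 * \<alpha>) * (X u \<omega> / (T - u) powr \<alpha>)\<^sup>2) =
       2 * c * (LBINT u:{0..S n}. (X u \<omega>)\<^sup>2)" for \<omega>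
    proof -
      have "(LBINT u:{0..S n}. 2 * c * (T - u) powr (2 * \<alpha>) * (X u \<omega> / (T - u) powr \<alpha>)\<^sup>2) =
        (LBINT u:{0..S n}. 2 * c * (X u \<omega>)\<^sup>2)"
      proof (intro set_lebesgue_integral_cong allI impI)
        fix u assume "u \<in> {0..S n}"
        then have "(T - u) powr \<alpha> > 0" "(T - u) powr (2 * \<alpha>) = ((T - u) powr \<alpha>)\<^sup>2"
          using mem[of u] by (simp_all add: power2_eq_square powr_add[symmetric])
        then show "2 * c * (T - u) powr (2 * \<alpha>) * (X u \<omega> / (T - u) powr \<alpha>)\<^sup>2 = 2 * c * (X u \<omega>)\<^sup>2"
          by (simp add: power_divide)
      qed simp
      then show ?thesis by simp
    qed
    have E: "G (S n) / \<phi> (S n) * (X (S n) \<omega> / (T - S n) powr \<alpha>)\<^sup>2 = - r n * (X (S n) \<omega>)\<^sup>2" for \<omega>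
    proof -
      have "(T - S n) powr (2 * \<nu> + 2) = (T - S n) * ((T - S n) powr \<alpha>)\<^sup>2"
        using S[of n] powr_add[of "T - S n" "2 * \<alpha>" 1] powr_add[of "T - S n" \<alpha> \<alpha>]
        by (simp add: \<nu>_def power2_eq_square algebra_simps)
      then show ?thesis using S[of n] by (simp add: G_def r_def power_divide)
    qed
    have Feq: "F n = (\<lambda>\<omega>. exp (- ((LBINT u:{0..S n}. 2 * c * (T - u) powr (2 * \<alpha>) * (X u \<omega> / (T - u) powr \<alpha>)\<^sup>2)
       - G (S n) / \<phi> (S n) * (X (S n) \<omega> / (T - S n) powr \<alpha>)\<^sup>2) / 2))"
      unfolding F_def I E by (simp add: fun_eq_iff field_simps)
    have \<phi>p: "\<phi> t > 0" for t using \<phi>1[of t] by simp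
    have Gn: "G t \<le> 0" for t unfolding G_def using c \<psi>0[of t] by simp
    have gc: "continuous_on {0..S n} (\<lambda>t. 2 * c * (T - t) powr (2 * \<alpha>))"
      using mem by (intro continuous_intros) force
    have gp: "2 * c * (T - t) powr (2 * \<alpha>) \<ge> 0" for t using c by simp
    show "F n \<in> borel_measurable (completion M)" "path_expectation M (F n) = sqrt (\<phi> (S n) / \<phi> 0)"
      unfolding Feq
      using bridge_expectation_exp_quadratic[OF B X S[of n] \<phi>G \<phi>p G'[OF mem] Gn gc gp] by blast+
  qed
  have c\<phi>: "isCont \<phi> t" "isCont \<psi> t" for t using \<phi>' \<psi>' by (auto intro: DERIV_isCont)
  have lim\<phi>: "(\<lambda>n. \<phi> (S n)) \<longlonglongrightarrow> \<phi> T" "(\<lambda>n. \<psi> (S n)) \<longlonglongrightarrow> \<psi> T"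
    by (rule isCont_tendsto_compose[OF c\<phi>(1) Slim] isCont_tendsto_compose[OF c\<phi>(2) Slim])+
  have \<phi>T: "\<phi> T = 1" by (simp add: \<phi>_def)
  have rlim: "r \<longlonglongrightarrow> c * (T - T) * \<psi> T / \<phi> T"
    unfolding r_def by (intro tendsto_intros lim\<phi> Slim) (simp add: \<phi>T)
  have "path_expectation M (\<lambda>\<omega>. exp (- c * (LBINT u:{0..T}. (X u \<omega>)\<^sup>2))) = sqrt (\<phi> T / \<phi> 0)"
  proof (rule path_expectation_limit(2)[OF _ F(1)])
    show "prob_space M" using B by (simp add: wiener_process_def)
    show "AE \<omega> in M. \<bar>F n \<omega>\<bar> \<le> 1" for n
    proof (intro AE_I2)
      fix \<omega>
      have "c * (LBINT u:{0..S n}. (X u \<omega>)\<^sup>2) \<ge> 0" using c by (intro mult_nonneg_nonneg set_integral_power2_nonneg)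
      moreover have "r n \<ge> 0" unfolding r_def using c S[of n] \<psi>0[of "S n"] \<phi>1[of "S n"]
        by (intro divide_nonneg_nonneg mult_nonneg_nonneg) auto
      then have "r n * (X (S n) \<omega>)\<^sup>2 \<ge> 0" by simp
      ultimately show "\<bar>F n \<omega>\<bar> \<le> 1" by (simp add: F_def)
    qed
    have "AE \<omega> in M. continuous_on {0..T} (\<lambda>t. X t \<omega>)" using X by (simp add: alpha_wiener_bridge_def)
    then show "AE \<omega> in M. (\<lambda>n. F n \<omega>) \<longlonglongrightarrow> exp (- c * (LBINT u:{0..T}. (X u \<omega>)\<^sup>2))"
    proof eventually_elim
      case (elim \<omega>)
      have c2: "continuous_on {0..T} (\<lambda>t. (X t \<omega>)\<^sup>2)" by (intro continuous_intros elim)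
      have SnT: "eventually (\<lambda>n. S n \<in> {0..T}) sequentially" using S by (auto intro!: always_eventually less_imp_le)
      have "continuous_on {0..T} (\<lambda>t. integral {0..t} (\<lambda>t. (X t \<omega>)\<^sup>2))"
        using c2 by (intro indefinite_integral_continuous_1 integrable_continuous_interval)
      then have "(\<lambda>n. integral {0..S n} (\<lambda>t. (X t \<omega>)\<^sup>2)) \<longlonglongrightarrow> integral {0..T} (\<lambda>t. (X t \<omega>)\<^sup>2)"
        using continuous_on_tendsto_compose[OF _ Slim _ SnT] T by simp
      moreover have "(LBINT u:{0..S n}. (X u \<omega>)\<^sup>2) = integral {0..S n} (\<lambda>t. (X t \<omega>)\<^sup>2)" for n
        using c2 S[of n] by (intro LBINT_eq_integral) (auto intro: continuous_on_subset)
      ultimately have 1: "(\<lambda>n. LBINT u:{0..S n}. (X u \<omega>)\<^sup>2) \<longlonglongrightarrow> (LBINT u:{0..T}. (X u \<omega>)\<^sup>2)"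
        by (simp add: LBINT_eq_integral[OF c2])
      have 2: "(\<lambda>n. X (S n) \<omega>) \<longlonglongrightarrow> X T \<omega>"
        using continuous_on_tendsto_compose[OF elim Slim _ SnT] T by simp
      have "(\<lambda>n. F n \<omega>) \<longlonglongrightarrow> exp (- c * (LBINT u:{0..T}. (X u \<omega>)\<^sup>2) - (c * (T - T) * \<psi> T / \<phi> T) * (X T \<omega>)\<^sup>2 / 2)"
        unfolding F_def by (intro tendsto_intros 1 2 rlim) auto
      then show ?case by simp
    qed
    show "(\<lambda>n. path_expectation M (F n)) \<longlonglongrightarrow> sqrt (\<phi> T / \<phi> 0)"
      unfolding F(2) using \<phi>1[of 0] by (intro tendsto_intros lim\<phi>) auto
  qed
  then show ?thesis unfolding \<phi>T by (simp add: \<phi>_def \<nu>_def real_sqrt_divide)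
qed

text \<open>For constant weight the equation is \<open>\<phi>'' = 2 * c * \<phi>\<close>; centring
  the hyperbolic cosine at 1 gives \<open>\<phi>' = 0\<close> there, so the boundary term
  disappears.\<close>

lemma wiener_laplace_transform:
  assumes X: "wiener_process M {0..1} X" and c: "c \<ge> 0"
  shows "path_expectation M (\<lambda>\<omega>. exp (- c * (LBINT u:{0..1}. (X u \<omega>)\<^sup>2))) = 1 / sqrt (cosh (sqrt (2 * c)))"
proof -
  define k where "k = sqrt (2 * c)"
  have k: "k \<ge> 0" "k * k = 2 * c" using c by (simp_all add: k_def)
  define \<phi> where "\<phi> t = cosh (k * (1 - t))" for t
  define G where "G t = - k * sinh (k * (1 - t))" for t
  have M: "prob_space M" using X by (simp add: wiener_process_def)
  have \<phi>': "(\<phi> has_real_derivative G t * 1) (at t)" for t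
    unfolding \<phi>_def G_def by (auto intro!: derivative_eq_intros)
  have G': "(G has_real_derivative 2 * c * \<phi> t) (at t)" for t
    unfolding \<phi>_def G_def k(2)[symmetric] by (auto intro!: derivative_eq_intros)
  have Gn: "G t \<le> 0" if "t \<in> {0..1}" for t
    unfolding G_def using k(1) that by (simp add: sinh_real_nonneg_iff)
  have \<phi>p: "\<phi> t > 0" for t unfolding \<phi>_def by (rule cosh_real_pos)
  have "path_expectation M (\<lambda>\<omega>. exp (- ((LBINT u:{0..1}. 2 * c * (X u \<omega>)\<^sup>2) - G 1 / \<phi> 1 * (X 1 \<omega>)\<^sup>2) / 2)) = sqrt (\<phi> 1 / \<phi> 0)"
  proof (rule path_expectation_exp_quadratic(2)[OF M, where h = "\<lambda>_. 1"])
    show "gaussian_increments M X (\<lambda>t. t) 1" using X by (rule wiener_gaussian_increments) simp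
  qed (use X \<phi>' G' Gn \<phi>p c in \<open>auto simp: wiener_process_def\<close>)
  then show ?thesis by (simp add: G_def \<phi>_def k_def real_sqrt_divide)
qed

text \<open>For \<open>\<alpha> = 1 / 2\<close> both the variance density and the weight of the
  rescaled process are multiples of \<open>1 / (T - t)\<close>, so in the logarithmic time
  \<open>l\<close> the equation has constant coefficients. Normalizing \<open>l S = 0\<close> makes
  \<open>G S = 0\<close> and removes the boundary term.\<close>

lemma half_bridge_weighted_laplace_transform:
  assumes B: "wiener_process M {0..} B" and X: "alpha_wiener_bridge M B (1 / 2) T X"
    and S: "0 < S" "S < T" and c: "c \<ge> 0"
  shows "path_expectation M (\<lambda>\<omega>. exp (- c * (LBINT u:{0..S}. (X u \<omega>)\<^sup>2 / (T - u)\<^sup>2))) =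
    1 / sqrt (cosh (sqrt (2 * c) * ln (T / (T - S))))"
proof -
  define k where "k = sqrt (2 * c)"
  have k: "k \<ge> 0" "k * k = 2 * c" using c by (simp_all add: k_def)
  define l where "l t = ln (T - t) - ln (T - S)" for t
  define \<phi> where "\<phi> t = cosh (k * l t)" for t
  define G where "G t = - k * sinh (k * l t)" for t
  have mem: "t < T" if "t \<in> {0..S}" for t using that S by simp
  have l': "(l has_real_derivative - (1 / (T - t))) (at t)" if "t \<in> {0..S}" for t
    unfolding l_def using mem[OF that] S by (auto intro!: derivative_eq_intros)
  have h: "(T - t) powr (- 2 * (1 / 2)) = 1 / (T - t)" if "t \<in> {0..S}" for t
    using powr_neg_one[of "T - t"] mem[OF that] by simp
  have \<phi>': "(\<phi> has_real_derivative G t * (T - t) powr (- 2 * (1 / 2))) (at t)" if "t \<in> {0..S}" for t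
    unfolding \<phi>_def G_def h[OF that] by (auto intro!: derivative_eq_intros l' that)
  have G': "(G has_real_derivative (k * k) / (T - t) * \<phi> t) (at t)" if "t \<in> {0..S}" for t
    unfolding \<phi>_def G_def by (auto intro!: derivative_eq_intros l' that)
  have Gn: "G t \<le> 0" if "t \<in> {0..S}" for t
  proof -
    have "l t \<ge> 0" unfolding l_def using that S by simp
    then show ?thesis unfolding G_def using k(1) by (simp add: sinh_real_nonneg_iff)
  qed
  have \<phi>p: "\<phi> t > 0" for t unfolding \<phi>_def by (rule cosh_real_pos)
  have gc: "continuous_on {0..S} (\<lambda>t. (k * k) / (T - t))" using mem by (intro continuous_intros) force
  have gp: "(k * k) / (T - t) \<ge> 0" if "t \<in> {0..S}" for t using mem[OF that] by simp
  have I: "(LBINT u:{0..S}. (k * k) / (T - u) * (X u \<omega> / (T - u) powr (1 / 2))\<^sup>2) =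
     2 * c * (LBINT u:{0..S}. (X u \<omega>)\<^sup>2 / (T - u)\<^sup>2)" for \<omega>
  proof -
    have "(LBINT u:{0..S}. (k * k) / (T - u) * (X u \<omega> / (T - u) powr (1 / 2))\<^sup>2) =
      (LBINT u:{0..S}. 2 * c * ((X u \<omega>)\<^sup>2 / (T - u)\<^sup>2))"
    proof (intro set_lebesgue_integral_cong allI impI)
      fix u assume "u \<in> {0..S}"
      then have "T - u > 0" using mem[of u] by simp
      then show "(k * k) / (T - u) * (X u \<omega> / (T - u) powr (1 / 2))\<^sup>2 = 2 * c * ((X u \<omega>)\<^sup>2 / (T - u)\<^sup>2)"
        by (simp add: k(2) powr_half_sqrt power_divide power2_eq_square)
    qed simp
    then show ?thesis by (simp only: set_integral_mult_right)
  qed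
  have "path_expectation M (\<lambda>\<omega>. exp (- ((LBINT u:{0..S}. (k * k) / (T - u) * (X u \<omega> / (T - u) powr (1 / 2))\<^sup>2)
      - G S / \<phi> S * (X S \<omega> / (T - S) powr (1 / 2))\<^sup>2) / 2)) = sqrt (\<phi> S / \<phi> 0)"
    by (rule bridge_expectation_exp_quadratic(2)[OF B X S \<phi>' \<phi>p G' Gn gc gp])
  moreover have "l 0 = ln (T / (T - S))" unfolding l_def using S by (simp add: ln_div)
  moreover have "l S = 0" by (simp add: l_def)
  ultimately show ?thesis unfolding I by (simp add: G_def \<phi>_def k_def real_sqrt_divide)
qed

theorem proposition3p1:
  fixes M :: "'a measure" and B :: "real \<Rightarrow> 'a \<Rightarrow> real" and T \<alpha> \<nu> :: real
  assumes "wiener_process M {0..} B"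
    and "T > 0" and "\<alpha> > 0" and "\<nu> = \<alpha> - 1 / 2"
  shows
    "(\<forall>X z. alpha_wiener_bridge M B \<alpha> T X \<and> lists_Bessel_zeros \<nu> z \<longrightarrow>
        (\<forall>c\<ge>0. (\<lambda>k. 1 / sqrt (1 + 2 * c * T\<^sup>2 / (z k)\<^sup>2)) has_prod
           path_expectation M (\<lambda>\<omega>. exp (- c * (LBINT u:{0..T}. (X u \<omega>)\<^sup>2))))) \<and>
     (\<forall>X. wiener_process M {0..1} X \<longrightarrow>
        (\<forall>c\<ge>0. path_expectation M (\<lambda>\<omega>. exp (- c * (LBINT u:{0..1}. (X u \<omega>)\<^sup>2))) =
           1 / sqrt (cosh (sqrt (2 * c))))) \<and>
     (\<forall>X. alpha_wiener_bridge M B 1 1 X \<longrightarrow>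
        (\<forall>c>0. path_expectation M (\<lambda>\<omega>. exp (- c * (LBINT u:{0..1}. (X u \<omega>)\<^sup>2))) =
           sqrt (sqrt (2 * c) / sinh (sqrt (2 * c))))) \<and>
     (\<forall>X. alpha_wiener_bridge M B (1 / 2) T X \<longrightarrow>
        (\<forall>S. 0 < S \<and> S < T \<longrightarrow>
          (\<forall>c\<ge>0. path_expectation M (\<lambda>\<omega>. exp (- c * (LBINT u:{0..S}. (X u \<omega>)\<^sup>2 / (T - u)\<^sup>2))) =
             1 / sqrt (cosh (sqrt (2 * c) * ln (T / (T - S)))))))"
proof (intro conjI allI impI; (elim conjE)?)
  fix X z and c :: real
  assume X: "alpha_wiener_bridge M B \<alpha> T X" and z: "lists_Bessel_zeros \<nu> z" and c: "c \<ge> 0"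
  have \<nu>: "\<nu> \<ge> - 1 / 2" using assms by simp
  define L where "L = bessel_entire \<nu> (c * T\<^sup>2 / 2)"
  have L1: "L \<ge> 1" unfolding L_def using c by (intro bessel_entire_ge_1 \<nu>) auto
  have x2: "(sqrt (2 * c) * T)\<^sup>2 = 2 * c * T\<^sup>2" using c by (simp add: power_mult_distrib)
  have "(\<lambda>n. \<Prod>k<n. 1 + 2 * c * T\<^sup>2 / (z k)\<^sup>2) \<longlonglongrightarrow> L"
    using bessel_product[OF \<nu> z, of "sqrt (2 * c) * T"] unfolding x2 by (simp add: L_def)
  then have "(\<lambda>n. 1 / sqrt (\<Prod>k<n. 1 + 2 * c * T\<^sup>2 / (z k)\<^sup>2)) \<longlonglongrightarrow> 1 / sqrt L"
    using L1 by (intro tendsto_intros) auto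
  moreover have "1 / sqrt (\<Prod>k<n. f k) = (\<Prod>k<n. 1 / sqrt (f k))" for f :: "nat \<Rightarrow> real" and n
    by (induction n) (simp_all add: real_sqrt_mult divide_inverse)
  ultimately have "(\<lambda>n. \<Prod>k<n. 1 / sqrt (1 + 2 * c * T\<^sup>2 / (z k)\<^sup>2)) \<longlonglongrightarrow> 1 / sqrt L"
    by (simp only:)
  \<comment> \<open>\<open>raw_has_prod\<close> uses partial products up to and including index
    \<open>n\<close>, hence the shift; the limit must be nonzero, which \<open>L \<ge> 1\<close>
    guarantees.\<close>
  from LIMSEQ_Suc[OF this] L1 have "raw_has_prod (\<lambda>k. 1 / sqrt (1 + 2 * c * T\<^sup>2 / (z k)\<^sup>2)) 0 (1 / sqrt L)"
    by (simp add: raw_has_prod_def lessThan_Suc_atMost)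
  then show "(\<lambda>k. 1 / sqrt (1 + 2 * c * T\<^sup>2 / (z k)\<^sup>2)) has_prod
           path_expectation M (\<lambda>\<omega>. exp (- c * (LBINT u:{0..T}. (X u \<omega>)\<^sup>2)))"
    unfolding bridge_laplace_transform[OF assms(1) X assms(2,3) c] assms(4)[symmetric] L_def[symmetric] has_prod_def
    by (rule disjI1)
next
  fix X and c :: real
  assume X: "alpha_wiener_bridge M B 1 1 X" and c: "c > 0"
  define k where "k = sqrt (2 * c)"
  have "path_expectation M (\<lambda>\<omega>. exp (- c * (LBINT u:{0..1}. (X u \<omega>)\<^sup>2))) =
      1 / sqrt (bessel_entire (1 - 1 / 2) (c * 1\<^sup>2 / 2))"
    by (rule bridge_laplace_transform[OF assms(1) X]) (use c in auto)
  also have "1 - 1 / 2 = (1 / 2 :: real)" by simp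
  also have "c * 1\<^sup>2 / 2 = k\<^sup>2 / 4" using c by (simp add: k_def)
  \<comment> \<open>Here \<open>c > 0\<close> is essential: it makes \<open>k\<close> nonzero, as
    the quotient \<open>sinh k / k\<close> demands.\<close>
  also have "bessel_entire (1 / 2) (k\<^sup>2 / 4) = sinh k / k"
    by (rule bessel_entire_half) (use c in \<open>simp add: k_def\<close>)
  also have "1 / sqrt (sinh k / k) = sqrt (k / sinh k)" by (simp add: real_sqrt_divide)
  finally show "path_expectation M (\<lambda>\<omega>. exp (- c * (LBINT u:{0..1}. (X u \<omega>)\<^sup>2))) = sqrt (sqrt (2 * c) / sinh (sqrt (2 * c)))"
    unfolding k_def .
next
  fix X and c :: real
  assume "wiener_process M {0..1} X" and "c \<ge> 0"
  then show "path_expectation M (\<lambda>\<omega>. exp (- c * (LBINT u:{0..1}. (X u \<omega>)\<^sup>2))) = 1 / sqrt (cosh (sqrt (2 * c)))"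
    by (rule wiener_laplace_transform)
next
  fix X and S c :: real
  assume "alpha_wiener_bridge M B (1 / 2) T X" "0 < S" "S < T" "c \<ge> 0"
  then show "path_expectation M (\<lambda>\<omega>. exp (- c * (LBINT u:{0..S}. (X u \<omega>)\<^sup>2 / (T - u)\<^sup>2))) =
             1 / sqrt (cosh (sqrt (2 * c) * ln (T / (T - S))))"
    by (rule half_bridge_weighted_laplace_transform[OF assms(1)])
qed

end
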